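(* Let $\lambda>0$, let $m\geq 1$ be an integer, and let $f:V\to V$ be a $C^1$-function satisfying (A1) $f(\gamma u)=\gamma f(u)$ for all $\gamma\in\Gamma$, $u\in V$; (A2) $f(-u)=-f(u)$ for all $u\in V$; (A3) there exists $M>0$ such that for all $u\in V$, $|u|>M$ implies $u\bullet f(u)>0$. Set $H=\mathbb{Z}_{2m}^d$ and assume that $k^2+\lambda^2\mu\neq 0$ (i.e. $\lambda^2\neq -k^2/\mu$) for every positive odd multiple $k$ of $m$ and every $\mu\in\sigma(Df(0))$. If the equivariant invariant $\omega^H\in A(G)$ is not zero, then the system $$\ddot x(t)=\lambda^2 f(x(t)),\qquad x(t)=x(t+2\pi),\quad \dot x(t)=\dot x(t+2\pi),\qquad t\in\mathbb{R},\ x(t)\in V,\qquad ( * )$$ admits a non-constant $2\pi$-periodic solution. More precisely, if $$\omega^H=n_1(H_1)+n_2(H_2)+\dots+n_r(H_r),\qquad n_j\neq 0,\quad j=1,\dots,r,$$ then for every $j$ there exists a non-constant $2\pi$-periodic solution $x$ of $( * )$ such that $G_x\geq H_j$.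
   Context: **Setting.** $\Gamma$ is a finite group and $V=\mathbb{R}^n$ is an orthogonal $\Gamma$-representation, with $\Gamma$ acting by permuting coordinates; $\bullet$, $|\cdot|$ are the Euclidean inner product and norm; $\sigma$ denotes spectrum. $\mathbb{Z}_2=\{1,-1\}$. $G=\Gamma\times\mathbb{Z}_2\times O(2)$, where $O(2)=SO(2)\cup SO(2)\kappa$, $\kappa=\mathrm{diag}(1,-1)$, and rotations are written $e^{i\tau}\in S^1$. $\mathscr{H}=H^2(S^1;V)$ is the Sobolev space of $2\pi$-periodic $H^2$ functions $\mathbb{R}\to V$, with norm from $\langle x,y\rangle=\int_0^{2\pi}(\ddot x\bullet\ddot y+\dot x\bullet\dot y+x\bullet y)\,dt$; it is an orthogonal $G$-representation via $$(\gamma,\pm1,e^{i\tau})x(t)=\pm\gamma x(t+\tau),\qquad (\gamma,\pm1,e^{i\tau}\kappa)x(t)=\pm\gamma x(-t+\tau).$$ $G_x$ is the isotropy group of $x$. For a subgroup $K\leq G$, $\mathscr{H}^K$ is the subspace of $K$-fixed points, and $U^K:=U\cap\mathscr{H}^K$ for $U\subset\mathscr{H}$. **The map.** With $L:\mathscr{H}\to L^2(S^1;V)$, $Lx=\ddot x-x$ (an isomorphism), put $\mathscr{F}_\tau(x)=x-\tau L^{-1}(\lambda^2f(x)-x)$ for $\tau\in[0,1]$ and $\mathscr{F}=\mathscr{F}_1$, a $G$-equivariant completely continuous field; zeros of $\mathscr{F}$ are exactly the solutions of $( * )$. **The group $H$.** $\mathbb{Z}_{2m}^d\leq G$ is the cyclic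 group of order $2m$ generated by $(e,-1,e^{i\pi/m})$ ($e$ the identity of $\Gamma$). It is normal in $G$, so $\mathscr{H}^H$ is a $G$-representation, consisting of the $x\in\mathscr{H}$ with $x(t)=-x(t+\pi/m)$; $\mathscr{F}^H:=\mathscr{F}|_{\mathscr{H}^H}:\mathscr{H}^H\to\mathscr{H}^H$ is $G$-equivariant. **The invariant.** Let $\Omega_r=\{x\in\mathscr{H}:\|x\|<r\}$. There is $R>0$ such that all zeros of $\mathscr{F}_\tau$, $\tau\in[0,1]$, lie in $\Omega_R$; and under the assumption of the theorem, for all sufficiently small $\varepsilon>0$, $0$ is the only zero of $\mathscr{F}^H$ in $\overline{\Omega_\varepsilon^H}$. With such $R$ and $\varepsilon$, put $\Omega=\Omega_R\setminus\overline{\Omega_\varepsilon}$ and $$\omega^H:=G\text{-}\deg(\mathscr{F}^H,\Omega^H)=G\text{-}\deg(\mathscr{F}^H,\Omega_R^H)-G\text{-}\deg(\mathscr{F}^H,\Omega_\varepsilon^H)\in A(G).$$ **Equivariant degree.** For a compact Lie group $G$, subgroups are closed, $(K)$ is the conjugacy class of $K$, $W(K)=N(K)/K$, and $(L)\leq(K)$ iff $gLg^{-1}\subset K$ for some $g\in G$. $\Phi_0(G)$ is the set of classes $(K)$ with $\dim W(K)=0$. $A(G)=\mathbb{Z}[\Phi_0(G)]$ is the Burnside ring (free abelian group on $\Phi_0(G)$, unit $(G)$; the coefficient of $(L)$ in $(K)\cdot(K')$ is the number of orbits of type $(L)$ in $G/K\times G/K'$). For $(L),(K)\in\Phi_0(G)$,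 $n(L,K)=|\{g\in G:gLg^{-1}\leq K\}/N(K)|$. If $W$ is a finite-dimensional orthogonal $G$-representation, $U\subset W$ is open, bounded and $G$-invariant, and $h:W\to W$ is continuous, $G$-equivariant and non-vanishing on $\partial U$, then $G\text{-}\deg(h,U)=\sum_{(L)\in\Phi_0(G)}n_L(L)$, where $$n_L=\frac{\deg(h^L,U^L)-\sum_{(K)>(L)}n_K\,n(L,K)\,|W(K)|}{|W(L)|},$$ with $\deg$ the Brouwer degree and $h^L=h|_{W^L}$. It extends in the standard Leray–Schauder manner, via finite-dimensional $G$-equivariant approximations, to $G$-equivariant completely continuous fields (identity minus compact map) on Hilbert $G$-representations.
   Formalization: As printed, the formulas for e^{iτ} and e^{iτ}κ do not define a left action of O(2); the formal version keeps x(t+τ) for e^{iτ} and lets κe^{iτ} (instead of e^{iτ}κ) send x(t) to x(−t+τ). *)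

theory Defs
  imports
    "HOL-Analysis.Analysis"
    "HOL-Algebra.Group_Action"
    "HOL-Algebra.Generated_Groups"
    "HOL-Algebra.Free_Abelian_Groups"
begin

section \<open>The Sobolev space of periodic \<open>H\<^sup>2\<close> functions\<close>

text \<open>
  Elements of the Sobolev space are taken as genuine functions (the continuously differentiable
  representatives): \<open>x\<close> is \<open>C\<^sup>1\<close> with derivative \<open>v\<close>, and \<open>v\<close> is an indefinite integral of
  the locally square integrable function \<open>y\<close>, which is the weak second derivative of \<open>x\<close>.
\<close>

definition h2_derivs ::
  "(real \<Rightarrow> 'v::euclidean_space) \<Rightarrow> (real \<Rightarrow> 'v) \<Rightarrow> (real \<Rightarrow> 'v) \<Rightarrow> bool" where
  "h2_derivs x v y \<longleftrightarrow>
     (\<forall>t. (x has_vector_derivative v t) (at t)) \<and>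
     y \<in> borel_measurable lborel \<and>
     (\<forall>a b. set_integrable lborel {a..b} y) \<and>
     (\<forall>a b. set_integrable lborel {a..b} (\<lambda>t. (norm (y t))\<^sup>2)) \<and>
     (\<forall>a b. a \<le> b \<longrightarrow> v b - v a = (LINT t:{a..b}|lborel. y t))"

definition H2_set :: "(real \<Rightarrow> 'v::euclidean_space) set" where
  "H2_set = {x. (\<forall>t. x (t + 2 * pi) = x t) \<and> (\<exists>v y. h2_derivs x v y)}"

lemma h2_derivs_zero: "h2_derivs (\<lambda>_. 0) (\<lambda>_. 0) (\<lambda>_. 0)"
  by (simp add: h2_derivs_def set_integrable_def set_lebesgue_integral_def)

lemma sq_add_bound: "(norm (a + b :: 'v::real_inner))\<^sup>2 \<le> 2 * (norm a)\<^sup>2 + 2 * (norm b)\<^sup>2"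
proof -
  have "0 \<le> (norm (a - b))\<^sup>2" by simp
  then show ?thesis
    unfolding power2_norm_eq_inner by (simp add: inner_simps inner_commute)
qed

lemma h2_derivs_add:
  assumes "h2_derivs x v y" "h2_derivs x' v' y'"
  shows "h2_derivs (\<lambda>t. x t + x' t) (\<lambda>t. v t + v' t) (\<lambda>t. y t + y' t)"
proof -
  note a = assms[unfolded h2_derivs_def]
  have m [measurable]: "y \<in> borel_measurable borel" "y' \<in> borel_measurable borel"
    using a by auto
  have "set_integrable lborel {a..b} (\<lambda>t. (norm (y t + y' t))\<^sup>2)" for a b
  proof (rule set_integrable_bound)
    show "set_integrable lborel {a..b} (\<lambda>t. 2 * (norm (y t))\<^sup>2 + 2 * (norm (y' t))\<^sup>2)"
      using a by (intro set_integral_add set_integrable_mult_right) auto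
    show "set_borel_measurable lborel {a..b} (\<lambda>t. (norm (y t + y' t))\<^sup>2)"
      unfolding set_borel_measurable_def by measurable
    show "AE t in lborel. t \<in> {a..b} \<longrightarrow>
        norm ((norm (y t + y' t))\<^sup>2) \<le> norm (2 * (norm (y t))\<^sup>2 + 2 * (norm (y' t))\<^sup>2)"
      using sq_add_bound by (auto intro!: AE_I2)
  qed
  moreover have "y \<in> borel_measurable lborel" "y' \<in> borel_measurable lborel"
    using m by auto
  ultimately show ?thesis
    using a unfolding h2_derivs_def
    by (auto intro!: has_vector_derivative_add set_integral_add
        simp: set_integral_add algebra_simps)
qed

lemma h2_derivs_linear:
  fixes A :: "'v::euclidean_space \<Rightarrow> 'w::euclidean_space"
  assumes A: "bounded_linear A" and x: "h2_derivs x v y"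
  shows "h2_derivs (\<lambda>t. A (x t)) (\<lambda>t. A (v t)) (\<lambda>t. A (y t))"
proof -
  interpret A: bounded_linear A by fact
  note a = x[unfolded h2_derivs_def]
  have [measurable]: "A \<in> borel_measurable borel"
    by (intro borel_measurable_continuous_onI linear_continuous_on A)
  have [measurable]: "y \<in> borel_measurable borel" using a by auto
  obtain K where K: "\<And>u. norm (A u) \<le> norm u * K" using A.bounded by blast
  have ind: "indicator S t *\<^sub>R A u = A (indicator S t *\<^sub>R u)" for S and t :: real and u
    by (simp add: A.scaleR)
  have 1: "set_integrable lborel {a..b} (\<lambda>t. A (y t))" for a b
    using a unfolding set_integrable_def ind by (auto intro!: integrable_bounded_linear[OF A])
  have 2: "(LINT t:{a..b}|lborel. A (y t)) = A (LINT t:{a..b}|lborel. y t)" for a b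
    using a unfolding set_lebesgue_integral_def set_integrable_def ind
    by (auto intro!: integral_bounded_linear[OF A])
  have 3: "set_integrable lborel {a..b} (\<lambda>t. (norm (A (y t)))\<^sup>2)" for a b
  proof (rule set_integrable_bound)
    show "set_integrable lborel {a..b} (\<lambda>t. K\<^sup>2 * (norm (y t))\<^sup>2)"
      using a by (intro set_integrable_mult_right) auto
    show "set_borel_measurable lborel {a..b} (\<lambda>t. (norm (A (y t)))\<^sup>2)"
      unfolding set_borel_measurable_def by measurable
    have "(norm (A (y t)))\<^sup>2 \<le> K\<^sup>2 * (norm (y t))\<^sup>2" for t
      using power_mono[OF K[of "y t"], of 2] by (simp add: power_mult_distrib mult.commute)
    then show "AE t in lborel. t \<in> {a..b} \<longrightarrow>
        norm ((norm (A (y t)))\<^sup>2) \<le> norm (K\<^sup>2 * (norm (y t))\<^sup>2)"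
      by (auto intro!: AE_I2)
  qed
  show ?thesis
    using a 1 3 unfolding h2_derivs_def
    by (auto intro!: A.has_vector_derivative simp: 2 A.diff[symmetric])
qed

lemma set_integrable_affine:
  fixes f :: "real \<Rightarrow> 'v::euclidean_space"
  assumes c: "c = 1 \<or> c = -1" and f: "\<And>a b. set_integrable lborel {a..b} f"
  shows "set_integrable lborel {a..b} (\<lambda>t. f (d + c * t))"
    and "(LINT t:{a..b}|lborel. f (d + c * t)) =
      (LINT t:(if c = 1 then {d + a..d + b} else {d - b..d - a})|lborel. f t)"
proof -
  define J where "J = (if c = 1 then {d + a..d + b} else {d - b..d - a})"
  have ind: "indicator {a..b} t = (indicator J (d + c * t) :: real)" for t
    using c by (auto simp: J_def indicator_def)
  have "integrable lborel (\<lambda>t. indicator J t *\<^sub>R f t)"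
    using f unfolding J_def set_integrable_def by simp
  with c show "set_integrable lborel {a..b} (\<lambda>t. f (d + c * t))"
    unfolding set_integrable_def ind by (intro lborel_integrable_real_affine) auto
  show "(LINT t:{a..b}|lborel. f (d + c * t)) =
      (LINT t:(if c = 1 then {d + a..d + b} else {d - b..d - a})|lborel. f t)"
    unfolding J_def[symmetric] set_lebesgue_integral_def ind
    using c lborel_integral_real_affine[of c "\<lambda>t. indicator J t *\<^sub>R f t" d] by auto
qed

lemma h2_derivs_affine:
  assumes c: "c = 1 \<or> c = -1" and x: "h2_derivs x v y"
  shows "h2_derivs (\<lambda>t. x (d + c * t)) (\<lambda>t. c *\<^sub>R v (d + c * t)) (\<lambda>t. y (d + c * t))"
proof -
  note a = x[unfolded h2_derivs_def]
  have "y \<in> borel_measurable borel" using a by auto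
  then have 1: "(\<lambda>t. y (d + c * t)) \<in> borel_measurable lborel" by measurable
  have dx: "((\<lambda>t. x (d + c * t)) has_vector_derivative c *\<^sub>R v (d + c * t)) (at t)" for t
  proof -
    have "((\<lambda>t. d + c * t) has_vector_derivative c) (at t)"
      by (auto intro!: derivative_eq_intros)
    moreover have "(x has_vector_derivative v (d + c * t)) (at (d + c * t))" using a by auto
    ultimately show ?thesis
      using vector_diff_chain_at[of "\<lambda>t. d + c * t" c t x] by (simp add: o_def)
  qed
  have "c *\<^sub>R v (d + c * s) - c *\<^sub>R v (d + c * r) = (LINT t:{r..s}|lborel. y (d + c * t))"
    if "r \<le> s" for r s
    using set_integrable_affine(2)[OF c, of y r s d] a c that by auto
  moreover have "set_integrable lborel {r..s} (\<lambda>t. y (d + c * t))"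
    "set_integrable lborel {r..s} (\<lambda>t. (norm (y (d + c * t)))\<^sup>2)" for r s
    using set_integrable_affine(1)[OF c, of y] set_integrable_affine(1)[OF c, of "\<lambda>t. (norm (y t))\<^sup>2"] a
    by auto
  ultimately show ?thesis using dx 1 unfolding h2_derivs_def by auto
qed

lemma h2_derivs_unique:
  assumes x: "h2_derivs x v y" and x': "h2_derivs x v' y'"
  shows "v = v'" and "AE t in lborel. y t = y' t"
proof -
  note a = x[unfolded h2_derivs_def] and a' = x'[unfolded h2_derivs_def]
  show v: "v = v'"
    using a a' by (intro ext vector_derivative_unique_at) auto
  let ?w = "\<lambda>t. y t - y' t"
  have int: "set_integrable lborel {a..b} ?w" for a b using a a' by auto
  have z: "integral {a..b} ?w = 0" if "a \<le> b" for a b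
  proof -
    have "set_integrable lborel {a..b} y" "set_integrable lborel {a..b} y'"
      using a a' by blast+
    then have "(LINT t:{a..b}|lborel. ?w t) =
        (LINT t:{a..b}|lborel. y t) - (LINT t:{a..b}|lborel. y' t)"
      by (rule set_integral_diff(2))
    also have "(LINT t:{a..b}|lborel. y t) = v b - v a" using a that by simp
    also have "(LINT t:{a..b}|lborel. y' t) = v b - v a" using a' that v by simp
    finally have "(LINT t:{a..b}|lborel. ?w t) = 0" by simp
    with set_borel_integral_eq_integral(2)[OF int[of a b]] show ?thesis by simp
  qed
  have "?w integrable_on cbox a b" for a b
    using set_borel_integral_eq_integral(1)[OF int[of a b]] by simp
  from integrable_ccontinuous_explicit[OF this] obtain N where N: "negligible N"
    and *: "\<And>x e. x \<notin> N \<Longrightarrow> 0 < e \<Longrightarrow> \<exists>d>0. \<forall>h. 0 < h \<and> h < d \<longrightarrow>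
        norm (integral (cbox x (x + h *\<^sub>R One)) ?w /\<^sub>R h ^ DIM(real) - ?w x) < e"
    by blast
  have "?w t = 0" if "t \<notin> N" for t
  proof (rule ccontr)
    assume "?w t \<noteq> 0"
    then have "0 < norm (?w t)" by simp
    from *[OF that this] obtain d where "d > 0"
      and d: "\<And>h. 0 < h \<and> h < d \<Longrightarrow>
        norm (integral (cbox t (t + h *\<^sub>R One)) ?w /\<^sub>R h ^ DIM(real) - ?w t) < norm (?w t)"
      by blast
    with d[of "d/2"] z[of t "t + d/2"] show False by (simp add: norm_minus_commute)
  qed
  then have "{t. \<not> y t = y' t} \<subseteq> N" by auto
  then have neg: "negligible {t. \<not> y t = y' t}" using N negligible_subset by blast
  then have "AE t in lebesgue. y t = y' t"
    by (simp add: negligible_iff_null_sets eventually_ae_filter)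
       (metis (mono_tags, lifting) mem_Collect_eq subsetI)
  then show "AE t in lborel. y t = y' t"
    by (simp add: AE_completion_iff)
qed

typedef (overloaded) 'v h2 = "H2_set :: (real \<Rightarrow> 'v::euclidean_space) set"
  morphisms h2_fun Abs_h2
proof
  show "(\<lambda>_. 0) \<in> H2_set" using h2_derivs_zero by (auto simp: H2_set_def)
qed

definition h2_d1 :: "'v::euclidean_space h2 \<Rightarrow> real \<Rightarrow> 'v" where
  "h2_d1 x t = vector_derivative (h2_fun x) (at t)"

definition h2_d2 :: "'v::euclidean_space h2 \<Rightarrow> real \<Rightarrow> 'v" where
  "h2_d2 x = (SOME y. h2_derivs (h2_fun x) (h2_d1 x) y)"

lemma h2_periodic: "h2_fun x (t + 2 * pi) = h2_fun x t"
  using h2_fun[of x] by (auto simp: H2_set_def)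

lemma h2_periodic_int: "h2_fun x (t + of_int k * (2 * pi)) = h2_fun x t"
proof -
  have nat: "h2_fun x (s + of_nat n * (2 * pi)) = h2_fun x s" for s and n :: nat
  proof (induction n)
    case (Suc n)
    have "s + of_nat (Suc n) * (2 * pi) = (s + of_nat n * (2 * pi)) + 2 * pi"
      by (simp add: algebra_simps)
    with Suc show ?case by (metis h2_periodic)
  qed simp
  show ?thesis
  proof (cases "k \<ge> 0")
    case True
    then show ?thesis using nat[of t "nat k"] by simp
  next
    case False
    then show ?thesis using nat[of "t + of_int k * (2 * pi)" "nat (- k)"] by (simp add: algebra_simps)
  qed
qed

lemma h2_derivs_h2: "h2_derivs (h2_fun x) (h2_d1 x) (h2_d2 x)"
proof -
  obtain v y where vy: "h2_derivs (h2_fun x) v y"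
    using h2_fun[of x] by (auto simp: H2_set_def)
  then have "h2_d1 x = v"
    by (auto simp: h2_d1_def h2_derivs_def fun_eq_iff intro!: vector_derivative_at)
  with vy show ?thesis unfolding h2_d2_def by (metis someI_ex)
qed

lemma h2_d1_d2_eqI:
  assumes "h2_derivs (h2_fun x) v y"
  shows "h2_d1 x = v" and "AE t in lborel. h2_d2 x t = y t"
  using h2_derivs_unique[OF h2_derivs_h2 assms] by auto

instantiation h2 :: (euclidean_space) real_vector
begin

definition "0 = Abs_h2 (\<lambda>_. 0)"
definition "x + y = Abs_h2 (\<lambda>t. h2_fun x t + h2_fun y t)"
definition "- x = Abs_h2 (\<lambda>t. - h2_fun x t)"
definition "x - y = Abs_h2 (\<lambda>t. h2_fun x t - h2_fun y t)"
definition "c *\<^sub>R x = Abs_h2 (\<lambda>t. c *\<^sub>R h2_fun x t)"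

lemma h2_fun_zero: "h2_fun 0 = (\<lambda>_. 0)"
  unfolding zero_h2_def using h2_derivs_zero
  by (intro Abs_h2_inverse) (auto simp: H2_set_def)

lemma h2_fun_add: "h2_fun (x + y) = (\<lambda>t. h2_fun x t + h2_fun y t)"
  unfolding plus_h2_def using h2_derivs_add[OF h2_derivs_h2[of x] h2_derivs_h2[of y]]
  by (intro Abs_h2_inverse) (auto simp: H2_set_def h2_periodic)

lemma h2_fun_scaleR: "h2_fun (c *\<^sub>R x) = (\<lambda>t. c *\<^sub>R h2_fun x t)"
  unfolding scaleR_h2_def using h2_derivs_linear[OF bounded_linear_scaleR_right h2_derivs_h2[of x]]
  by (intro Abs_h2_inverse) (auto simp: H2_set_def h2_periodic)

lemma h2_fun_minus: "h2_fun (- x) = (\<lambda>t. - h2_fun x t)"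
  using h2_fun_scaleR[of "-1" x] h2_fun_inverse[of "(-1) *\<^sub>R x"] by (simp add: uminus_h2_def)

lemma h2_fun_diff: "h2_fun (x - y) = (\<lambda>t. h2_fun x t - h2_fun y t)"
  using h2_fun_add[of x "- y"] h2_fun_inverse[of "x + - y"]
  by (simp add: minus_h2_def h2_fun_minus)

lemmas h2_fun_simps = h2_fun_zero h2_fun_add h2_fun_scaleR h2_fun_minus h2_fun_diff

instance
proof
  fix x y z :: "'a h2" and a b :: real
  show "x + y + z = x + (y + z)" "x + y = y + x" "0 + x = x" "- x + x = 0" "x - y = x + - y"
    "a *\<^sub>R (x + y) = a *\<^sub>R x + a *\<^sub>R y" "(a + b) *\<^sub>R x = a *\<^sub>R x + b *\<^sub>R x"
    "a *\<^sub>R b *\<^sub>R x = (a * b) *\<^sub>R x" "1 *\<^sub>R x = x"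
    by (simp_all add: h2_fun_inject[symmetric] h2_fun_simps algebra_simps)
qed

end

lemma h2_d1_add: "h2_d1 (x + y) = (\<lambda>t. h2_d1 x t + h2_d1 y t)"
  and h2_d2_add: "AE t in lborel. h2_d2 (x + y) t = h2_d2 x t + h2_d2 y t"
  using h2_d1_d2_eqI[of "x + y"] h2_derivs_add[OF h2_derivs_h2[of x] h2_derivs_h2[of y]]
  by (simp_all add: h2_fun_simps)

lemma h2_d1_scaleR: "h2_d1 (c *\<^sub>R x) = (\<lambda>t. c *\<^sub>R h2_d1 x t)"
  and h2_d2_scaleR: "AE t in lborel. h2_d2 (c *\<^sub>R x) t = c *\<^sub>R h2_d2 x t"
  using h2_d1_d2_eqI[of "c *\<^sub>R x", unfolded h2_fun_simps]
    h2_derivs_linear[OF bounded_linear_scaleR_right[of c] h2_derivs_h2[of x]]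
  by blast+

lemma h2_continuous [continuous_intros]:
  "continuous_on S (h2_fun x)" "continuous_on S (h2_d1 x)"
proof -
  note a = h2_derivs_h2[of x, unfolded h2_derivs_def]
  show "continuous_on S (h2_fun x)"
    using a by (meson continuous_at_imp_continuous_on has_vector_derivative_continuous)
  have "continuous_on {- n..n} (h2_d1 x)" for n
  proof -
    have "h2_d2 x integrable_on {- n..n}" using a set_borel_integral_eq_integral(1) by blast
    then have "continuous_on {- n..n} (\<lambda>t. h2_d1 x (- n) + integral {- n..t} (h2_d2 x))"
      by (intro continuous_intros indefinite_integral_continuous_1)
    moreover have "h2_d1 x (- n) + integral {- n..t} (h2_d2 x) = h2_d1 x t" if "t \<in> {- n..n}" for t
    proof -
      have "h2_d1 x t - h2_d1 x (- n) = integral {- n..t} (h2_d2 x)"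
        using a that set_borel_integral_eq_integral(2)[of "{- n..t}" "h2_d2 x"] by auto
      then show ?thesis by (simp add: algebra_simps)
    qed
    ultimately show ?thesis by (rule continuous_on_eq)
  qed
  have "isCont (h2_d1 x) t" for t
  proof -
    have "continuous_on {- (\<bar>t\<bar> + 1)<..<\<bar>t\<bar> + 1} (h2_d1 x)"
      by (rule continuous_on_subset[OF \<open>\<And>n. continuous_on {- n..n} (h2_d1 x)\<close>[of "\<bar>t\<bar> + 1"]]) auto
    moreover have "t \<in> {- (\<bar>t\<bar> + 1)<..<\<bar>t\<bar> + 1}" by auto
    ultimately show ?thesis using continuous_on_eq_continuous_at open_greaterThanLessThan by blast
  qed
  then show "continuous_on S (h2_d1 x)" by (simp add: continuous_at_imp_continuous_on)
qed

lemma h2_inner_integrable: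
  fixes x y :: "'v::euclidean_space h2"
  shows
  "set_integrable lborel {0..2 * pi}
     (\<lambda>t. h2_d2 x t \<bullet> h2_d2 y t + h2_d1 x t \<bullet> h2_d1 y t + h2_fun x t \<bullet> h2_fun y t)"
proof (intro set_integral_add)
  note a = h2_derivs_h2[unfolded h2_derivs_def]
  have [measurable]: "h2_d2 x \<in> borel_measurable borel" "h2_d2 y \<in> borel_measurable borel"
    using a[of x] a[of y] by auto
  show "set_integrable lborel {0..2 * pi} (\<lambda>t. h2_d2 x t \<bullet> h2_d2 y t)"
  proof (rule set_integrable_bound)
    show "set_integrable lborel {0..2 * pi} (\<lambda>t. (norm (h2_d2 x t))\<^sup>2 + (norm (h2_d2 y t))\<^sup>2)"
      using a[of x] a[of y] by (intro set_integral_add) auto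
    show "set_borel_measurable lborel {0..2 * pi} (\<lambda>t. h2_d2 x t \<bullet> h2_d2 y t)"
      unfolding set_borel_measurable_def by measurable
    have "\<bar>u \<bullet> w\<bar> \<le> (norm u)\<^sup>2 + (norm w)\<^sup>2" for u w :: 'v
    proof -
      have "\<bar>u \<bullet> w\<bar> \<le> norm u * norm w" by (rule Cauchy_Schwarz_ineq2)
      also have "\<dots> \<le> (norm u)\<^sup>2 + (norm w)\<^sup>2"
        using sum_squares_bound[of "norm u" "norm w"]
          mult_nonneg_nonneg[OF norm_ge_zero[of u] norm_ge_zero[of w]] by linarith
      finally show ?thesis .
    qed
    then show "AE t in lborel. t \<in> {0..2 * pi} \<longrightarrow>
      norm (h2_d2 x t \<bullet> h2_d2 y t) \<le> norm ((norm (h2_d2 x t))\<^sup>2 + (norm (h2_d2 y t))\<^sup>2)"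
      by (auto intro!: AE_I2)
  qed
  show "set_integrable lborel {0..2 * pi} (\<lambda>t. h2_d1 x t \<bullet> h2_d1 y t)"
    "set_integrable lborel {0..2 * pi} (\<lambda>t. h2_fun x t \<bullet> h2_fun y t)"
    unfolding set_integrable_def
    by (intro borel_integrable_compact continuous_intros compact_Icc)+
qed

instantiation h2 :: (euclidean_space) real_inner
begin

definition "x \<bullet> y = (LINT t:{0..2 * pi}|lborel.
  h2_d2 x t \<bullet> h2_d2 y t + h2_d1 x t \<bullet> h2_d1 y t + h2_fun x t \<bullet> h2_fun y t)"
definition "norm x = sqrt (x \<bullet> x)" for x :: "'a h2"
definition "sgn x = x /\<^sub>R norm x" for x :: "'a h2"
definition "dist x y = norm (x - y)" for x y :: "'a h2"
definition "uniformity = (INF e\<in>{0<..}. principal {(x, y :: 'a h2). dist x y < e})"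
definition "open U = (\<forall>x\<in>U. \<forall>\<^sub>F (x', y) in uniformity. x' = x \<longrightarrow> y \<in> U)" for U :: "'a h2 set"

instance
proof
  fix x y z :: "'a h2" and a b :: real
  let ?I = "\<lambda>x y t. h2_d2 x t \<bullet> h2_d2 y t + h2_d1 x t \<bullet> h2_d1 y t + h2_fun x t \<bullet> h2_fun y t"
  have [measurable]: "?I x y \<in> borel_measurable borel" for x y :: "'a h2"
  proof -
    have [measurable]: "h2_d2 x \<in> borel_measurable borel" for x :: "'a h2"
      using h2_derivs_h2[of x, unfolded h2_derivs_def] by auto
    have [measurable]: "h2_d1 x \<in> borel_measurable borel" "h2_fun x \<in> borel_measurable borel" for x :: "'a h2"
      by (intro borel_measurable_continuous_onI continuous_intros)+
    show ?thesis by measurable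
  qed
  show "dist x y = norm (x - y)" by (rule dist_h2_def)
  show "sgn x = x /\<^sub>R norm x" by (rule sgn_h2_def)
  show "(uniformity :: ('a h2 \<times> 'a h2) filter) = (INF e\<in>{0<..}. principal {(x, y). dist x y < e})"
    by (rule uniformity_h2_def)
  show "open U = (\<forall>x\<in>U. \<forall>\<^sub>F (x', y) in uniformity. x' = x \<longrightarrow> y \<in> U)" for U :: "'a h2 set"
    by (rule open_h2_def)
  show "norm x = sqrt (x \<bullet> x)" by (rule norm_h2_def)
  show "x \<bullet> y = y \<bullet> x" by (simp add: inner_h2_def inner_commute)
  show "(x + y) \<bullet> z = x \<bullet> z + y \<bullet> z"
  proof -
    have "(x + y) \<bullet> z = (LINT t:{0..2 * pi}|lborel. ?I x z t + ?I y z t)"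
      unfolding inner_h2_def
      by (rule set_lebesgue_integral_cong_AE, simp, measurable)
         (use h2_d2_add[of x y] in \<open>auto elim!: eventually_mono
            simp: h2_d1_add h2_fun_add inner_simps\<close>)
    then show ?thesis
      unfolding inner_h2_def by (simp add: set_integral_add(2) h2_inner_integrable)
  qed
  show sc: "(a *\<^sub>R x) \<bullet> y = a * (x \<bullet> y)" for a and x y :: "'a h2"
  proof -
    have "(a *\<^sub>R x) \<bullet> y = (LINT t:{0..2 * pi}|lborel. a * ?I x y t)"
      unfolding inner_h2_def
      by (rule set_lebesgue_integral_cong_AE, simp, measurable)
         (use h2_d2_scaleR[of a x] in \<open>auto elim!: eventually_mono
            simp: h2_d1_scaleR h2_fun_scaleR algebra_simps\<close>)
    then show ?thesis unfolding inner_h2_def by simp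
  qed
  show "0 \<le> x \<bullet> x"
    unfolding inner_h2_def set_lebesgue_integral_def by (intro integral_nonneg_AE AE_I2) simp
  show "(x \<bullet> x = 0) = (x = 0)"
  proof
    assume "x = 0"
    then show "x \<bullet> x = 0" using sc[of 0 x x] by simp
  next
    assume 0: "x \<bullet> x = 0"
    have int: "set_integrable lborel {0..2 * pi} (\<lambda>t. h2_fun x t \<bullet> h2_fun x t)"
      unfolding set_integrable_def
      by (intro borel_integrable_compact continuous_intros compact_Icc)
    have "(LINT t:{0..2 * pi}|lborel. h2_fun x t \<bullet> h2_fun x t) \<le> x \<bullet> x"
      unfolding inner_h2_def by (intro set_integral_mono int h2_inner_integrable) simp
    with 0 have "integral {0..2 * pi} (\<lambda>t. h2_fun x t \<bullet> h2_fun x t) \<le> 0"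
      using set_borel_integral_eq_integral(2)[OF int] by simp
    moreover have "0 \<le> integral {0..2 * pi} (\<lambda>t. h2_fun x t \<bullet> h2_fun x t)"
      using set_borel_integral_eq_integral(1)[OF int] by (intro integral_nonneg) auto
    ultimately have "integral {0..2 * pi} (\<lambda>t. h2_fun x t \<bullet> h2_fun x t) = 0" by simp
    then have z: "\<forall>t\<in>{0..2 * pi}. h2_fun x t \<bullet> h2_fun x t = 0"
      by (subst (asm) integral_eq_0_iff) (auto intro!: continuous_intros)
    have "h2_fun x t = 0" for t
    proof -
      define k where "k = \<lfloor>t / (2 * pi)\<rfloor>"
      have "h2_fun x t = h2_fun x ((t - of_int k * (2 * pi)) + of_int k * (2 * pi))" by simp
      also have "\<dots> = h2_fun x (t - of_int k * (2 * pi))" by (rule h2_periodic_int)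
      also have "\<dots> = 0"
      proof -
        have "of_int k \<le> t / (2 * pi)" "t / (2 * pi) \<le> of_int k + 1"
          unfolding k_def by linarith+
        then have "t - of_int k * (2 * pi) \<in> {0..2 * pi}" by (auto simp: field_simps)
        with z show ?thesis by simp
      qed
      finally show ?thesis .
    qed
    then show "x = 0" by (simp add: h2_fun_inject[symmetric] h2_fun_simps fun_eq_iff)
  qed
qed

end

section \<open>The group \<open>\<Gamma> \<times> \<int>\<^sub>2 \<times> O(2)\<close> and its action\<close>

definition rot :: "real \<Rightarrow> real^2^2" where
  "rot \<tau> = vector [vector [cos \<tau>, - sin \<tau>], vector [sin \<tau>, cos \<tau>]]"

definition kappa :: "real^2^2" where
  "kappa = vector [vector [1, 0], vector [0, - 1]]"

definition O2 :: "(real^2^2) monoid" where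
  "O2 = \<lparr>carrier = {A. orthogonal_matrix A}, mult = (**), one = mat 1\<rparr>"

definition Z2 :: "int monoid" where
  "Z2 = \<lparr>carrier = {1, - 1}, mult = (*), one = 1\<rparr>"

definition GG :: "'g monoid \<Rightarrow> ('g \<times> int \<times> (real^2^2)) monoid" where
  "GG \<Gamma> = \<Gamma> \<times>\<times> Z2 \<times>\<times> O2"

definition GG_topology :: "'g monoid \<Rightarrow> ('g \<times> int \<times> (real^2^2)) topology" where
  "GG_topology \<Gamma> = prod_topology (discrete_topology (carrier \<Gamma>))
     (prod_topology (discrete_topology (carrier Z2)) (top_of_set (carrier O2)))"

text \<open>
  \<open>\<phi>\<close> is an action of \<open>\<Gamma>\<close> on the index type; the induced action on \<open>\<real>\<^sup>n\<close> moves the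
  \<open>i\<close>-th coordinate to position \<open>\<phi> \<gamma> i\<close>.
\<close>

definition perm_act :: "'g monoid \<Rightarrow> ('g \<Rightarrow> 'n \<Rightarrow> 'n) \<Rightarrow> 'g \<Rightarrow> real^'n \<Rightarrow> real^'n" where
  "perm_act \<Gamma> \<phi> \<gamma> u = (\<chi> i. u $ \<phi> (inv\<^bsub>\<Gamma>\<^esub> \<gamma>) i)"

text \<open>
  The rotation by \<open>\<tau>\<close> sends \<open>x(t)\<close> to \<open>x(t + \<tau>)\<close>, and \<open>\<kappa>\<close> sends \<open>x(t)\<close> to \<open>x(-t)\<close>.  For these to
  generate a left action of \<open>O(2)\<close>, it is the product \<open>\<kappa> e\<^bsup>i\<tau>\<^esup>\<close> (and not \<open>e\<^bsup>i\<tau>\<^esup> \<kappa>\<close>, which equals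
  \<open>\<kappa> e\<^bsup>-i\<tau>\<^esup>\<close>) that sends \<open>x(t)\<close> to \<open>x(-t + \<tau>)\<close>.  The angle \<open>\<tau>\<close> is determined by the matrix up to
  multiples of \<open>2\<pi>\<close>, which do not matter for periodic functions.
\<close>

definition O2_time :: "real^2^2 \<Rightarrow> real \<Rightarrow> real" where
  "O2_time A t = (if \<exists>\<tau>. A = rot \<tau> then t + (SOME \<tau>. A = rot \<tau>)
                  else - t + (SOME \<tau>. A = kappa ** rot \<tau>))"

definition h2_act ::
  "'g monoid \<Rightarrow> ('g \<Rightarrow> 'n \<Rightarrow> 'n) \<Rightarrow> 'g \<times> int \<times> (real^2^2) \<Rightarrow> (real^'n::finite) h2 \<Rightarrow> (real^'n) h2" where
  "h2_act \<Gamma> \<phi> = (\<lambda>(\<gamma>, s, A) x.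
     Abs_h2 (\<lambda>t. of_int s *\<^sub>R perm_act \<Gamma> \<phi> \<gamma> (h2_fun x (O2_time A t))))"

lemma bounded_linear_perm_act: "bounded_linear (perm_act \<Gamma> \<phi> \<gamma> :: real^'n::finite \<Rightarrow> _)"
proof -
  have "linear (perm_act \<Gamma> \<phi> \<gamma> :: real^'n \<Rightarrow> _)"
    by (rule linearI) (simp_all add: perm_act_def vec_eq_iff)
  then show ?thesis by (rule linear_conv_bounded_linear[THEN iffD1])
qed

lemma O2_time_affine: "\<exists>c d. (c = 1 \<or> c = -1) \<and> O2_time A = (\<lambda>t. d + c * t)"
proof (cases "\<exists>\<tau>. A = rot \<tau>")
  case True
  then have "O2_time A = (\<lambda>t. (SOME \<tau>. A = rot \<tau>) + 1 * t)" by (auto simp: O2_time_def fun_eq_iff)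
  then show ?thesis by blast
next
  case False
  then have "O2_time A = (\<lambda>t. (SOME \<tau>. A = kappa ** rot \<tau>) + (-1) * t)" by (auto simp: O2_time_def fun_eq_iff)
  then show ?thesis by blast
qed

lemma h2_fun_act:
  "h2_fun (h2_act \<Gamma> \<phi> (\<gamma>, s, A) x) =
     (\<lambda>t. of_int s *\<^sub>R perm_act \<Gamma> \<phi> \<gamma> (h2_fun x (O2_time A t)))"
proof -
  obtain c d where c: "c = 1 \<or> c = -1" and A: "O2_time A = (\<lambda>t. d + c * t)"
    using O2_time_affine by blast
  have bl: "bounded_linear (\<lambda>u. of_int s *\<^sub>R perm_act \<Gamma> \<phi> \<gamma> u)"
    using bounded_linear_compose[OF bounded_linear_scaleR_right bounded_linear_perm_act] .
  have "h2_fun x (d + c * (t + 2 * pi)) = h2_fun x (d + c * t)" for t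
    using c h2_periodic_int[of x "d + c * t" 1] h2_periodic_int[of x "d + c * t" "-1"]
    by (auto simp: algebra_simps)
  then show ?thesis
    unfolding h2_act_def split_conv A
    using h2_derivs_linear[OF bl h2_derivs_affine[OF c h2_derivs_h2[of x], of d]]
    by (intro Abs_h2_inverse) (auto simp: H2_set_def)
qed

lemma vec2_eq_iff: "A = B \<longleftrightarrow> A$1$1 = B$1$1 \<and> A$1$2 = B$1$2 \<and> A$2$1 = B$2$1 \<and> A$2$2 = B$2$2"
  for A B :: "real^2^2"
  by (auto simp: vec_eq_iff forall_2)

lemma rot_mult: "rot a ** rot b = rot (a + b)"
  by (simp add: vec2_eq_iff rot_def matrix_matrix_mult_def sum_2 cos_add sin_add algebra_simps)

lemma rot_kappa: "rot a ** kappa = kappa ** rot (- a)"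
  by (simp add: vec2_eq_iff rot_def kappa_def matrix_matrix_mult_def sum_2)

lemma kappa_kappa: "kappa ** kappa = mat 1"
  by (simp add: vec2_eq_iff kappa_def matrix_matrix_mult_def sum_2 mat_def)

lemma rot_neq_kappa_rot: "rot a \<noteq> kappa ** rot b"
proof
  assume "rot a = kappa ** rot b"
  then have "det (rot a) = det kappa * det (rot b)" by (simp add: det_mul)
  then have "(cos a)\<^sup>2 + (sin a)\<^sup>2 = - ((cos b)\<^sup>2 + (sin b)\<^sup>2)"
    by (simp add: det_2 rot_def kappa_def power2_eq_square)
  then show False by simp
qed

lemma rot_eq_iff: "rot a = rot b \<longleftrightarrow> (\<exists>k::int. a = b + of_int k * (2 * pi))"
  using sin_cos_eq_iff[of a b]
  by (auto simp: vec2_eq_iff rot_def algebra_simps)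

lemma h2_O2_time:
  "h2_fun x (O2_time (rot \<tau>) t) = h2_fun x (t + \<tau>)"
  "h2_fun x (O2_time (kappa ** rot \<tau>) t) = h2_fun x (- t + \<tau>)"
proof -
  define a where "a = (SOME a. rot \<tau> = rot a)"
  have "rot \<tau> = rot a" unfolding a_def by (rule someI_ex) blast
  then obtain k :: int where "a = \<tau> + of_int k * (2 * pi)" using rot_eq_iff by metis
  moreover have "O2_time (rot \<tau>) t = t + a" unfolding O2_time_def a_def by auto
  ultimately show "h2_fun x (O2_time (rot \<tau>) t) = h2_fun x (t + \<tau>)"
    using h2_periodic_int[of x "t + \<tau>" k] by (simp add: add.assoc)
  define b where "b = (SOME a. kappa ** rot \<tau> = kappa ** rot a)"
  have "kappa ** rot \<tau> = kappa ** rot b" unfolding b_def by (rule someI_ex) blast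
  then have "kappa ** (kappa ** rot \<tau>) = kappa ** (kappa ** rot b)" by simp
  then have "rot \<tau> = rot b" by (simp add: matrix_mul_assoc kappa_kappa)
  then obtain k :: int where "b = \<tau> + of_int k * (2 * pi)" using rot_eq_iff by metis
  moreover have "O2_time (kappa ** rot \<tau>) t = - t + b"
    unfolding O2_time_def b_def using rot_neq_kappa_rot by (metis (full_types))
  ultimately have "O2_time (kappa ** rot \<tau>) t = (- t + \<tau>) + of_int k * (2 * pi)" by simp
  then show "h2_fun x (O2_time (kappa ** rot \<tau>) t) = h2_fun x (- t + \<tau>)"
    by (simp only: h2_periodic_int)
qed

lemma h2_act_rot:
  "h2_fun (h2_act \<Gamma> \<phi> (\<gamma>, s, rot \<tau>) x) t = of_int s *\<^sub>R perm_act \<Gamma> \<phi> \<gamma> (h2_fun x (t + \<tau>))"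
  "h2_fun (h2_act \<Gamma> \<phi> (\<gamma>, s, kappa ** rot \<tau>) x) t =
     of_int s *\<^sub>R perm_act \<Gamma> \<phi> \<gamma> (h2_fun x (- t + \<tau>))"
  by (simp_all add: h2_fun_act h2_O2_time)

lemma O2_cases:
  assumes "A \<in> carrier O2"
  obtains \<tau> where "A = rot \<tau>" | \<tau> where "A = kappa ** rot \<tau>"
proof -
  have o: "transpose A ** A = mat 1" "A ** transpose A = mat 1"
    using assms by (auto simp: O2_def orthogonal_matrix_def)
  have 1: "(A$1$1)\<^sup>2 + (A$2$1)\<^sup>2 = 1" "(A$1$2)\<^sup>2 + (A$2$2)\<^sup>2 = 1" "A$1$1 * A$1$2 + A$2$1 * A$2$2 = 0"
    using o(1) by (auto simp: vec2_eq_iff matrix_matrix_mult_def sum_2 transpose_def mat_def power2_eq_square)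
  obtain \<tau> where t: "A$1$1 = cos \<tau>" "A$2$1 = sin \<tau>"
    using sincos_total_2pi[OF 1(1)] by metis
  have 2: "A$1$2 * cos \<tau> + A$2$2 * sin \<tau> = 0" using 1(3) t by (simp add: mult.commute)
  define c where "c = A$2$2 * cos \<tau> - A$1$2 * sin \<tau>"
  have a12: "A$1$2 = - c * sin \<tau>"
  proof -
    have "- c * sin \<tau> = A$1$2 * (sin \<tau>)\<^sup>2 - (A$2$2 * sin \<tau>) * cos \<tau>"
      by (simp add: c_def algebra_simps power2_eq_square)
    also have "A$2$2 * sin \<tau> = - (A$1$2 * cos \<tau>)" using 2 by linarith
    finally have "- c * sin \<tau> = A$1$2 * ((sin \<tau>)\<^sup>2 + (cos \<tau>)\<^sup>2)"
      by (simp only: algebra_simps power2_eq_square)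
    then show ?thesis by (metis mult_1_right sin_cos_squared_add)
  qed
  have a22: "A$2$2 = c * cos \<tau>"
  proof -
    have "c * cos \<tau> = A$2$2 * (cos \<tau>)\<^sup>2 - (A$1$2 * cos \<tau>) * sin \<tau>"
      by (simp add: c_def algebra_simps power2_eq_square)
    also have "A$1$2 * cos \<tau> = - (A$2$2 * sin \<tau>)" using 2 by linarith
    finally have "c * cos \<tau> = A$2$2 * ((sin \<tau>)\<^sup>2 + (cos \<tau>)\<^sup>2)"
      by (simp only: algebra_simps power2_eq_square)
    then show ?thesis by (metis mult_1_right sin_cos_squared_add)
  qed
  have "c\<^sup>2 * ((sin \<tau>)\<^sup>2 + (cos \<tau>)\<^sup>2) = 1"
  proof -
    have "c\<^sup>2 * ((sin \<tau>)\<^sup>2 + (cos \<tau>)\<^sup>2) = (- c * sin \<tau>)\<^sup>2 + (c * cos \<tau>)\<^sup>2"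
      by (simp only: power_mult_distrib power2_minus distrib_left)
    then show ?thesis using 1(2) unfolding a12 a22 by simp
  qed
  then have "c = 1 \<or> c = -1" by (simp add: power2_eq_1_iff)
  then show thesis
  proof
    assume "c = 1"
    then have "A = rot \<tau>" using t a12 a22 by (simp add: vec2_eq_iff rot_def)
    then show thesis by (rule that)
  next
    assume "c = -1"
    then have "A = kappa ** rot (- \<tau>)"
      using t a12 a22
      by (simp add: vec2_eq_iff rot_def kappa_def matrix_matrix_mult_def sum_2)
    then show thesis by (rule that)
  qed
qed

lemma h2_act_mult:
  fixes \<Gamma> :: "'g monoid" and \<phi> :: "'g \<Rightarrow> 'n::finite \<Rightarrow> 'n"
  assumes \<phi>: "group_action \<Gamma> UNIV \<phi>"
    and g: "g \<in> carrier (GG \<Gamma>)" and h: "h \<in> carrier (GG \<Gamma>)"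
  shows "h2_act \<Gamma> \<phi> (g \<otimes>\<^bsub>GG \<Gamma>\<^esub> h) x = h2_act \<Gamma> \<phi> g (h2_act \<Gamma> \<phi> h x)"
proof -
  interpret group_action \<Gamma> UNIV \<phi> by fact
  interpret \<Gamma>: group \<Gamma> using group_hom group_hom.axioms(1) by blast
  obtain \<gamma> s A where g': "g = (\<gamma>, s, A)" "\<gamma> \<in> carrier \<Gamma>" "A \<in> carrier O2"
    using g by (cases g) (auto simp: GG_def)
  obtain \<delta> r B where h': "h = (\<delta>, r, B)" "\<delta> \<in> carrier \<Gamma>" "B \<in> carrier O2"
    using h by (cases h) (auto simp: GG_def)
  have gh: "g \<otimes>\<^bsub>GG \<Gamma>\<^esub> h = (\<gamma> \<otimes>\<^bsub>\<Gamma>\<^esub> \<delta>, s * r, A ** B)"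
    by (simp add: GG_def g' h' Z2_def O2_def)
  have p: "perm_act \<Gamma> \<phi> (\<gamma> \<otimes>\<^bsub>\<Gamma>\<^esub> \<delta>) u = perm_act \<Gamma> \<phi> \<gamma> (perm_act \<Gamma> \<phi> \<delta> u)" for u
    using g' h' composition_rule[of _ "inv\<^bsub>\<Gamma>\<^esub> \<delta>" "inv\<^bsub>\<Gamma>\<^esub> \<gamma>"]
    by (simp add: perm_act_def vec_eq_iff \<Gamma>.inv_mult_group)
  have sc: "perm_act \<Gamma> \<phi> \<gamma> (c *\<^sub>R u) = c *\<^sub>R perm_act \<Gamma> \<phi> \<gamma> u" for c and u :: "real^'n"
    by (simp add: perm_act_def vec_eq_iff)
  have t: "h2_fun x (O2_time (A ** B) t) = h2_fun x (O2_time B (O2_time A t))" for t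
  proof -
    have kk: "(kappa ** rot a) ** (kappa ** rot b) = rot (b - a)" for a b
      by (metis (no_types, opaque_lifting) matrix_mul_assoc rot_kappa kappa_kappa matrix_mul_lid rot_mult
          add.commute diff_conv_add_uminus)
    have rk: "rot a ** (kappa ** rot b) = kappa ** rot (b - a)" for a b
      by (metis (no_types, opaque_lifting) matrix_mul_assoc rot_kappa rot_mult
          add.commute diff_conv_add_uminus)
    have kr: "(kappa ** rot a) ** rot b = kappa ** rot (a + b)" for a b
      by (simp add: matrix_mul_assoc[symmetric] rot_mult)
    have sh: "h2_fun x (O2_time B (O2_time (rot a) t)) = h2_fun x (O2_time B (t + a))"
      "h2_fun x (O2_time B (O2_time (kappa ** rot a) t)) = h2_fun x (O2_time B (- t + a))" for a
    proof -
      let ?y = "Abs_h2 (\<lambda>t. h2_fun x (O2_time B t))"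
      have "h2_fun ?y = (\<lambda>t. h2_fun x (O2_time B t))"
      proof -
        obtain c d where c: "c = 1 \<or> c = -1" and B: "O2_time B = (\<lambda>t. d + c * t)"
          using O2_time_affine by blast
        have "h2_fun x (d + c * (t + 2 * pi)) = h2_fun x (d + c * t)" for t
          using c h2_periodic_int[of x "d + c * t" 1] h2_periodic_int[of x "d + c * t" "-1"]
          by (auto simp: algebra_simps)
        then show ?thesis
          unfolding B using h2_derivs_affine[OF c h2_derivs_h2[of x], of d]
          by (intro Abs_h2_inverse) (auto simp: H2_set_def)
      qed
      then show "h2_fun x (O2_time B (O2_time (rot a) t)) = h2_fun x (O2_time B (t + a))"
        "h2_fun x (O2_time B (O2_time (kappa ** rot a) t)) = h2_fun x (O2_time B (- t + a))"
        using h2_O2_time[of ?y] by simp_all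
    qed
    from \<open>A \<in> carrier O2\<close> show ?thesis
    proof (cases rule: O2_cases)
      case A: (1 a)
      show ?thesis
        unfolding A sh
        by (rule O2_cases[OF \<open>B \<in> carrier O2\<close>]) (simp_all add: h2_O2_time rot_mult rk algebra_simps)
    next
      case A: (2 a)
      show ?thesis
        unfolding A sh
        by (rule O2_cases[OF \<open>B \<in> carrier O2\<close>]) (simp_all add: h2_O2_time kr kk algebra_simps)
    qed
  qed
  show ?thesis
    unfolding gh unfolding g' h' h2_fun_inject[symmetric] h2_fun_act
    by (simp add: fun_eq_iff p sc t)
qed

section \<open>Conjugacy classes of subgroups and the Burnside group\<close>

definition conj_class :: "('g, 'b) monoid_scheme \<Rightarrow> 'g set \<Rightarrow> 'g set set" where
  "conj_class G K = {g <#\<^bsub>G\<^esub> K #>\<^bsub>G\<^esub> (inv\<^bsub>G\<^esub> g) | g. g \<in> carrier G}"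

definition class_le :: "'g set set \<Rightarrow> 'g set set \<Rightarrow> bool" where
  "class_le c d \<longleftrightarrow> (\<exists>L\<in>c. \<exists>K\<in>d. L \<subseteq> K)"

definition class_rep :: "'g set set \<Rightarrow> 'g set" where
  "class_rep c = (SOME K. K \<in> c)"

definition weyl_group :: "('g, 'b) monoid_scheme \<Rightarrow> 'g set \<Rightarrow> 'g set monoid" where
  "weyl_group G K = (G\<lparr>carrier := normalizer G K\<rparr>) Mod K"

text \<open>The compact Lie group \<open>W(K)\<close> has dimension zero iff it is finite.\<close>

definition Phi0_subgroups :: "('g, 'b) monoid_scheme \<Rightarrow> 'g topology \<Rightarrow> 'g set set" where
  "Phi0_subgroups G T =
     {K. subgroup K G \<and> closedin T K \<and> finite (carrier (weyl_group G K))}"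

definition Phi0 :: "('g, 'b) monoid_scheme \<Rightarrow> 'g topology \<Rightarrow> 'g set set set" where
  "Phi0 G T = conj_class G ` Phi0_subgroups G T"

text \<open>
  Elements of \<open>A(G)\<close> are represented by finitely supported functions \<open>'g set set \<Rightarrow>\<^sub>0 int\<close> with
  support in \<open>\<Phi>\<^sub>0(G)\<close>, i.e. elements of \<open>free_Abelian_group (Phi0 G T)\<close>.
\<close>

definition num_conj :: "('g, 'b) monoid_scheme \<Rightarrow> 'g set \<Rightarrow> 'g set \<Rightarrow> nat" where
  "num_conj G L K =
     card ((\<lambda>g. normalizer G K #>\<^bsub>G\<^esub> g) `
       {g \<in> carrier G. g <#\<^bsub>G\<^esub> L #>\<^bsub>G\<^esub> (inv\<^bsub>G\<^esub> g) \<subseteq> K})"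

definition fixed_points :: "('g \<Rightarrow> 'v \<Rightarrow> 'v) \<Rightarrow> 'g set \<Rightarrow> 'v set \<Rightarrow> 'v set" where
  "fixed_points act K S = {x \<in> S. \<forall>g\<in>K. act g x = x}"

section \<open>Degrees\<close>

text \<open>
  \<open>A \<delta>\<close> are the admissible approximations of precision \<open>\<delta>\<close>: the common value of \<open>v\<close> on all
  sufficiently fine approximations.  Where the degrees below are defined in the literature,
  this value exists and is unique; the totalising value 0 is not used there.
\<close>

definition eventual_value :: "(real \<Rightarrow> 'a set) \<Rightarrow> ('a \<Rightarrow> 'c::zero) \<Rightarrow> 'c" where
  "eventual_value A v =
     (if \<exists>!d. \<exists>\<delta>>0. \<forall>g\<in>A \<delta>. v g = d then THE d. \<exists>\<delta>>0. \<forall>g\<in>A \<delta>. v g = d else 0)"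

definition onb :: "'v::real_inner set \<Rightarrow> 'v set" where
  "onb W = (SOME B. finite B \<and> pairwise orthogonal B \<and> (\<forall>b\<in>B. norm b = 1) \<and> span B = W)"

text \<open>The determinant of an endomorphism \<open>A\<close> of a finite-dimensional subspace \<open>W\<close>
  (equal to 1 if \<open>W\<close> is the zero space).\<close>

definition det_on :: "'v::real_inner set \<Rightarrow> ('v \<Rightarrow> 'v) \<Rightarrow> real" where
  "det_on W A = (\<Sum>p | p permutes onb W. of_int (sign p) * (\<Prod>b\<in>onb W. A b \<bullet> p b))"

text \<open>
  Brouwer degree of \<open>h : W \<rightarrow> W\<close> over a bounded relatively open \<open>U \<subseteq> W\<close>, for a finite-dimensional
  subspace \<open>W\<close>: the signed number of zeros of sufficiently close \<open>C\<^sup>1\<close> approximations having 0 as a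
  regular value.  The derivative of \<open>g\<close> within \<open>U\<close> is uniquely determined on \<open>W\<close> only, and only
  its values on \<open>W\<close> are used.
\<close>

definition regular_approx ::
  "'v::real_inner set \<Rightarrow> ('v \<Rightarrow> 'v) \<Rightarrow> 'v set \<Rightarrow> real \<Rightarrow> ('v \<Rightarrow> 'v) set" where
  "regular_approx W h U \<delta> = {g.
     continuous_on (closure U) g \<and> g ` closure U \<subseteq> W \<and>
     (\<forall>x\<in>closure U. norm (g x - h x) < \<delta>) \<and>
     (\<forall>x\<in>U. g differentiable (at x within U)) \<and>
     (\<forall>w\<in>W. continuous_on U (\<lambda>x. frechet_derivative g (at x within U) w)) \<and>
     (\<forall>x\<in>U. g x = 0 \<longrightarrow> det_on W (frechet_derivative g (at x within U)) \<noteq> 0)}"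

definition brouwer_deg :: "'v::real_inner set \<Rightarrow> ('v \<Rightarrow> 'v) \<Rightarrow> 'v set \<Rightarrow> int" where
  "brouwer_deg W h U = eventual_value (regular_approx W h U)
     (\<lambda>g. \<Sum>x | x \<in> U \<and> g x = 0.
        if det_on W (frechet_derivative g (at x within U)) > 0 then 1 else - 1)"

text \<open>
  The recurrence formula for \<open>n\<^sub>L\<close>, for a finite-dimensional \<open>G\<close>-invariant subspace \<open>W\<close>.  The set
  of classes above a given one may be infinite, and it may contain infinite ascending chains, so
  the formula is read as a condition on a finitely supported \<open>n\<close>.  It has at most one solution
  (compare two solutions at a maximal class where they differ), and exactly one if \<open>h\<close> is an
  admissible equivariant map.
\<close>

definition is_Gdeg_fin ::
  "('g, 'b) monoid_scheme \<Rightarrow> 'g topology \<Rightarrow> ('g \<Rightarrow> 'v::real_inner \<Rightarrow> 'v) \<Rightarrow>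
   'v set \<Rightarrow> ('v \<Rightarrow> 'v) \<Rightarrow> 'v set \<Rightarrow> ('g set set \<Rightarrow>\<^sub>0 int) \<Rightarrow> bool" where
  "is_Gdeg_fin G T act W h U n \<longleftrightarrow>
     Poly_Mapping.keys n \<subseteq> Phi0 G T \<and>
     (\<forall>c\<in>Phi0 G T. let L = class_rep c in
        real_of_int (Poly_Mapping.lookup n c) =
          (of_int (brouwer_deg (fixed_points act L W) h (fixed_points act L U))
           - (\<Sum>d | d \<in> Poly_Mapping.keys n \<and> class_le c d \<and> d \<noteq> c. let K = class_rep d in
                of_int (Poly_Mapping.lookup n d) * real (num_conj G L K) *
                real (order (weyl_group G K))))
          / real (order (weyl_group G L)))"

definition Gdeg_fin ::
  "('g, 'b) monoid_scheme \<Rightarrow> 'g topology \<Rightarrow> ('g \<Rightarrow> 'v::real_inner \<Rightarrow> 'v) \<Rightarrow>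
   'v set \<Rightarrow> ('v \<Rightarrow> 'v) \<Rightarrow> 'v set \<Rightarrow> ('g set set \<Rightarrow>\<^sub>0 int)" where
  "Gdeg_fin G T act W h U =
     (if \<exists>!n. is_Gdeg_fin G T act W h U n then THE n. is_Gdeg_fin G T act W h U n else 0)"

text \<open>
  Leray--Schauder extension to completely continuous equivariant fields \<open>F : E \<rightarrow> E\<close> on a closed
  invariant subspace \<open>E\<close>, with \<open>U\<close> relatively open in \<open>E\<close>: the approximating fields are identity
  minus a map into a finite-dimensional invariant subspace \<open>W\<close> of \<open>E\<close>.
\<close>

definition fin_dim_approx ::
  "('g, 'b) monoid_scheme \<Rightarrow> ('g \<Rightarrow> 'v::real_inner \<Rightarrow> 'v) \<Rightarrow> 'v set \<Rightarrow> ('v \<Rightarrow> 'v) \<Rightarrow> 'v set \<Rightarrow>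
   real \<Rightarrow> ('v set \<times> ('v \<Rightarrow> 'v)) set" where
  "fin_dim_approx G act E F U \<delta> = {(W, h).
     (\<exists>B. finite B \<and> W = span B) \<and> W \<subseteq> E \<and>
     (\<forall>g\<in>carrier G. act g ` W \<subseteq> W) \<and>
     continuous_on (closure U) h \<and>
     (\<forall>x\<in>closure U. x - h x \<in> W) \<and>
     (\<forall>g\<in>carrier G. \<forall>x\<in>closure U. h (act g x) = act g (h x)) \<and>
     (\<forall>x\<in>closure U. norm (h x - F x) < \<delta>)}"

definition Gdeg ::
  "('g, 'b) monoid_scheme \<Rightarrow> 'g topology \<Rightarrow> ('g \<Rightarrow> 'v::real_inner \<Rightarrow> 'v) \<Rightarrow>
   'v set \<Rightarrow> ('v \<Rightarrow> 'v) \<Rightarrow> 'v set \<Rightarrow> ('g set set \<Rightarrow>\<^sub>0 int)" where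
  "Gdeg G T act E F U =
     eventual_value (fin_dim_approx G act E F U) (\<lambda>(W, h). Gdeg_fin G T act W h (U \<inter> W))"

section \<open>The boundary value problem and the invariant\<close>

definition periodic_solution ::
  "real \<Rightarrow> ('v::real_normed_vector \<Rightarrow> 'v) \<Rightarrow> (real \<Rightarrow> 'v) \<Rightarrow> bool" where
  "periodic_solution lam f x \<longleftrightarrow>
     (\<exists>v. (\<forall>t. (x has_vector_derivative v t) (at t)) \<and>
          (\<forall>t. (v has_vector_derivative lam\<^sup>2 *\<^sub>R f (x t)) (at t)) \<and>
          (\<forall>t. x t = x (t + 2 * pi)) \<and> (\<forall>t. v t = v (t + 2 * pi)))"

definition L_inv :: "(real \<Rightarrow> 'v::euclidean_space) \<Rightarrow> 'v h2" where
  "L_inv y = (THE z. AE t in lborel. h2_d2 z t - h2_fun z t = y t)"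

definition field_F ::
  "real \<Rightarrow> ('v::euclidean_space \<Rightarrow> 'v) \<Rightarrow> real \<Rightarrow> 'v h2 \<Rightarrow> 'v h2" where
  "field_F lam f \<tau> x = x - \<tau> *\<^sub>R L_inv (\<lambda>t. lam\<^sup>2 *\<^sub>R f (h2_fun x t) - h2_fun x t)"

definition Z2md :: "'g monoid \<Rightarrow> nat \<Rightarrow> ('g \<times> int \<times> (real^2^2)) set" where
  "Z2md \<Gamma> m = generate (GG \<Gamma>) {(\<one>\<^bsub>\<Gamma>\<^esub>, - 1, rot (pi / real m))}"

definition h2_fix :: "'g monoid \<Rightarrow> ('g \<Rightarrow> 'n \<Rightarrow> 'n) \<Rightarrow> nat \<Rightarrow> (real^'n::finite) h2 set" where
  "h2_fix \<Gamma> \<phi> m = fixed_points (h2_act \<Gamma> \<phi>) (Z2md \<Gamma> m) UNIV"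

text \<open>
  \<open>\<omega>\<^sup>H\<close> does not depend on the choice of the radii \<open>R\<close> and \<open>\<epsilon>\<close>, by the excision and additivity
  properties of the degree.
\<close>

definition radius_R :: "real \<Rightarrow> ('v::euclidean_space \<Rightarrow> 'v) \<Rightarrow> real" where
  "radius_R lam f = (SOME R. R > 0 \<and>
     (\<forall>\<tau>\<in>{0..1}. \<forall>x. field_F lam f \<tau> x = 0 \<longrightarrow> x \<in> ball 0 R))"

definition radius_eps ::
  "'g monoid \<Rightarrow> ('g \<Rightarrow> 'n \<Rightarrow> 'n) \<Rightarrow> real \<Rightarrow> (real^'n::finite \<Rightarrow> real^'n) \<Rightarrow> nat \<Rightarrow> real" where
  "radius_eps \<Gamma> \<phi> lam f m = (SOME \<epsilon>. 0 < \<epsilon> \<and> \<epsilon> < radius_R lam f \<and>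
     (\<forall>x\<in>cball 0 \<epsilon> \<inter> h2_fix \<Gamma> \<phi> m. field_F lam f 1 x = 0 \<longrightarrow> x = 0))"

definition omega_H ::
  "'g monoid \<Rightarrow> ('g \<Rightarrow> 'n \<Rightarrow> 'n) \<Rightarrow> real \<Rightarrow> (real^'n::finite \<Rightarrow> real^'n) \<Rightarrow> nat \<Rightarrow>
   ('g \<times> int \<times> (real^2^2)) set set \<Rightarrow>\<^sub>0 int" where
  "omega_H \<Gamma> \<phi> lam f m =
     Gdeg (GG \<Gamma>) (GG_topology \<Gamma>) (h2_act \<Gamma> \<phi>) (h2_fix \<Gamma> \<phi> m) (field_F lam f 1)
       ((ball 0 (radius_R lam f) - cball 0 (radius_eps \<Gamma> \<phi> lam f m)) \<inter> h2_fix \<Gamma> \<phi> m)"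

definition complex_spectrum :: "real^'n^'n \<Rightarrow> complex set" where
  "complex_spectrum A = {\<mu>. \<not> invertible (map_matrix complex_of_real A - mat \<mu>)}"

end

theory Submission
  imports
    "HOL-Algebra.Multiplicative_Group"
    Defs
    "HOL-Library.Periodic_Fun"
    "HOL-Analysis.Kronecker_Approximation_Theorem"
    "HOL-Complex_Analysis.Great_Picard"
    "HOL-Computational_Algebra.Fundamental_Theorem_Algebra"
begin

text \<open>
  If \<open>\<omega>\<^sup>H \<noteq> 0\<close>, the value of the degree is attained on arbitrarily fine finite-dimensional
  approximations (without any such approximation every value would be an eventual one).  For a class
  \<open>c\<close> with nonzero coefficient choose a maximal class \<open>d \<ge> c\<close> with nonzero coefficient: the
  recurrence at \<open>d\<close> has an empty sum, hence the Brouwer degree on the fixed space of a representative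
  \<open>K\<close> of \<open>d\<close> is nonzero, and \<open>\<F>\<close> has \<open>\<delta>\<close>-zeros in \<open>\<Omega>\<close> fixed by \<open>K\<close>, for every \<open>\<delta> > 0\<close>.  By
  Arzela--Ascoli and the estimate \<open>\<parallel>L\<^sup>-\<^sup>1 y\<parallel> \<le> \<surd>(2\<pi>) sup |y|\<close> they accumulate at a zero \<open>z\<close> with
  \<open>\<parallel>z\<parallel> \<ge> \<epsilon>\<close>, which is antiperiodic and thus not constant; translating it by an element of \<open>G\<close> gives
  the required isotropy.  The radius \<open>R\<close> exists by a maximum principle, and \<open>\<epsilon>\<close> by linearisation at
  \<open>0\<close>: an antiperiodic solution of \<open>x'' = \<lambda>\<^sup>2 Df(0) x\<close> vanishes by induction on the degree of a
  polynomial annihilating \<open>Df(0)\<close>.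
\<close>

section \<open>The operator \<open>L\<^sup>-\<^sup>1\<close>\<close>

text \<open>A maximal class above \<open>c\<close> is available because \<open>class_le\<close> is
  antisymmetric on \<open>Phi0\<close>. In a general infinite group a subgroup can be conjugate to a
  proper subgroup of itself, so this is a fact about closed subgroups of a compact group; it is
  reduced to the recurrence of a rotation (Dirichlet approximation). The maximal class may lie
  strictly above \<open>c\<close>, which is why the conclusion is an inclusion in the isotropy group
  and not an equality. The radii are picked by \<open>SOME\<close>, so
  \<open>radius_eps > 0\<close>, which separates the limit from the trivial solution, has to be
  earned by proving that suitable radii exist: (A3) enters through \<open>radius_R\<close>, the
  nonresonance condition through \<open>radius_eps\<close>. One compactness statement,
  \<open>h2_compactness\<close>, serves both the normalised zeros near 0 and the approximate zeros
  in the annulus: it asks only for uniform convergence of right-hand sides, which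
  \<open>L_inv\<close> converts into convergence in the Sobolev norm.\<close>

lemma h2_norm_sq:
  "(norm x)\<^sup>2 = (LINT t:{0..2 * pi}|lborel.
     (norm (h2_d2 x t))\<^sup>2 + (norm (h2_d1 x t))\<^sup>2 + (norm (h2_fun x t))\<^sup>2)"
  by (simp add: power2_norm_eq_inner inner_h2_def)

lemma h2_d1_periodic: "h2_d1 x (t + 2 * pi) = h2_d1 x t"
proof -
  have "h2_derivs (\<lambda>t. h2_fun x (2 * pi + 1 * t)) (\<lambda>t. 1 *\<^sub>R h2_d1 x (2 * pi + 1 * t))
      (\<lambda>t. h2_d2 x (2 * pi + 1 * t))"
    by (rule h2_derivs_affine) (auto simp: h2_derivs_h2)
  moreover have "(\<lambda>t. h2_fun x (2 * pi + 1 * t)) = h2_fun x"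
    using h2_periodic[of x] by (simp add: add.commute)
  ultimately have "h2_d1 x = (\<lambda>t. h2_d1 x (2 * pi + t))"
    using h2_d1_d2_eqI(1) by fastforce
  then show ?thesis by (metis add.commute)
qed

lemma periodic_representative:
  fixes g :: "real \<Rightarrow> 'a"
  assumes per: "\<And>t. g (t + 2 * pi) = g t"
  obtains s where "s \<in> {0..2 * pi}" "g t = g s"
proof -
  interpret periodic_fun_simple g "2 * pi" by standard (rule per)
  define k where "k = \<lfloor>t / (2 * pi)\<rfloor>"
  have "of_int k \<le> t / (2 * pi)" "t / (2 * pi) \<le> of_int k + 1"
    unfolding k_def by linarith+
  then have "t - of_int k * (2 * pi) \<in> {0..2 * pi}" by (auto simp: field_simps)
  moreover have "g t = g (t - of_int k * (2 * pi))" by (simp add: minus_of_int)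
  ultimately show thesis by (rule that)
qed

lemma h2_integrable_parts:
  "set_integrable lborel {0..2 * pi} (\<lambda>t. (norm (h2_d2 x t))\<^sup>2)"
  "set_integrable lborel {0..2 * pi} (\<lambda>t. (norm (h2_d1 x t))\<^sup>2)"
  "set_integrable lborel {0..2 * pi} (\<lambda>t. (norm (h2_fun x t))\<^sup>2)"
  using h2_derivs_h2[of x] unfolding h2_derivs_def
  by (blast, (intro borel_integrable_atLeastAtMost' continuous_intros)+)

lemma h2_fun_diff_eq:
  assumes "a \<le> b"
  shows "h2_fun x b - h2_fun x a = (LINT t:{a..b}|lborel. h2_d1 x t)"
proof -
  have "(h2_d1 x has_integral h2_fun x b - h2_fun x a) {a..b}"
    using assms h2_derivs_h2[of x] unfolding h2_derivs_def
    by (intro fundamental_theorem_of_calculus) (auto intro: has_vector_derivative_at_within)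
  moreover have "set_integrable lborel {a..b} (h2_d1 x)"
    by (intro borel_integrable_atLeastAtMost' continuous_intros)
  ultimately show ?thesis
    using set_borel_integral_eq_integral(2) by (metis integral_unique)
qed

text \<open>Sobolev embedding in dimension one. The L2 bound on \<open>w\<close> forces
  \<open>norm (w t0) \<le> 1\<close> at some point of the period, since otherwise the integral would
  be at least 2 pi; from there \<open>w\<close> moves by at most the integral of |y|, which is at
  most that of 1 + |y|^2, hence at most 2 pi + 1. It is phrased for a pair \<open>w\<close>,
  \<open>y\<close> so as to apply to (x, x') and to (x', x'').\<close>

lemma periodic_sup_bound:
  fixes w y :: "real \<Rightarrow> 'v::euclidean_space"
  assumes per: "\<And>t. w (t + 2 * pi) = w t" and cont: "continuous_on UNIV w"
    and inc: "\<And>a b. a \<le> b \<Longrightarrow> w b - w a = (LINT t:{a..b}|lborel. y t)"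
    and int: "\<And>a b. set_integrable lborel {a..b} y"
      "set_integrable lborel {0..2 * pi} (\<lambda>t. (norm (y t))\<^sup>2)"
    and le: "(LINT t:{0..2 * pi}|lborel. (norm (y t))\<^sup>2) \<le> 1"
      "(LINT t:{0..2 * pi}|lborel. (norm (w t))\<^sup>2) \<le> 1"
  shows "norm (w t) \<le> 2 + 2 * pi"
proof -
  have m: "measure lborel {0..2 * pi} = 2 * pi" by simp
  have c: "set_integrable lborel {0..2 * pi} (\<lambda>t. c :: real)" for c
    by (intro borel_integrable_atLeastAtMost' continuous_intros)
  have ci: "(LINT t:{0..2 * pi}|lborel. (1::real)) = 2 * pi"
    unfolding set_lebesgue_integral_def by simp
  have "\<exists>t0\<in>{0..2 * pi}. norm (w t0) \<le> 1"
  proof (rule ccontr)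
    assume "\<not> ?thesis"
    then have gt: "1 \<le> norm (w t)" if "t \<in> {0..2 * pi}" for t using that by force
    have "(LINT t:{0..2 * pi}|lborel. (1::real)) \<le> (LINT t:{0..2 * pi}|lborel. (norm (w t))\<^sup>2)"
    proof (rule set_integral_mono[OF c])
      show "set_integrable lborel {0..2 * pi} (\<lambda>t. (norm (w t))\<^sup>2)"
        unfolding set_integrable_def
        by (intro borel_integrable_compact continuous_intros continuous_on_subset[OF cont]) auto
    qed (use gt in simp)
    then show False using le(2) ci pi_gt3 by linarith
  qed
  then obtain t0 where t0: "t0 \<in> {0..2 * pi}" "norm (w t0) \<le> 1" by blast
  have ab: "norm (w b - w a) \<le> 2 * pi + 1" if ab: "0 \<le> a" "a \<le> b" "b \<le> 2 * pi" for a b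
  proof -
    have ny: "set_integrable lborel {a..b} (\<lambda>t. norm (y t))" for a b
      by (rule set_integrable_norm[OF int(1)])
    have "norm (w b - w a) \<le> (LINT t:{a..b}|lborel. norm (y t))"
      unfolding inc[OF ab(2)] by (rule set_integral_norm_bound[OF int(1)])
    also have "\<dots> \<le> (LINT t:{0..2*pi}|lborel. norm (y t))"
      unfolding set_lebesgue_integral_def
      using ab ny[of a b] ny[of 0 "2 * pi"]
      by (intro integral_mono) (auto simp: set_integrable_def indicator_def)
    also have "\<dots> \<le> (LINT t:{0..2*pi}|lborel. 1 + (norm (y t))\<^sup>2)"
    proof (rule set_integral_mono[OF ny set_integral_add(1)[OF c int(2)]])
      fix t
      have "2 * norm (y t) \<le> 1 + (norm (y t))\<^sup>2"
        using sum_squares_bound[of "norm (y t)" 1] by simp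
      then show "norm (y t) \<le> 1 + (norm (y t))\<^sup>2"
        using norm_ge_zero[of "y t"] by linarith
    qed
    also have "\<dots> = 2 * pi + (LINT t:{0..2*pi}|lborel. (norm (y t))\<^sup>2)"
      using set_integral_add(2)[OF c int(2)] ci by simp
    finally show ?thesis using le(1) by simp
  qed
  obtain s where s: "s \<in> {0..2 * pi}" "w t = w s" 
    using periodic_representative[of w t, OF per] by blast
  have "norm (w s - w t0) \<le> 2 * pi + 1"
    using s(1) t0(1) ab[of s t0] ab[of t0 s] by (cases "s \<le> t0") (auto simp: norm_minus_commute)
  then show ?thesis using t0(2) norm_triangle_ineq2[of "w s" "w t0"] s(2) by simp
qed

lemma h2_sup_bound_unit:
  assumes "norm x \<le> 1"
  shows "norm (h2_fun x t) \<le> 2 + 2 * pi" "norm (h2_d1 x t) \<le> 2 + 2 * pi"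
proof -
  let ?I = "\<lambda>f. LINT t:{0..2 * pi}|lborel. (f t :: real)"
  have sum: "?I (\<lambda>t. (norm (h2_d2 x t))\<^sup>2) + ?I (\<lambda>t. (norm (h2_d1 x t))\<^sup>2) +
      ?I (\<lambda>t. (norm (h2_fun x t))\<^sup>2) \<le> 1"
    using power_mono[OF assms, of 2]
    by (simp add: h2_norm_sq set_integral_add h2_integrable_parts)
  have nn: "0 \<le> ?I (\<lambda>t. (norm (g t))\<^sup>2)" for g :: "real \<Rightarrow> 'a"
    unfolding set_lebesgue_integral_def by (intro integral_nonneg_AE AE_I2) simp
  note a = h2_derivs_h2[of x, unfolded h2_derivs_def]
  have i1: "set_integrable lborel {a..b} (h2_d1 x)" for a b
    by (intro borel_integrable_atLeastAtMost' continuous_intros)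
  show "norm (h2_fun x t) \<le> 2 + 2 * pi"
    by (rule periodic_sup_bound[of "h2_fun x" "h2_d1 x"])
      (use sum nn[of "h2_fun x"] nn[of "h2_d1 x"] nn[of "h2_d2 x"] in
        \<open>auto simp: h2_periodic h2_fun_diff_eq h2_integrable_parts i1 intro: h2_continuous\<close>)
  show "norm (h2_d1 x t) \<le> 2 + 2 * pi"
    by (rule periodic_sup_bound[of "h2_d1 x" "h2_d2 x"])
      (use a sum nn[of "h2_fun x"] nn[of "h2_d1 x"] nn[of "h2_d2 x"] in
        \<open>auto simp: h2_d1_periodic h2_integrable_parts intro: h2_continuous\<close>)
qed

lemma h2_sup_bound:
  "norm (h2_fun x t) \<le> (2 + 2 * pi) * norm x" "norm (h2_d1 x t) \<le> (2 + 2 * pi) * norm x"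
proof -
  have "norm (h2_fun x t) \<le> (2 + 2 * pi) * norm x \<and> norm (h2_d1 x t) \<le> (2 + 2 * pi) * norm x"
  proof (cases "x = 0")
    case True
    then show ?thesis using h2_d1_scaleR[of 0 x] by (simp add: h2_fun_zero)
  next
    case False
    then have "norm ((1 / norm x) *\<^sub>R x) \<le> 1" by simp
    from h2_sup_bound_unit[OF this, of t] show ?thesis
      using False by (simp add: h2_fun_scaleR h2_d1_scaleR field_simps)
  qed
  then show "norm (h2_fun x t) \<le> (2 + 2 * pi) * norm x" "norm (h2_d1 x t) \<le> (2 + 2 * pi) * norm x"
    by auto
qed

lemma h2_derivs_C2:
  fixes x :: "real \<Rightarrow> 'v::euclidean_space"
  assumes x: "\<And>t. (x has_vector_derivative v t) (at t)"
    and v: "\<And>t. (v has_vector_derivative w t) (at t)" and w: "continuous_on UNIV w"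
  shows "h2_derivs x v w"
proof -
  have c: "continuous_on {a..b} w" "continuous_on {a..b} (\<lambda>t. (norm (w t))\<^sup>2)" for a b
    by (intro continuous_intros continuous_on_subset[OF w] subset_UNIV)+
  have "v b - v a = (LINT t:{a..b}|lborel. w t)" if "a \<le> b" for a b
  proof -
    have "(w has_integral v b - v a) {a..b}"
      using that v by (intro fundamental_theorem_of_calculus)
        (auto intro: has_vector_derivative_at_within)
    then show ?thesis
      using set_borel_integral_eq_integral(2)[OF borel_integrable_atLeastAtMost'[OF c(1)]]
      by (metis integral_unique)
  qed
  with x c w show ?thesis
    unfolding h2_derivs_def
    by (auto intro!: borel_integrable_atLeastAtMost' borel_measurable_continuous_onI)
qed

lemma inner_has_real_derivative:
  fixes x y :: "real \<Rightarrow> 'v::real_inner"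
  assumes "(x has_vector_derivative x') (at t)" "(y has_vector_derivative y') (at t)"
  shows "((\<lambda>t. x t \<bullet> y t) has_real_derivative x t \<bullet> y' + x' \<bullet> y t) (at t)"
proof -
  have "((\<lambda>t. x t \<bullet> y t) has_derivative (\<lambda>h. x t \<bullet> (h *\<^sub>R y') + (h *\<^sub>R x') \<bullet> y t)) (at t)"
    using assms unfolding has_vector_derivative_def by (intro has_derivative_inner) auto
  then show ?thesis
    unfolding has_field_derivative_def
    by (rule has_derivative_eq_rhs) (simp add: fun_eq_iff algebra_simps)
qed

text \<open>Since \<open>|y|\<^sup>2 = |z'' - z|\<^sup>2 = |z''|\<^sup>2 + 2 |z'|\<^sup>2 + |z|\<^sup>2 - 2 (z \<bullet> z')'\<close>, where the last term integrates to
  zero over a period, \<open>\<parallel>z\<parallel>\<^sup>2 \<le> \<integral> |y|\<^sup>2\<close>.\<close>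

lemma h2_norm_le_of_ode:
  fixes z :: "'v::euclidean_space h2"
  assumes z: "\<And>t. (h2_d1 z has_vector_derivative h2_fun z t + y t) (at t)"
    and y: "continuous_on UNIV y" and b: "\<And>t. norm (y t) \<le> b"
  shows "norm z \<le> sqrt (2 * pi) * b"
proof -
  have b0: "0 \<le> b" using b[of 0] norm_ge_zero order_trans by blast
  let ?x = "h2_fun z" and ?v = "h2_d1 z"
  let ?w = "\<lambda>t. ?x t + y t"
  have xv: "(?x has_vector_derivative ?v t) (at t)" for t
    using h2_derivs_h2[of z] by (simp add: h2_derivs_def)
  have w: "continuous_on S ?w" for S
    by (intro continuous_intros continuous_on_subset[OF y] subset_UNIV)
  have "((\<lambda>t. ?x t \<bullet> ?v t) has_vector_derivative (norm (?v t))\<^sup>2 + ?x t \<bullet> ?w t) (at t within S)" for t S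
    using inner_has_real_derivative[OF xv z, of t]
    by (auto simp: power2_norm_eq_inner add.commute has_real_derivative_iff_has_vector_derivative
        intro: has_vector_derivative_at_within)
  then have "((\<lambda>t. (norm (?v t))\<^sup>2 + ?x t \<bullet> ?w t) has_integral
      (?x (2 * pi) \<bullet> ?v (2 * pi) - ?x 0 \<bullet> ?v 0)) {0..2 * pi}"
    by (intro fundamental_theorem_of_calculus) auto
  then have "((\<lambda>t. (norm (?v t))\<^sup>2 + ?x t \<bullet> ?w t) has_integral 0) {0..2 * pi}"
    using h2_periodic[of z 0] h2_d1_periodic[of z 0] by simp
  from has_integral_add[OF has_integral_const_real[of "b\<^sup>2" 0 "2 * pi"] has_integral_mult_right[OF this, of 2]]
  have I: "((\<lambda>t. b\<^sup>2 + 2 * ((norm (?v t))\<^sup>2 + ?x t \<bullet> ?w t)) has_integral 2 * pi * b\<^sup>2) {0..2 * pi}"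
    by simp
  let ?N = "\<lambda>t. (norm (?w t))\<^sup>2 + (norm (?v t))\<^sup>2 + (norm (?x t))\<^sup>2"
  have "AE t in lborel. h2_d2 z t = ?w t"
    by (rule h2_d1_d2_eqI(2)[OF h2_derivs_C2[OF xv z w]])
  moreover have [measurable]: "h2_d2 z \<in> borel_measurable borel"
    using h2_derivs_h2[of z] by (simp add: h2_derivs_def)
  moreover have [measurable]: "?w \<in> borel_measurable borel"
    "?x \<in> borel_measurable borel" "?v \<in> borel_measurable borel" "y \<in> borel_measurable borel"
    by (intro borel_measurable_continuous_onI w y h2_continuous)+
  ultimately have "(norm z)\<^sup>2 = (LINT t:{0..2 * pi}|lborel. ?N t)"
    unfolding h2_norm_sq
    by (intro set_lebesgue_integral_cong_AE) (measurable, auto elim!: eventually_mono)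
  moreover have Nint: "set_integrable lborel {0..2 * pi} ?N"
    by (intro borel_integrable_atLeastAtMost' continuous_intros continuous_on_subset[OF y] subset_UNIV)
  ultimately have "(?N has_integral (norm z)\<^sup>2) {0..2 * pi}"
    using set_borel_integral_eq_integral[OF Nint] by (simp add: has_integral_integral)
  then have "(norm z)\<^sup>2 \<le> 2 * pi * b\<^sup>2"
  proof (rule has_integral_le[OF _ I])
    fix t
    have "(norm (y t))\<^sup>2 = (norm (?w t - ?x t))\<^sup>2" by simp
    also have "\<dots> = (norm (?w t))\<^sup>2 + (norm (?x t))\<^sup>2 - 2 * (?x t \<bullet> ?w t)"
      unfolding power2_norm_eq_inner by (simp add: inner_simps inner_commute algebra_simps)
    finally show "?N t \<le> b\<^sup>2 + 2 * ((norm (?v t))\<^sup>2 + ?x t \<bullet> ?w t)"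
      using power_mono[OF b[of t] norm_ge_zero, of 2] zero_le_power2[of "norm (?v t)"]
      unfolding distrib_left by argo
  qed
  then have "norm z \<le> sqrt (2 * pi * b\<^sup>2)" by (simp add: real_le_rsqrt)
  with b0 show ?thesis by (simp add: real_sqrt_mult)
qed

text \<open>Variation of constants. As \<open>c\<close> is not 0, \<open>exp (2 * pi * c)\<close>
  differs from 1, so the initial value can be solved for from the condition that the solution closes
  up after one period.\<close>

lemma periodic_first_order_ode:
  fixes y :: "real \<Rightarrow> 'v::euclidean_space"
  assumes y: "continuous_on UNIV y" and per: "\<And>t. y (t + 2 * pi) = y t" and c: "c \<noteq> 0"
  obtains p where "\<And>t. (p has_vector_derivative c *\<^sub>R p t + y t) (at t)" "\<And>t. p (t + 2 * pi) = p t"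
proof -
  define g where "g t = exp (- c * t) *\<^sub>R y t" for t
  have g: "continuous_on S g" for S
    unfolding g_def by (intro continuous_intros continuous_on_subset[OF y] subset_UNIV)
  obtain a where a: "\<And>t. (a has_vector_derivative g t) (at t)"
  proof -
    \<comment> \<open>Two branches are needed because the integral over \<open>{0..t}\<close> is
      taken over the empty set for negative \<open>t\<close>.\<close>
    define a where "a t = (if 0 \<le> t then integral {0..t} g else - integral {t..0} g)" for t
    have "(a has_vector_derivative g t) (at t)" for t
    proof -
      define r where "r = \<bar>t\<bar> + 1"
      have "((\<lambda>u. integral {-r..u} g) has_vector_derivative g t) (at t within {-r..r})"
        by (rule integral_has_vector_derivative[OF g]) (auto simp: r_def)
      then have "((\<lambda>u. integral {-r..u} g) has_vector_derivative g t) (at t)"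
        using at_within_Icc_at[of "-r" t r] by (simp add: r_def abs_if split: if_splits)
      then have d: "((\<lambda>u. integral {-r..u} g - integral {-r..0} g) has_vector_derivative g t) (at t)"
        by (auto intro!: derivative_eq_intros)
      have e: "integral {-r..u} g - integral {-r..0} g = a u" if "u \<in> {-r<..<r}" for u
      proof (cases "0 \<le> u")
        case True
        have "integral {-r..0} g + integral {0..u} g = integral {-r..u} g"
          using True that by (intro Henstock_Kurzweil_Integration.integral_combine
              integrable_continuous_interval g) auto
        then show ?thesis using True by (simp add: a_def algebra_simps)
      next
        case False
        have "integral {-r..u} g + integral {u..0} g = integral {-r..0} g"
          using False that by (intro Henstock_Kurzweil_Integration.integral_combine
              integrable_continuous_interval g) auto
        then show ?thesis using False by (simp add: a_def algebra_simps)
      qed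
      show ?thesis
        by (rule has_vector_derivative_transform_within_open[OF d, of "{-r<..<r}"])
          (use e in \<open>auto simp: r_def\<close>)
    qed
    then show thesis by (rule that)
  qed
  \<comment> \<open>With e = exp (2 pi c), this solves e (a (2 pi) + A) = a 0 + A, that is p (2 pi)
    = p 0.\<close>
  define A where "A = (1 / (1 - exp (2 * pi * c))) *\<^sub>R exp (2 * pi * c) *\<^sub>R (a (2 * pi) - a 0) - a 0"
  define p where "p t = exp (c * t) *\<^sub>R (a t + A)" for t
  have p: "(p has_vector_derivative c *\<^sub>R p t + y t) (at t)" for t
  proof -
    have "(p has_vector_derivative exp (c * t) *\<^sub>R g t + (exp (c * t) * c) *\<^sub>R (a t + A)) (at t)"
      unfolding p_def by (auto intro!: derivative_eq_intros a)
    moreover have "exp (c * t) *\<^sub>R g t = y t" by (simp add: g_def exp_minus)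
    ultimately show ?thesis by (simp add: p_def mult.commute add.commute)
  qed
  define e where "e = exp (2 * pi * c)"
  have e1: "1 - e \<noteq> 0" using c by (simp add: e_def)
  have A: "a 0 + A = (e / (1 - e)) *\<^sub>R (a (2 * pi) - a 0)" by (simp add: A_def e_def)
  have "p (2 * pi) = e *\<^sub>R ((a (2 * pi) - a 0) + (a 0 + A))"
    by (simp add: p_def e_def algebra_simps)
  also have "\<dots> = (e * (1 + e / (1 - e))) *\<^sub>R (a (2 * pi) - a 0)"
    unfolding A by (simp add: algebra_simps)
  also have "e * (1 + e / (1 - e)) = e / (1 - e)" using e1 by (simp add: field_simps)
  also have "(e / (1 - e)) *\<^sub>R (a (2 * pi) - a 0) = p 0"
    unfolding A[symmetric] by (simp add: p_def)
  finally have p0: "p (0 + 2 * pi) - p 0 = 0" by simp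
  \<comment> \<open>The difference of \<open>p\<close> and its shift solves the homogeneous equation
    because \<open>y\<close> is periodic; the integrating factor makes it constant, and it vanishes
    at 0.\<close>
  define d where "d t = exp (- c * t) *\<^sub>R (p (t + 2 * pi) - p t)" for t
  have "(d has_vector_derivative 0) (at t)" for t
  proof -
    have "((p \<circ> (\<lambda>t. t + 2 * pi)) has_vector_derivative 1 *\<^sub>R (c *\<^sub>R p (t + 2 * pi) + y (t + 2 * pi))) (at t)"
      by (rule vector_diff_chain_at) (auto intro!: derivative_eq_intros p)
    then have q: "((\<lambda>t. p (t + 2 * pi)) has_vector_derivative c *\<^sub>R p (t + 2 * pi) + y t) (at t)"
      by (simp add: o_def per)
    have "(d has_vector_derivative exp (- c * t) *\<^sub>R ((c *\<^sub>R p (t + 2 * pi) + y t) - (c *\<^sub>R p t + y t))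
        + (exp (- c * t) * (- c)) *\<^sub>R (p (t + 2 * pi) - p t)) (at t)"
      unfolding d_def by (intro has_vector_derivative_scaleR has_vector_derivative_diff q p)
        (auto intro!: derivative_eq_intros)
    then show ?thesis by (simp add: algebra_simps)
  qed
  then obtain k where "\<And>t. d t = k"
    using has_vector_derivative_zero_constant[of UNIV d] by auto
  then have "d t = d 0" for t by simp
  moreover have "d 0 = 0" using p0 by (simp add: d_def)
  ultimately have "p (t + 2 * pi) = p t" for t
    unfolding d_def by simp
  with p show thesis by (rule that)
qed

text \<open>Factors the operator x'' - x into two first-order ones: if p' = p + y and q' = - q + y,
  then x = (p - q)/2 has x' = (p + q)/2 and x'' = x + y.\<close>

lemma ex_h2_ode:
  fixes y :: "real \<Rightarrow> 'v::euclidean_space"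
  assumes y: "continuous_on UNIV y" and per: "\<And>t. y (t + 2 * pi) = y t"
  obtains z :: "'v h2" where "\<And>t. (h2_d1 z has_vector_derivative h2_fun z t + y t) (at t)"
proof -
  obtain p where p: "\<And>t. (p has_vector_derivative 1 *\<^sub>R p t + y t) (at t)" "\<And>t. p (t + 2 * pi) = p t"
    using periodic_first_order_ode[OF y per, of 1] by auto
  obtain q where q: "\<And>t. (q has_vector_derivative (- 1) *\<^sub>R q t + y t) (at t)" "\<And>t. q (t + 2 * pi) = q t"
    using periodic_first_order_ode[OF y per, of "-1"] by (metis neg_equal_0_iff_equal zero_neq_one)
  define x v where "x t = (1/2) *\<^sub>R (p t - q t)" and "v t = (1/2) *\<^sub>R (p t + q t)" for t
  have x: "(x has_vector_derivative v t) (at t)" for t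
  proof -
    have "(x has_vector_derivative (1/2) *\<^sub>R ((1 *\<^sub>R p t + y t) - ((- 1) *\<^sub>R q t + y t))) (at t)"
      unfolding x_def
      by (intro bounded_linear.has_vector_derivative[OF bounded_linear_scaleR_right]
          has_vector_derivative_diff p q)
    then show ?thesis by (simp add: v_def algebra_simps)
  qed
  have v: "(v has_vector_derivative x t + y t) (at t)" for t
  proof -
    have "(v has_vector_derivative (1/2) *\<^sub>R ((1 *\<^sub>R p t + y t) + ((- 1) *\<^sub>R q t + y t))) (at t)"
      unfolding v_def
      by (intro bounded_linear.has_vector_derivative[OF bounded_linear_scaleR_right]
          has_vector_derivative_add p q)
    moreover have "(1/2) *\<^sub>R ((1 *\<^sub>R p t + y t) + ((- 1) *\<^sub>R q t + y t)) = x t + y t"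
      by (simp add: x_def algebra_simps flip: scaleR_add_left)
    ultimately show ?thesis by simp
  qed
  have "continuous_on UNIV x"
    using x by (meson continuous_at_imp_continuous_on has_vector_derivative_continuous)
  then have w: "continuous_on UNIV (\<lambda>t. x t + y t)" by (intro continuous_intros y)
  note d = h2_derivs_C2[OF x v w]
  have "x (t + 2 * pi) = x t" for t by (simp add: x_def p q)
  with d have fx: "h2_fun (Abs_h2 x) = x" by (intro Abs_h2_inverse) (auto simp: H2_set_def)
  have "h2_d1 (Abs_h2 x) = v" using h2_d1_d2_eqI(1)[of "Abs_h2 x"] d fx by metis
  with fx v show thesis by (intro that[of "Abs_h2 x"]) simp
qed

lemma h2_d1_diff: "h2_d1 (x - y) = (\<lambda>t. h2_d1 x t - h2_d1 y t)"
  using h2_d1_add[of x "(-1) *\<^sub>R y"] h2_d1_scaleR[of "-1" y] by (simp add: fun_eq_iff)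

text \<open>The second derivative of an element is only a weak one, but it agrees almost everywhere
  with a continuous function, so the first derivative is an integral of that function and the
  equation holds classically. The base point t - 1 keeps \<open>t\<close> in the interior of the
  interval of integration.\<close>

lemma h2_ode_of_AE:
  fixes z :: "'v::euclidean_space h2"
  assumes y: "continuous_on UNIV y" and z: "AE t in lborel. h2_d2 z t - h2_fun z t = y t"
  shows "(h2_d1 z has_vector_derivative h2_fun z t + y t) (at t)"
proof -
  let ?w = "\<lambda>t. h2_fun z t + y t" and ?a = "t - 1"
  have w: "continuous_on S ?w" for S
    by (intro continuous_intros continuous_on_subset[OF y] subset_UNIV)
  note a = h2_derivs_h2[of z, unfolded h2_derivs_def]
  have "h2_d1 z u - h2_d1 z ?a = integral {?a..u} ?w" if "?a \<le> u" for u
  proof -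
    have [measurable]: "h2_d2 z \<in> borel_measurable borel" using a by simp
    have [measurable]: "?w \<in> borel_measurable borel" "h2_fun z \<in> borel_measurable borel"
      "y \<in> borel_measurable borel"
      by (intro borel_measurable_continuous_onI w y h2_continuous)+
    have "h2_d1 z u - h2_d1 z ?a = (LINT s:{?a..u}|lborel. h2_d2 z s)" using a that by simp
    also have "\<dots> = (LINT s:{?a..u}|lborel. ?w s)"
      by (intro set_lebesgue_integral_cong_AE)
        (measurable, use z in \<open>auto elim!: eventually_mono simp: algebra_simps\<close>)
    also have "\<dots> = integral {?a..u} ?w"
      by (rule set_borel_integral_eq_integral(2)[OF borel_integrable_atLeastAtMost'[OF w]])
    finally show ?thesis .
  qed
  then have e: "h2_d1 z ?a + integral {?a..u} ?w = h2_d1 z u" if "?a \<le> u" for u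
    using that by (metis add_diff_cancel_left' diff_add_cancel add.commute)
  have "((\<lambda>u. integral {?a..u} ?w) has_vector_derivative ?w t) (at t within {?a..t+1})"
    by (rule integral_has_vector_derivative[OF w]) auto
  then have "((\<lambda>u. integral {?a..u} ?w) has_vector_derivative ?w t) (at t)"
    using at_within_Icc_at[of ?a t "t + 1"] by simp
  then have "((\<lambda>u. h2_d1 z ?a + integral {?a..u} ?w) has_vector_derivative ?w t) (at t)"
    by (auto intro!: derivative_eq_intros)
  then show ?thesis
    by (rule has_vector_derivative_transform_within_open[where S = "{?a<..}"]) (use e in auto)
qed

lemma L_inv_eqI:
  fixes z :: "'v::euclidean_space h2"
  assumes y: "continuous_on UNIV y"
    and z: "\<And>t. (h2_d1 z has_vector_derivative h2_fun z t + y t) (at t)"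
  shows "L_inv y = z"
  unfolding L_inv_def
proof (rule the_equality)
  have xv: "(h2_fun z has_vector_derivative h2_d1 z t) (at t)" for t
    using h2_derivs_h2[of z] by (simp add: h2_derivs_def)
  have "AE t in lborel. h2_d2 z t = h2_fun z t + y t"
    by (rule h2_d1_d2_eqI(2)[OF h2_derivs_C2[OF xv z]]) (intro continuous_intros y)
  then show "AE t in lborel. h2_d2 z t - h2_fun z t = y t" by (auto elim!: eventually_mono)
  fix z' :: "'v h2"
  assume "AE t in lborel. h2_d2 z' t - h2_fun z' t = y t"
  note z' = h2_ode_of_AE[OF y this]
  \<comment> \<open>Uniqueness: the difference solves the equation with right-hand side 0, so the
    norm estimate with bound 0 makes it vanish.\<close>
  have "(h2_d1 (z' - z) has_vector_derivative h2_fun (z' - z) t + 0) (at t)" for t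
    unfolding h2_d1_diff h2_fun_diff using has_vector_derivative_diff[OF z'[of t] z[of t]] by simp
  from h2_norm_le_of_ode[of "z' - z" "\<lambda>_. 0", OF this, of 0] show "z' = z" by simp
qed

lemma L_inv_ode:
  fixes y :: "real \<Rightarrow> 'v::euclidean_space"
  assumes y: "continuous_on UNIV y" and per: "\<And>t. y (t + 2 * pi) = y t"
  shows "(h2_d1 (L_inv y) has_vector_derivative h2_fun (L_inv y) t + y t) (at t)"
  using ex_h2_ode[OF y per] L_inv_eqI[OF y] by metis

text \<open>This is what upgrades uniform convergence of right-hand sides to convergence of the
  solutions in the Sobolev norm.\<close>

lemma L_inv_dist:
  fixes y y' :: "real \<Rightarrow> 'v::euclidean_space"
  assumes y: "continuous_on UNIV y" "\<And>t. y (t + 2 * pi) = y t"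
    and y': "continuous_on UNIV y'" "\<And>t. y' (t + 2 * pi) = y' t"
    and b: "\<And>t. norm (y t - y' t) \<le> b"
  shows "norm (L_inv y - L_inv y') \<le> sqrt (2 * pi) * b"
proof (rule h2_norm_le_of_ode[where y = "\<lambda>t. y t - y' t"])
  show "(h2_d1 (L_inv y - L_inv y') has_vector_derivative
      h2_fun (L_inv y - L_inv y') t + (y t - y' t)) (at t)" for t
    unfolding h2_d1_diff h2_fun_diff
    using has_vector_derivative_diff[OF L_inv_ode[OF y, of t] L_inv_ode[OF y', of t]]
    by (simp add: algebra_simps)
qed (auto intro!: continuous_intros y y' b)

lemma L_inv_scaleR:
  fixes y :: "real \<Rightarrow> 'v::euclidean_space"
  assumes y: "continuous_on UNIV y" "\<And>t. y (t + 2 * pi) = y t"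
  shows "L_inv (\<lambda>t. c *\<^sub>R y t) = c *\<^sub>R L_inv y"
proof (rule L_inv_eqI)
  show "(h2_d1 (c *\<^sub>R L_inv y) has_vector_derivative h2_fun (c *\<^sub>R L_inv y) t + c *\<^sub>R y t) (at t)" for t
    unfolding h2_d1_scaleR h2_fun_scaleR
    using bounded_linear.has_vector_derivative[OF bounded_linear_scaleR_right[of c] L_inv_ode[OF y, of t]]
    by (simp add: algebra_simps)
qed (intro continuous_intros y)

section \<open>Compactness and a maximum principle\<close>

lemma h2_lipschitz: "norm (h2_fun x s - h2_fun x t) \<le> (2 + 2 * pi) * norm x * norm (s - t)"
proof (rule differentiable_bound[where S = UNIV and f' = "\<lambda>t h. h *\<^sub>R h2_d1 x t"])
  show "(h2_fun x has_derivative (\<lambda>h. h *\<^sub>R h2_d1 x t)) (at t within UNIV)" for t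
    using h2_derivs_h2[of x] by (simp add: h2_derivs_def has_vector_derivative_def)
  show "onorm (\<lambda>h. h *\<^sub>R h2_d1 x t) \<le> (2 + 2 * pi) * norm x" for t
    using h2_sup_bound(2)[of x t] by (intro onorm_le) (simp add: mult.commute mult_left_mono)
qed auto

lemma tendsto_h2_fun:
  assumes "(x \<longlongrightarrow> z) F"
  shows "((\<lambda>k. h2_fun (x k) t) \<longlongrightarrow> h2_fun z t) F"
proof -
  have "((\<lambda>k. norm (h2_fun (x k) t - h2_fun z t)) \<longlongrightarrow> 0) F"
  proof (rule tendsto_sandwich[OF _ _ tendsto_const])
    have "((\<lambda>k. norm (x k - z)) \<longlongrightarrow> 0) F" using assms by (simp add: LIM_zero tendsto_norm_zero)
    then show "((\<lambda>k. (2 + 2 * pi) * norm (x k - z)) \<longlongrightarrow> 0) F" by (rule tendsto_mult_right_zero)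
    show "\<forall>\<^sub>F k in F. norm (h2_fun (x k) t - h2_fun z t) \<le> (2 + 2 * pi) * norm (x k - z)"
      using h2_sup_bound(1)[of "x k - z" t for k] by (simp add: h2_fun_diff)
  qed simp
  then show ?thesis by (simp add: LIM_zero_iff tendsto_norm_zero_iff)
qed

text \<open>A bound in the norm bounds the functions and their Lipschitz constants, so Arzela-Ascoli
  gives a uniformly convergent subsequence; then the right-hand sides \<open>y (r k)\<close>
  converge uniformly and \<open>L_inv\<close> makes the elements themselves converge. The abstract
  \<open>Y\<close> is the limit form of the right-hand side: nonlinear for the field, linear for the
  blow-up at 0.\<close>

lemma h2_compactness:
  fixes x :: "nat \<Rightarrow> 'v::euclidean_space h2" and y :: "nat \<Rightarrow> real \<Rightarrow> 'v"
    and Y :: "(real \<Rightarrow> 'v) \<Rightarrow> real \<Rightarrow> 'v"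
  assumes bdd: "\<And>k. norm (x k) \<le> B"
    and y: "\<And>k. continuous_on UNIV (y k)" "\<And>k t. y k (t + 2 * pi) = y k t"
    and lim: "(\<lambda>k. x k - L_inv (y k)) \<longlonglongrightarrow> 0"
    and Y: "\<And>u. continuous_on UNIV u \<Longrightarrow> (\<And>t. u (t + 2 * pi) = u t) \<Longrightarrow>
       continuous_on UNIV (Y u) \<and> (\<forall>t. Y u (t + 2 * pi) = Y u t)"
    and Ylim: "\<And>u r. strict_mono r \<Longrightarrow> continuous_on UNIV u \<Longrightarrow>
       uniform_limit UNIV (\<lambda>k. h2_fun (x (r k))) u sequentially \<Longrightarrow>
       uniform_limit UNIV (\<lambda>k. y (r k)) (Y u) sequentially"
  obtains r z where "strict_mono (r :: nat \<Rightarrow> nat)" "(\<lambda>k. x (r k)) \<longlonglongrightarrow> z" "z = L_inv (Y (h2_fun z))"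
proof -
  define C where "C = (2 + 2 * pi) * B"
  have B: "0 \<le> B" using bdd[of 0] norm_ge_zero order_trans by blast
  then have C: "0 \<le> C" by (simp add: C_def)
  have sup: "norm (h2_fun (x k) t) \<le> C" for k t
    using h2_sup_bound(1)[of "x k" t] mult_left_mono[OF bdd[of k], of "2 + 2 * pi"]
    by (simp add: C_def)
  have lip: "norm (h2_fun (x k) s - h2_fun (x k) t) \<le> C * norm (s - t)" for k s t
  proof -
    have "(2 + 2 * pi) * norm (x k) * norm (s - t) \<le> C * norm (s - t)"
      unfolding C_def using bdd by (intro mult_right_mono mult_left_mono) auto
    then show ?thesis using h2_lipschitz[of "x k" s t] by linarith
  qed
  have eq: "\<exists>d. 0 < d \<and> (\<forall>k s. s \<in> {0..2 * pi} \<and> norm (t - s) < d \<longrightarrow>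
      norm (h2_fun (x k) t - h2_fun (x k) s) < e)" if "e > 0" for t e
  proof (intro exI conjI allI impI)
    show "0 < e / (C + 1)" using that C by simp
    fix k s assume s: "s \<in> {0..2 * pi} \<and> norm (t - s) < e / (C + 1)"
    have "norm (h2_fun (x k) t - h2_fun (x k) s) \<le> C * norm (t - s)" by (rule lip)
    also have "\<dots> \<le> (C + 1) * norm (t - s)" by (intro mult_right_mono) auto
    also have "\<dots> < e" using s C by (simp add: field_simps)
    finally show "norm (h2_fun (x k) t - h2_fun (x k) s) < e" .
  qed
  obtain g r where r: "strict_mono (r :: nat \<Rightarrow> nat)"
    and g: "\<And>e. 0 < e \<Longrightarrow> \<exists>N. \<forall>n t. n \<ge> N \<and> t \<in> {0..2 * pi} \<longrightarrow> norm (h2_fun (x (r n)) t - g t) < e"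
    using Arzela_Ascoli[OF compact_Icc, of 0 "2 * pi" "\<lambda>k. h2_fun (x k)" C, OF sup eq] by metis
  \<comment> \<open>Reduction of the time modulo 2 pi: Arzela-Ascoli works on one compact period,
    and its limit \<open>g\<close> is carried to the whole line through
    \<open>\<rho>\<close>.\<close>
  define \<rho> where "\<rho> t = (let k = \<lfloor>t / (2 * pi)\<rfloor> in t - of_int k * (2 * pi))" for t
  have \<rho>: "\<rho> t \<in> {0..2 * pi}" for t
  proof -
    define k where "k = \<lfloor>t / (2 * pi)\<rfloor>"
    have "of_int k \<le> t / (2 * pi)" "t / (2 * pi) \<le> of_int k + 1"
      unfolding k_def by linarith+
    then show ?thesis unfolding \<rho>_def Let_def k_def[symmetric] by (auto simp: field_simps)
  qed
  have x\<rho>: "h2_fun z (\<rho> t) = h2_fun z t" for z :: "'v h2" and t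
    unfolding \<rho>_def Let_def using h2_periodic_int[of z "t - of_int \<lfloor>t / (2 * pi)\<rfloor> * (2 * pi)" "\<lfloor>t / (2 * pi)\<rfloor>"]
    by simp
  define u where "u t = g (\<rho> t)" for t
  have ul: "uniform_limit UNIV (\<lambda>k. h2_fun (x (r k))) u sequentially"
    unfolding uniform_limit_sequentially_iff
  proof (intro allI impI)
    fix e :: real assume "e > 0"
    from g[OF this] obtain N where N: "\<And>n t. n \<ge> N \<Longrightarrow> t \<in> {0..2 * pi} \<Longrightarrow> norm (h2_fun (x (r n)) t - g t) < e"
      by blast
    have "dist (h2_fun (x (r n)) t) (u t) < e" if "n \<ge> N" for n t
      using N[OF that \<rho>[of t]] by (simp add: u_def x\<rho> dist_norm)
    then show "\<exists>N. \<forall>n\<ge>N. \<forall>t\<in>UNIV. dist (h2_fun (x (r n)) t) (u t) < e" by blast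
  qed
  have u: "continuous_on UNIV u"
    by (rule uniform_limit_theorem[OF _ ul]) (simp_all add: h2_continuous)
  have pt: "(\<lambda>k. h2_fun (x (r k)) t) \<longlonglongrightarrow> u t" for t
    by (rule tendsto_uniform_limitI[OF ul]) simp
  have per: "u (t + 2 * pi) = u t" for t
    using LIMSEQ_unique[OF pt[of "t + 2 * pi"]] pt[of t] by (simp add: h2_periodic)
  have Yu: "continuous_on UNIV (Y u)" "\<And>t. Y u (t + 2 * pi) = Y u t"
    using Y[OF u per] by auto
  define z where "z = L_inv (Y u)"
  have "(\<lambda>k. L_inv (y (r k))) \<longlonglongrightarrow> z"
  proof (rule LIMSEQ_I)
    fix e :: real assume e: "e > 0"
    define d where "d = e / (2 * sqrt (2 * pi))"
    have d: "d > 0" using e by (simp add: d_def)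
    with Ylim[OF r u ul] obtain N where N: "\<And>n t. n \<ge> N \<Longrightarrow> dist (y (r n) t) (Y u t) < d"
      unfolding uniform_limit_sequentially_iff by blast
    have "norm (L_inv (y (r n)) - z) < e" if "n \<ge> N" for n
    proof -
      have "norm (L_inv (y (r n)) - z) \<le> sqrt (2 * pi) * d"
        unfolding z_def
        by (rule L_inv_dist[OF y Yu]) (use N[OF that] in \<open>auto simp: dist_norm less_imp_le\<close>)
      also have "\<dots> = e / 2" by (simp add: d_def)
      finally show ?thesis using e by simp
    qed
    then show "\<exists>N. \<forall>n\<ge>N. norm (L_inv (y (r n)) - z) < e" by blast
  qed
  moreover have "(\<lambda>k. x (r k) - L_inv (y (r k))) \<longlonglongrightarrow> 0"
    using LIMSEQ_subseq_LIMSEQ[OF lim r] by (simp add: o_def)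
  ultimately have xz: "(\<lambda>k. x (r k)) \<longlonglongrightarrow> z"
    using tendsto_add[of "\<lambda>k. x (r k) - L_inv (y (r k))" 0 sequentially] by force
  \<comment> \<open>Identifies the limit in the norm with the uniform limit, which closes the fixed
    point equation.\<close>
  have "h2_fun z t = u t" for t
    using LIMSEQ_unique[OF tendsto_h2_fun[OF xz] pt] .
  then have "h2_fun z = u" by blast
  with r xz show thesis by (intro that) (auto simp: z_def)
qed

text \<open>At a maximum of |x|^2 the second derivative 2 (x . w + |v|^2) cannot be positive, but
  outside the ball of radius \<open>M\<close> it would be. By periodicity the maximum over one
  period is global, so it is an interior one even if attained at an endpoint.\<close>

lemma periodic_max_principle:
  fixes x :: "real \<Rightarrow> 'v::euclidean_space"
  assumes per: "\<And>t. x (t + 2 * pi) = x t"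
    and x: "\<And>t. (x has_vector_derivative v t) (at t)"
    and v: "\<And>t. (v has_vector_derivative w t) (at t)"
    and pos: "\<And>t. norm (x t) > M \<Longrightarrow> x t \<bullet> w t > 0"
  shows "norm (x t) \<le> M"
proof -
  let ?\<phi> = "\<lambda>t. x t \<bullet> x t" and ?\<psi> = "\<lambda>t. 2 * (x t \<bullet> v t)"
  have \<phi>: "(?\<phi> has_real_derivative ?\<psi> t) (at t)" for t
    using inner_has_real_derivative[OF x x, of t] by (simp add: inner_commute)
  have \<psi>: "(?\<psi> has_real_derivative 2 * (x t \<bullet> w t + v t \<bullet> v t)) (at t)" for t
    by (rule DERIV_cmult[OF inner_has_real_derivative[OF x v]])
  have "continuous_on {0..2 * pi} ?\<phi>"
    using \<phi> by (meson DERIV_continuous continuous_at_imp_continuous_on)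
  then obtain t0 where t0: "\<And>t. t \<in> {0..2 * pi} \<Longrightarrow> ?\<phi> t \<le> ?\<phi> t0"
    using continuous_attains_sup[of "{0..2 * pi}" ?\<phi>] by fastforce
  have max: "?\<phi> t \<le> ?\<phi> t0" for t
    using t0 periodic_representative[of x t, OF per] by metis
  have le: "norm (x t0) \<le> M"
  proof (rule ccontr)
    assume "\<not> ?thesis"
    then have "x t0 \<bullet> w t0 > 0" by (intro pos) simp
    then have "2 * (x t0 \<bullet> w t0 + v t0 \<bullet> v t0) > 0"
      by (simp add: add_pos_nonneg)
    \<comment> \<open>\<open>w\<close> is not assumed continuous, so positivity of the second
      derivative is known at \<open>t0\<close> alone. It makes the first derivative
      \<open>?\<psi>\<close> positive just to the right of \<open>t0\<close>, and the mean value
      theorem then exceeds the maximum.\<close>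
    from DERIV_pos_inc_right[OF \<psi> this] obtain d
      where d: "d > 0" "\<And>h. 0 < h \<Longrightarrow> h < d \<Longrightarrow> ?\<psi> t0 < ?\<psi> (t0 + h)" by blast
    have "?\<psi> t0 = 0"
      by (rule DERIV_local_max[OF \<phi>, of 1]) (use max in auto)
    with d have pos': "?\<psi> (t0 + h) > 0" if "0 < h" "h < d" for h using that by force
    obtain s where s: "t0 < s" "s < t0 + d / 2" "?\<phi> (t0 + d / 2) - ?\<phi> t0 = (t0 + d / 2 - t0) * ?\<psi> s"
      using MVT2[of t0 "t0 + d / 2" ?\<phi> ?\<psi>] \<phi> d(1) by auto
    then have "?\<phi> (t0 + d / 2) - ?\<phi> t0 > 0"
      using pos'[of "s - t0"] d(1) by simp
    with max[of "t0 + d / 2"] show False by simp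
  qed
  have "norm (x t) \<le> norm (x t0)" using max[of t] by (simp add: norm_le)
  with le show ?thesis by simp
qed

section \<open>Antiperiodic solutions of linear systems\<close>

text \<open>The vector p(M) v, evaluated by Horner's rule with matrix-vector products only.\<close>

definition poly_act :: "'a::field^'n::finite^'n \<Rightarrow> 'a poly \<Rightarrow> 'a^'n \<Rightarrow> 'a^'n" where
  "poly_act M p = fold_coeffs (\<lambda>a f v. a *s v + M *v f v) p (\<lambda>_. 0)"

lemma poly_act_0 [simp]: "poly_act M 0 v = 0"
  by (simp add: poly_act_def)

lemma poly_act_pCons [simp]: "poly_act M (pCons a p) v = a *s v + M *v poly_act M p v"
  by (cases "p = 0 \<and> a = 0") (auto simp: poly_act_def)

lemma poly_act_add: "poly_act M (p + q) v = poly_act M p v + poly_act M q v"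
  by (induction p q rule: poly_induct2)
    (simp_all add: matrix_vector_right_distrib vec.scale_left_distrib)

lemma poly_act_smult: "poly_act M (smult c p) v = c *s poly_act M p v"
  by (induction p) (simp_all add: vector_smult_assoc vec.scale_right_distrib vector_scalar_commute)

lemma poly_act_mult: "poly_act M (p * q) v = poly_act M p (poly_act M q v)"
  by (induction p) (simp_all add: poly_act_add poly_act_smult)

lemma poly_act_vec_add: "poly_act M p (v + w) = poly_act M p v + poly_act M p w"
  by (induction p) (simp_all add: matrix_vector_right_distrib vec.scale_right_distrib)

lemma poly_act_vec_scale: "poly_act M p (c *s v) = c *s poly_act M p v"
  by (induction p)
    (simp_all add: vector_smult_assoc vec.scale_right_distrib vector_scalar_commute mult.commute)

lemma poly_act_vec_zero [simp]: "poly_act M p 0 = 0"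
  using poly_act_vec_scale[of M p 0 0] by simp

lemma poly_act_vec_sum: "poly_act M p (sum g S) = (\<Sum>i\<in>S. poly_act M p (g i))"
  by (induction S rule: infinite_finite_induct) (simp_all add: poly_act_vec_add)

lemma poly_act_sum: "poly_act M (sum g S) v = (\<Sum>i\<in>S. poly_act M (g i) v)"
  by (induction S rule: infinite_finite_induct) (simp_all add: poly_act_add)

lemma poly_act_monom: "poly_act M (monom c i) v = c *s (((*v) M ^^ i) v)"
  by (induction i) (simp_all add: monom_0 monom_Suc vector_scalar_commute)

text \<open>The n + 1 iterates v, M v, ..., M^n v live in dimension n; the coefficients of a linear
  relation among them form \<open>p\<close>.\<close>

lemma annihilating_poly_vec:
  fixes M :: "'a::field^'n::finite^'n"
  obtains p where "p \<noteq> 0" "poly_act M p v = 0"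
proof -
  define b where "b i = ((*v) M ^^ i) v" for i
  let ?N = "{..CARD('n)}"
  show thesis
  proof (cases "inj_on b ?N")
    \<comment> \<open>Linear dependence is a notion for sets, which hide repetitions; two equal
      iterates give the polynomial X^i - X^j directly.\<close>
    case False
    then obtain i j where ij: "i \<noteq> j" "b i = b j" by (auto simp: inj_on_def)
    have "coeff (monom (1::'a) i - monom 1 j) i = 1" using ij by simp
    then have "monom (1::'a) i - monom 1 j \<noteq> 0" by (metis coeff_0 zero_neq_one)
    moreover have "poly_act M (monom 1 i - monom 1 j) v = 0"
    proof -
      have "monom (1::'a) i - monom 1 j = monom 1 i + monom (- 1) j" 
        by (metis diff_conv_add_uminus minus_monom)
      then have "poly_act M (monom 1 i - monom 1 j) v = 1 *s b i + (- 1) *s b j"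
        by (simp only: poly_act_add poly_act_monom b_def)
      then show ?thesis using ij(2) by simp
    qed
    ultimately show thesis by (rule that)
  next
    case True
    have "vec.dependent (b ` ?N)"
      using vec.independent_card_le_dim[of "b ` ?N" UNIV] by (auto simp: card_image[OF True] vec_dim_card card_cart_basis)
    then obtain u where u: "\<exists>x\<in>b ` ?N. u x \<noteq> 0" "(\<Sum>x\<in>b ` ?N. u x *s x) = 0"
      by (auto simp: vec.dependent_finite)
    define p where "p = (\<Sum>i\<in>?N. monom (u (b i)) i)"
    have "poly_act M p v = (\<Sum>i\<in>?N. u (b i) *s b i)"
      by (simp add: p_def poly_act_sum poly_act_monom b_def)
    also have "\<dots> = 0" using u(2) sum.reindex[OF True, of "\<lambda>x. u x *s x"] by simp
    finally have 0: "poly_act M p v = 0" .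
    from u(1) obtain i where i: "i \<in> ?N" "u (b i) \<noteq> 0" by blast
    have "coeff p i = (\<Sum>j\<in>?N. if j = i then u (b j) else 0)"
      by (simp add: p_def coeff_sum)
    then have "coeff p i \<noteq> 0" using i by simp
    then have "p \<noteq> 0" by auto
    then show thesis using 0 by (rule that)
  qed
qed

text \<open>Polynomials in \<open>M\<close> commute, so a product of annihilators of the basis
  vectors kills every basis vector.\<close>

lemma annihilating_poly:
  fixes M :: "'a::field^'n::finite^'n"
  obtains p where "p \<noteq> 0" "\<And>v. poly_act M p v = 0"
proof -
  have "\<exists>p. p \<noteq> 0 \<and> (\<forall>j\<in>J. poly_act M p (axis j 1) = 0)" for J :: "'n set"
  proof (induction rule: finite_induct[OF finite[of J]])
    case 1
    show ?case by (rule exI[of _ 1]) simp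
  next
    case (2 j J)
    then obtain p where p: "p \<noteq> 0" "\<And>i. i \<in> J \<Longrightarrow> poly_act M p (axis i 1) = 0" by blast
    obtain q where q: "q \<noteq> 0" "poly_act M q (axis j 1) = 0" by (rule annihilating_poly_vec)
    have "poly_act M (p * q) (axis i 1) = 0" if "i \<in> insert j J" for i
    proof (cases "i = j")
      case True
      then show ?thesis by (simp add: poly_act_mult q)
    next
      case False
      then show ?thesis using that by (simp add: mult.commute[of p] poly_act_mult p)
    qed
    with p(1) q(1) show ?case by (intro exI[of _ "p * q"]) simp
  qed
  then obtain p where p: "p \<noteq> 0" "\<And>j. poly_act M p (axis j 1) = 0" by blast
  have "poly_act M p v = 0" for v
    by (subst basis_expansion[symmetric]) (simp add: poly_act_vec_sum poly_act_vec_scale p)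
  with p(1) show thesis by (rule that)
qed

lemma mat_mult_vec: "mat \<mu> *v v = \<mu> *s v" for v :: "'a::semiring_1^'n::finite"
  by (simp add: vec_eq_iff matrix_vector_mult_def mat_def if_distrib[of "\<lambda>x. x * _"] cong: if_cong)

text \<open>The solution is exp (\<nu> t) h(0). If h(0) is not 0, antiperiodicity means exp (\<nu>
  pi / m) = -1, so \<nu> is i times an odd multiple of m and \<nu>^2 = - (j m)^2 with j odd, the
  excluded resonance.\<close>

lemma antiperiodic_exp_trivial:
  fixes h :: "real \<Rightarrow> complex"
  assumes h: "\<And>t. (h has_vector_derivative \<nu> * h t) (at t)"
    and m: "m \<ge> 1" and anti: "\<And>t. h (t + pi / real m) = - h t"
    and nonres: "\<And>j::nat. odd j \<Longrightarrow> of_real ((real (j * m))\<^sup>2) + \<nu>\<^sup>2 \<noteq> 0"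
  shows "h t = 0"
proof -
  define k where "k t = exp (- \<nu> * of_real t) * h t" for t
  have "(k has_vector_derivative 0) (at t)" for t
  proof -
    have "((\<lambda>t. exp (- \<nu> * of_real t)) has_vector_derivative - \<nu> * exp (- \<nu> * of_real t)) (at t)"
      by (rule has_vector_derivative_real_field) (auto intro!: derivative_eq_intros)
    from has_vector_derivative_mult[OF this h[of t]] show ?thesis
      unfolding k_def by (simp add: algebra_simps)
  qed
  then obtain c where "\<And>t. k t = c"
    using has_vector_derivative_zero_constant[of UNIV k] by auto
  then have "k t = k 0" for t by simp
  moreover have "h t = exp (\<nu> * of_real t) * k t" for t
    unfolding k_def by (simp add: mult.assoc[symmetric] mult_exp_exp)
  moreover have "k 0 = h 0" by (simp add: k_def)
  ultimately have e: "h t = exp (\<nu> * of_real t) * h 0" for t by metis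
  have "h 0 = 0"
  proof (rule ccontr)
    assume "h 0 \<noteq> 0"
    have "exp (\<nu> * of_real (pi / real m)) * h 0 = - 1 * h 0"
      using anti[of 0] e[of "pi / real m"] by simp
    with \<open>h 0 \<noteq> 0\<close> have "exp (\<nu> * of_real (pi / real m)) = - 1"
      using mult_right_cancel by blast
    then have "exp (\<nu> * of_real (pi / real m)) = exp (\<i> * of_real pi)" by simp
    then obtain n :: int where "\<nu> * of_real (pi / real m) = \<i> * of_real pi + of_int (2 * n) * of_real pi * \<i>"
      unfolding exp_eq by auto
    then have "\<nu> * of_real pi = \<i> * of_real pi * of_int (2 * n + 1) * of_nat m"
      using m by (simp add: field_simps)
    then have nu: "\<nu> = \<i> * (of_int (2 * n + 1) * of_nat m)" by simp
    \<comment> \<open>The odd integer 2 n + 1 may be negative; only its square matters, so its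
      absolute value serves as the natural number \<open>j\<close>.\<close>
    define j where "j = nat \<bar>2 * n + 1\<bar>"
    have "odd j" by (simp add: j_def even_nat_iff)
    moreover have "(real (j * m))\<^sup>2 = (of_int (2 * n + 1) * real m)\<^sup>2"
      by (simp add: j_def power_mult_distrib)
    then have "complex_of_real ((real (j * m))\<^sup>2) = (of_int (2 * n + 1) * of_nat m)\<^sup>2"
      by (simp only: of_real_power of_real_mult of_real_of_int_eq of_real_of_nat_eq)
    then have "complex_of_real ((real (j * m))\<^sup>2) + \<nu>\<^sup>2 = 0"
      unfolding nu by (simp add: power_mult_distrib)
    ultimately show False using nonres by blast
  qed
  with e show ?thesis by simp
qed

lemma antiperiodic_derivative:
  fixes x :: "real \<Rightarrow> 'v::real_normed_vector"
  assumes x: "\<And>t. (x has_vector_derivative v t) (at t)" and anti: "\<And>t. x (t + T) = - x t"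
  shows "v (t + T) = - v t"
proof (rule vector_derivative_unique_at)
  have "((x \<circ> (\<lambda>t. t + T)) has_vector_derivative 1 *\<^sub>R v (t + T)) (at t)"
    by (rule vector_diff_chain_at) (auto intro!: derivative_eq_intros x)
  then show "((\<lambda>t. - x t) has_vector_derivative v (t + T)) (at t)" by (simp add: o_def anti)
  show "((\<lambda>t. - x t) has_vector_derivative - v t) (at t)"
    by (rule has_vector_derivative_minus[OF x])
qed

text \<open>With \<nu> a square root of \<mu>, g' + \<nu> g solves a first-order equation with rate
  \<nu> and vanishes; what remains is g' = - \<nu> g, of the same kind with rate - \<nu>. Applying
  the first-order result in succession covers \<mu> = 0 without a separate case.\<close>

lemma antiperiodic_scalar_ode_trivial:
  fixes g :: "real \<Rightarrow> complex"
  assumes g: "\<And>t. (g has_vector_derivative g' t) (at t)"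
    and g': "\<And>t. (g' has_vector_derivative \<mu> * g t) (at t)"
    and m: "m \<ge> 1" and anti: "\<And>t. g (t + pi / real m) = - g t"
    and nonres: "\<And>j::nat. odd j \<Longrightarrow> of_real ((real (j * m))\<^sup>2) + \<mu> \<noteq> 0"
  shows "g t = 0"
proof -
  define \<nu> where "\<nu> = csqrt \<mu>"
  have \<nu>: "\<nu>\<^sup>2 = \<mu>" "(- \<nu>)\<^sup>2 = \<mu>" by (simp_all add: \<nu>_def)
  have anti': "g' (t + pi / real m) = - g' t" for t by (rule antiperiodic_derivative[OF g anti])
  have "g' t + \<nu> * g t = 0" for t
  proof (rule antiperiodic_exp_trivial[of "\<lambda>t. g' t + \<nu> * g t" \<nu>, OF _ m])
    fix t
    have "((\<lambda>t. g' t + \<nu> * g t) has_vector_derivative \<mu> * g t + \<nu> * g' t) (at t)"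
      by (intro has_vector_derivative_add g' has_vector_derivative_mult_right g)
    then show "((\<lambda>t. g' t + \<nu> * g t) has_vector_derivative \<nu> * (g' t + \<nu> * g t)) (at t)"
      unfolding \<nu>(1)[symmetric] by (simp add: algebra_simps power2_eq_square)
  qed (use anti anti' nonres \<nu> in \<open>auto simp: algebra_simps\<close>)
  then have "g' t = - \<nu> * g t" for t by (metis add_eq_0_iff mult_minus_left add.commute)
  with g have "(g has_vector_derivative - \<nu> * g t) (at t)" for t by metis
  from antiperiodic_exp_trivial[OF this m anti] nonres \<nu>(2) show ?thesis by simp
qed

text \<open>Let p = (X - \<mu>) q annihilate all values of \<open>w\<close>. Then A w with A = M -
  \<mu> is again an antiperiodic solution, annihilated by q, so it vanishes by induction; hence
  \<open>w\<close> takes values in the kernel of A and its components solve scalar equations. Since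
  A w is again a solution, Jordan blocks are covered too. The induction must range over all
  solutions, not over one fixed \<open>w\<close>.\<close>

lemma antiperiodic_linear_ode_trivial:
  fixes M :: "complex^'n::finite^'n" and w :: "real \<Rightarrow> complex^'n"
  assumes m: "m \<ge> 1"
    and nonres: "\<And>(j::nat) \<mu>. odd j \<Longrightarrow> \<not> invertible (M - mat \<mu>) \<Longrightarrow>
      of_real ((real (j * m))\<^sup>2) + c * \<mu> \<noteq> 0"
    and w: "\<And>t. (w has_vector_derivative w' t) (at t)"
      "\<And>t. (w' has_vector_derivative c *s (M *v w t)) (at t)"
      "\<And>t. w (t + pi / real m) = - w t"
  shows "w t = 0"
proof -
  have "p \<noteq> 0 \<Longrightarrow> (\<And>t. poly_act M p (w t) = 0) \<Longrightarrow> 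
      (\<And>t. (w has_vector_derivative w' t) (at t)) \<Longrightarrow>
      (\<And>t. (w' has_vector_derivative c *s (M *v w t)) (at t)) \<Longrightarrow>
      (\<And>t. w (t + pi / real m) = - w t) \<Longrightarrow> w t = 0" for p and w w' :: "real \<Rightarrow> complex^'n" and t
  proof (induction "degree p" arbitrary: p w w' t rule: less_induct)
    case less
    show ?case
    proof (cases "degree p = 0")
      case True
      then obtain a where a: "p = [:a:]" by (rule degree_eq_zeroE)
      with less(2) less(3)[of t] show ?thesis by simp
    next
      case False
      then obtain \<mu> where "poly p \<mu> = 0"
        using fundamental_theorem_of_algebra by (metis constant_degree)
      then obtain q where q: "p = [:- \<mu>, 1:] * q" by (auto simp: poly_eq_0_iff_dvd dvd_def)
      with less(2) have q0: "q \<noteq> 0" by auto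
      have "degree p = Suc (degree q)" unfolding q using q0 by (subst degree_mult_eq) auto
      then have deg: "degree q < degree p" by simp
      define A where "A v = M *v v - \<mu> *s v" for v :: "complex^'n"
      have lin: "linear A"
        by (rule linearI)
          (simp_all add: A_def matrix_vector_right_distrib vec.scale_right_distrib vec_eq_iff
            matrix_vector_mult_def scaleR_sum_right algebra_simps sum_distrib_left sum.distrib)
      then have A: "bounded_linear A" by (simp add: linear_conv_bounded_linear)
      have AM: "A (c *s (M *v v)) = c *s (M *v A v)" for v
        by (simp add: A_def matrix_vector_mult_diff_distrib vec.scale_right_diff_distrib
            vector_scalar_commute vector_smult_assoc mult.commute)
      have "A (w t) = 0" for t
      proof (rule less(1)[OF deg q0, of "\<lambda>t. A (w t)" "\<lambda>t. A (w' t)"])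
        show "poly_act M q (A (w t)) = 0" for t
          using less(3)[of t] unfolding q mult.commute[of "[:- \<mu>, 1:]"] poly_act_mult
          by (simp add: A_def algebra_simps)
        show "((\<lambda>t. A (w t)) has_vector_derivative A (w' t)) (at t)" for t
          by (rule bounded_linear.has_vector_derivative[OF A less(4)])
        show "((\<lambda>t. A (w' t)) has_vector_derivative c *s (M *v A (w t))) (at t)" for t
          using bounded_linear.has_vector_derivative[OF A less(5)] by (simp add: AM)
        show "A (w (t + pi / real m)) = - A (w t)" for t
          unfolding less(6) by (rule linear_neg[OF lin])
      qed
      then have Mw: "M *v w t = \<mu> *s w t" for t by (simp add: A_def)
      show ?thesis
      proof (rule ccontr)
        \<comment> \<open>A root \<mu> of \<open>p\<close> is not yet known to be an eigenvalue. A
          nonzero value of \<open>w\<close> makes it one, and only then does nonresonance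
          apply.\<close>
        assume nz: "w t \<noteq> 0"
        have "(M - mat \<mu>) *v w t = 0"
          using Mw[of t] by (simp add: matrix_vector_mult_diff_rdistrib mat_mult_vec)
        then have ni: "\<not> invertible (M - mat \<mu>)"
          using nz by (auto simp: invertible_left_inverse matrix_left_invertible_ker)
        have "w t $ i = 0" for i
        proof (rule antiperiodic_scalar_ode_trivial[of "\<lambda>t. w t $ i" "\<lambda>t. w' t $ i" "c * \<mu>" m])
          have b: "bounded_linear (\<lambda>v::complex^'n. v $ i)" by (rule bounded_linear_vec_nth)
          show "((\<lambda>t. w t $ i) has_vector_derivative w' t $ i) (at t)" for t
            by (rule bounded_linear.has_vector_derivative[OF b less(4)])
          show "((\<lambda>t. w' t $ i) has_vector_derivative c * \<mu> * w t $ i) (at t)" for t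
            using bounded_linear.has_vector_derivative[OF b less(5)[of t]] by (simp add: Mw mult.assoc)
        qed (use m less(6) nonres ni in auto)
        with nz show False by (simp add: vec_eq_iff)
      qed
    qed
  qed
  moreover obtain p where "p \<noteq> 0" "\<And>v. poly_act M p v = 0"
    using annihilating_poly[of M] by blast
  ultimately show ?thesis using w by blast
qed

section \<open>A priori bounds for the zeros of the field\<close>

lemma field_F_eq_0D:
  assumes f: "continuous_on UNIV f" and F: "field_F lam f \<tau> x = 0"
  shows "x = L_inv (\<lambda>t. \<tau> *\<^sub>R (lam\<^sup>2 *\<^sub>R f (h2_fun x t) - h2_fun x t))"
    and "(h2_d1 x has_vector_derivative
      h2_fun x t + \<tau> *\<^sub>R (lam\<^sup>2 *\<^sub>R f (h2_fun x t) - h2_fun x t)) (at t)"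
proof -
  let ?y = "\<lambda>t. lam\<^sup>2 *\<^sub>R f (h2_fun x t) - h2_fun x t"
  have y: "continuous_on UNIV ?y" "?y (t + 2 * pi) = ?y t" for t
    by (intro continuous_intros continuous_on_compose2[OF f]) (auto simp: h2_periodic)
  show *: "x = L_inv (\<lambda>t. \<tau> *\<^sub>R ?y t)"
    using F unfolding field_F_def L_inv_scaleR[OF y] by simp
  have "continuous_on UNIV (\<lambda>t. \<tau> *\<^sub>R ?y t)" by (intro continuous_intros y)
  from L_inv_ode[OF this] y(2) *
  show "(h2_d1 x has_vector_derivative h2_fun x t + \<tau> *\<^sub>R ?y t) (at t)" by simp
qed

text \<open>A zero solves x'' = \<tau> \<lambda>^2 f(x) + (1 - \<tau>) x, whose right-hand side has
  positive inner product with x once |x| > M, for each \<tau> in [0,1]. The maximum principle thus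
  bounds |x| by \<open>M\<close> uniformly in \<tau>, and the estimate for \<open>L_inv\<close> then
  bounds the norm.\<close>

lemma field_F_zeros_bounded:
  fixes f :: "'v::euclidean_space \<Rightarrow> 'v"
  assumes lam: "lam > 0" and f: "continuous_on UNIV f"
    and A3: "\<exists>M>0. \<forall>u. norm u > M \<longrightarrow> u \<bullet> f u > 0"
  shows "\<exists>R>0. \<forall>\<tau>\<in>{0..1}. \<forall>x. field_F lam f \<tau> x = 0 \<longrightarrow> x \<in> ball 0 R"
proof -
  obtain M where M: "M > 0" "\<And>u. norm u > M \<Longrightarrow> u \<bullet> f u > 0" using A3 by blast
  have "compact (f ` cball 0 M)"
    by (intro compact_continuous_image continuous_on_subset[OF f]) auto
  then obtain b where b: "\<And>u. norm u \<le> M \<Longrightarrow> norm (f u) \<le> b"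
    by (meson bounded_iff compact_imp_bounded image_eqI mem_cball_0)
  \<comment> \<open>The right-hand side is at most \<lambda>^2 b + M on the ball of radius M; sqrt
    (2 pi) is the constant of the norm estimate, and the 1 makes the inequality strict.\<close>
  define R where "R = sqrt (2 * pi) * (lam\<^sup>2 * b + M) + 1"
  have "norm (f 0) \<le> b" using b[of 0] M(1) by simp
  then have b0: "0 \<le> b" using norm_ge_zero order_trans by blast
  have "norm x < R" if \<tau>: "\<tau> \<in> {0..1}" and F: "field_F lam f \<tau> x = 0" for \<tau> x
  proof -
    let ?y = "\<lambda>t. \<tau> *\<^sub>R (lam\<^sup>2 *\<^sub>R f (h2_fun x t) - h2_fun x t)"
    note ode = field_F_eq_0D(2)[OF f F]
    have xv: "(h2_fun x has_vector_derivative h2_d1 x t) (at t)" for t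
      using h2_derivs_h2[of x] by (simp add: h2_derivs_def)
    have "h2_fun x t \<bullet> (h2_fun x t + ?y t) > 0" if "norm (h2_fun x t) > M" for t
    proof -
      let ?u = "h2_fun x t"
      have p: "0 < ?u \<bullet> f ?u" "0 < ?u \<bullet> ?u" using M that by auto
      have "?u \<bullet> (?u + ?y t) = \<tau> * (lam\<^sup>2 * (?u \<bullet> f ?u)) + (1 - \<tau>) * (?u \<bullet> ?u)"
        by (simp add: inner_simps algebra_simps)
      also have "\<dots> > 0"
      \<comment> \<open>The first summand is strictly positive unless \<tau> = 0, in which case the
        second one is |u|^2 > 0.\<close>
      proof (cases "\<tau> = 0")
        case False
        have "0 < \<tau> * (lam\<^sup>2 * (?u \<bullet> f ?u))" "0 \<le> (1 - \<tau>) * (?u \<bullet> ?u)"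
          using False \<tau> p lam by (auto intro!: mult_nonneg_nonneg mult_pos_pos)
        then show ?thesis by (rule add_pos_nonneg)
      qed (use p in simp)
      finally show ?thesis .
    qed
    from periodic_max_principle[OF h2_periodic xv ode this]
    have M': "norm (h2_fun x t) \<le> M" for t .
    have "norm x \<le> sqrt (2 * pi) * (lam\<^sup>2 * b + M)"
    proof (rule h2_norm_le_of_ode[OF ode])
      show "continuous_on UNIV ?y"
        by (intro continuous_intros continuous_on_compose2[OF f]) auto
      fix t
      have "norm (?y t) \<le> norm (lam\<^sup>2 *\<^sub>R f (h2_fun x t) - h2_fun x t)"
        using \<tau> by (simp add: mult_left_le_one_le)
      also have "\<dots> \<le> norm (lam\<^sup>2 *\<^sub>R f (h2_fun x t)) + norm (h2_fun x t)" by (rule norm_triangle_ineq4)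
      also have "\<dots> \<le> lam\<^sup>2 * b + M"
        using M'[of t] b[OF M'[of t]] by (intro add_mono) (auto simp: mult_left_mono)
      finally show "norm (?y t) \<le> lam\<^sup>2 * b + M" .
    qed
    then show ?thesis by (simp add: R_def)
  qed
  moreover have "R > 0"
    unfolding R_def using b0 M(1) by (intro add_nonneg_pos mult_nonneg_nonneg add_nonneg_nonneg) auto
  ultimately show ?thesis by (intro exI[of _ R]) auto
qed

text \<open>The spectrum of a real matrix may be non-real, so the equation is moved to complex
  vectors by the coordinatewise embedding \<open>C\<close>, which is injective and intertwines
  \<open>D\<close> with its matrix.\<close>

lemma complexified_ode_trivial:
  fixes D :: "real^'n::finite \<Rightarrow> real^'n" and x :: "real \<Rightarrow> real^'n"
  assumes m: "m \<ge> 1" and D: "linear D"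
    and nonres: "\<And>(j::nat) \<mu>. odd j \<Longrightarrow> \<mu> \<in> complex_spectrum (matrix D) \<Longrightarrow>
       complex_of_real ((real (j * m))\<^sup>2) + complex_of_real c * \<mu> \<noteq> 0"
    and x: "\<And>t. (x has_vector_derivative v t) (at t)"
      "\<And>t. (v has_vector_derivative c *\<^sub>R D (x t)) (at t)"
      "\<And>t. x (t + pi / real m) = - x t"
  shows "x t = 0"
proof -
  define C :: "real^'n \<Rightarrow> complex^'n" where "C u = (\<chi> i. of_real (u $ i))" for u
  have "linear C" by (rule linearI) (simp_all add: C_def vec_eq_iff, simp add: scaleR_conv_of_real)
  then have C: "bounded_linear C" by (simp add: linear_conv_bounded_linear)
  let ?M = "map_matrix complex_of_real (matrix D)"
  have CD: "C (c *\<^sub>R D u) = of_real c *s (?M *v C u)" for u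
  proof -
    have "D u = matrix D *v u" using D by (simp add: matrix_vector_mul)
    then show ?thesis by (simp add: C_def vec_eq_iff matrix_vector_mult_def map_matrix_def)
  qed
  have "C (x t) = 0"
  proof (rule antiperiodic_linear_ode_trivial[OF m, of ?M "of_real c" "\<lambda>t. C (x t)" "\<lambda>t. C (v t)"])
    show "((\<lambda>t. C (x t)) has_vector_derivative C (v t)) (at t)" for t
      by (rule bounded_linear.has_vector_derivative[OF C x(1)])
    show "((\<lambda>t. C (v t)) has_vector_derivative of_real c *s (?M *v C (x t))) (at t)" for t
      using bounded_linear.has_vector_derivative[OF C x(2)] by (simp add: CD)
    show "C (x (t + pi / real m)) = - C (x t)" for t by (simp add: x(3) C_def vec_eq_iff)
  qed (use nonres in \<open>auto simp: complex_spectrum_def\<close>)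
  then show ?thesis by (simp add: C_def vec_eq_iff)
qed

text \<open>Blow-up: nonzero antiperiodic zeros \<open>x k\<close> tending to 0 are normalised to
  \<open>u k\<close>. A limit of these has norm 1 and solves the linearised antiperiodic problem,
  which has only the trivial solution.\<close>

lemma field_F_zero_isolated:
  fixes f :: "real^'n::finite \<Rightarrow> real^'n"
  assumes m: "m \<ge> 1" and f: "continuous_on UNIV f" and f0: "f 0 = 0"
    and D: "(f has_derivative D) (at 0)"
    and nonres: "\<And>(j::nat) \<mu>. odd j \<Longrightarrow> \<mu> \<in> complex_spectrum (matrix D) \<Longrightarrow>
       complex_of_real ((real (j * m))\<^sup>2) + complex_of_real (lam\<^sup>2) * \<mu> \<noteq> 0"
  shows "\<exists>\<epsilon>>0. \<forall>x. norm x \<le> \<epsilon> \<longrightarrow> (\<forall>t. h2_fun x (t + pi / real m) = - h2_fun x t) \<longrightarrow>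
      field_F lam f 1 x = 0 \<longrightarrow> x = 0"
proof (rule ccontr)
  assume "\<not> ?thesis"
  then have "\<exists>x. norm x \<le> 1 / real (Suc k) \<and> (\<forall>t. h2_fun x (t + pi / real m) = - h2_fun x t) \<and>
      field_F lam f 1 x = 0 \<and> x \<noteq> 0" for k :: nat
    by (metis divide_pos_pos of_nat_0_less_iff zero_less_Suc zero_less_one)
  then obtain x where x: "\<And>k. norm (x k) \<le> 1 / real (Suc k)"
    "\<And>k t. h2_fun (x k) (t + pi / real m) = - h2_fun (x k) t"
    "\<And>k. field_F lam f 1 (x k) = 0" "\<And>k. x k \<noteq> 0"
    by metis
  have D': "bounded_linear D" using D has_derivative_bounded_linear by blast
  then have Dlin: "linear D" by (simp add: bounded_linear.linear)
  define n where "n k = norm (x k)" for k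
  have n: "n k > 0" for k using x(4) by (simp add: n_def)
  define u where "u k = (1 / n k) *\<^sub>R x k" for k
  have nu: "norm (u k) = 1" for k using n[of k] by (simp add: u_def n_def)
  define y where "y k = (\<lambda>t. (1 / n k) *\<^sub>R (lam\<^sup>2 *\<^sub>R f (h2_fun (x k) t) - h2_fun (x k) t))" for k
  have cont: "continuous_on UNIV (\<lambda>t. lam\<^sup>2 *\<^sub>R f (h2_fun (x k) t) - h2_fun (x k) t)" for k
    by (intro continuous_intros continuous_on_compose2[OF f]) auto
  have y: "continuous_on UNIV (y k)" "y k (t + 2 * pi) = y k t" for k t
    unfolding y_def by (intro continuous_intros cont) (simp add: h2_periodic)
  have uy: "u k = L_inv (y k)" for k
  proof -
    have "x k = L_inv (\<lambda>t. lam\<^sup>2 *\<^sub>R f (h2_fun (x k) t) - h2_fun (x k) t)"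
      using field_F_eq_0D(1)[OF f x(3)] by simp
    moreover have "L_inv (y k) = (1 / n k) *\<^sub>R L_inv (\<lambda>t. lam\<^sup>2 *\<^sub>R f (h2_fun (x k) t) - h2_fun (x k) t)"
      unfolding y_def by (rule L_inv_scaleR[OF cont]) (simp add: h2_periodic)
    ultimately show ?thesis by (simp add: u_def)
  qed
  define C :: real where "C = 2 + 2 * pi"
  have C: "C > 0" by (simp add: C_def add_pos_pos)
  have x0: "x \<longlonglongrightarrow> 0"
  proof (rule tendsto_norm_zero_cancel, rule tendsto_sandwich[OF _ _ tendsto_const LIMSEQ_inverse_real_of_nat])
    show "\<forall>\<^sub>F k in sequentially. norm (x k) \<le> inverse (real (Suc k))"
      using x(1) by (simp only: inverse_eq_divide eventually_True)
  qed simp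
  \<comment> \<open>The remainder of the first-order expansion of \<open>f\<close> at 0, divided by
    the norm of \<open>x k\<close>. It tends to 0 uniformly in time because |x_k(t)| is at most
    \<open>C\<close> times that norm.\<close>
  define rem where "rem k t = (1 / n k) *\<^sub>R (f (h2_fun (x k) t) - D (h2_fun (x k) t))" for k t
  have rem: "uniform_limit UNIV rem (\<lambda>_. 0) sequentially"
    unfolding uniform_limit_iff
  proof (intro allI impI)
    fix e :: real assume e: "e > 0"
    \<comment> \<open>The factor C absorbs the sup bound and the 2 yields a strict
      inequality.\<close>
    then have "e / (2 * C) > 0" using C by simp
    with D obtain d where d: "d > 0" "\<And>v. norm v < d \<Longrightarrow> norm (f v - D v) \<le> e / (2 * C) * norm v"
      unfolding has_derivative_within_alt by (auto simp: f0)
    have "\<forall>\<^sub>F k in sequentially. norm (x k) < d / C"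
      using tendsto_norm[OF x0] d(1) C by (intro order_tendstoD(2)[of _ 0]) auto
    then show "\<forall>\<^sub>F k in sequentially. \<forall>t\<in>UNIV. dist (rem k t) 0 < e"
    proof (rule eventually_mono)
      fix k assume k: "norm (x k) < d / C"
      show "\<forall>t\<in>UNIV. dist (rem k t) 0 < e"
      proof
        fix t
        let ?v = "h2_fun (x k) t"
        have v: "norm ?v \<le> C * n k" using h2_sup_bound(1) by (simp add: C_def n_def)
        also have "\<dots> < d" using k C by (simp add: n_def field_simps)
        finally have "norm (f ?v - D ?v) \<le> e / (2 * C) * norm ?v" by (rule d(2))
        also have "\<dots> \<le> e / (2 * C) * (C * n k)" using v e C by (intro mult_left_mono) auto
        also have "\<dots> < e * n k" using e C n[of k] by (simp add: field_simps)
        finally show "dist (rem k t) 0 < e" 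
          using n[of k] by (simp add: rem_def divide_less_eq)
      qed
    qed
  qed
  have yeq: "y k = (\<lambda>t. lam\<^sup>2 *\<^sub>R rem k t + (lam\<^sup>2 *\<^sub>R D (h2_fun (u k) t) - h2_fun (u k) t))" for k
    by (simp add: fun_eq_iff y_def rem_def u_def h2_fun_scaleR linear_scale[OF Dlin] algebra_simps)
  obtain r z where r: "strict_mono (r :: nat \<Rightarrow> nat)" "(\<lambda>k. u (r k)) \<longlonglongrightarrow> z"
    "z = L_inv (\<lambda>t. lam\<^sup>2 *\<^sub>R D (h2_fun z t) - h2_fun z t)"
  proof (rule h2_compactness[of u 1 y "\<lambda>w t. lam\<^sup>2 *\<^sub>R D (w t) - w t"])
    show "(\<lambda>k. u k - L_inv (y k)) \<longlonglongrightarrow> 0" by (simp add: uy[symmetric])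
    fix w :: "real \<Rightarrow> real^'n"
    assume w: "continuous_on UNIV w"
    show "continuous_on UNIV (\<lambda>t. lam\<^sup>2 *\<^sub>R D (w t) - w t) \<and>
        (\<forall>t. lam\<^sup>2 *\<^sub>R D (w (t + 2 * pi)) - w (t + 2 * pi) = lam\<^sup>2 *\<^sub>R D (w t) - w t)"
      if "\<And>t. w (t + 2 * pi) = w t"
      using that by (auto intro!: continuous_intros w bounded_linear.continuous_on[OF D'])
    fix r :: "nat \<Rightarrow> nat"
    assume r: "strict_mono r" and ul: "uniform_limit UNIV (\<lambda>k. h2_fun (u (r k))) w sequentially"
    have "uniform_limit UNIV (\<lambda>k. rem (r k)) (\<lambda>_. 0) sequentially"
      using filterlim_compose[OF rem filterlim_subseq[OF r]] .
    then have "uniform_limit UNIV (\<lambda>k t. lam\<^sup>2 *\<^sub>R rem (r k) t + (lam\<^sup>2 *\<^sub>R D (h2_fun (u (r k)) t) - h2_fun (u (r k)) t))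
        (\<lambda>t. lam\<^sup>2 *\<^sub>R 0 + (lam\<^sup>2 *\<^sub>R D (w t) - w t)) sequentially"
      by (intro uniform_limit_add uniform_limit_minus ul
          bounded_linear.uniform_limit[OF bounded_linear_scaleR_right]
          bounded_linear.uniform_limit[OF D'])
    then show "uniform_limit UNIV (\<lambda>k. y (r k)) (\<lambda>t. lam\<^sup>2 *\<^sub>R D (w t) - w t) sequentially"
      by (simp add: yeq)
  qed (use nu y in auto)
  have "norm z = 1" using LIMSEQ_unique[OF tendsto_norm[OF r(2)]] by (simp add: nu)
  have "h2_fun z t = 0" for t
  proof (rule complexified_ode_trivial[OF m Dlin nonres])
    show "(h2_fun z has_vector_derivative h2_d1 z t) (at t)" for t
      using h2_derivs_h2[of z] by (simp add: h2_derivs_def)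
    show "(h2_d1 z has_vector_derivative lam\<^sup>2 *\<^sub>R D (h2_fun z t)) (at t)" for t
    proof -
      have "(h2_d1 (L_inv (\<lambda>t. lam\<^sup>2 *\<^sub>R D (h2_fun z t) - h2_fun z t)) has_vector_derivative
         h2_fun (L_inv (\<lambda>t. lam\<^sup>2 *\<^sub>R D (h2_fun z t) - h2_fun z t)) t + (lam\<^sup>2 *\<^sub>R D (h2_fun z t) - h2_fun z t)) (at t)"
        by (rule L_inv_ode)
          (auto intro!: continuous_intros bounded_linear.continuous_on[OF D'] simp: h2_periodic)
      then show ?thesis by (simp flip: r(3))
    qed
    fix t
    have "h2_fun (u k) (t + pi / real m) = - h2_fun (u k) t" for k
      by (simp add: u_def h2_fun_scaleR x(2))
    then show "h2_fun z (t + pi / real m) = - h2_fun z t"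
      using LIMSEQ_unique[OF tendsto_h2_fun[OF r(2)] ] tendsto_minus[OF tendsto_h2_fun[OF r(2), of t]]
      by simp
  qed auto
  then have "z = 0" by (simp add: h2_fun_inject[symmetric] h2_fun_zero fun_eq_iff)
  with \<open>norm z = 1\<close> show False by simp
qed

section \<open>Degrees and conjugacy classes\<close>

lemma eventual_value_attained:
  assumes nz: "eventual_value A v \<noteq> 0"
    and mono: "\<And>\<delta> \<delta>'. \<delta> \<le> \<delta>' \<Longrightarrow> A \<delta> \<subseteq> A \<delta>'" and \<delta>: "\<delta> > 0"
  shows "\<exists>g\<in>A \<delta>. v g = eventual_value A v"
proof -
  let ?P = "\<lambda>d. \<exists>\<delta>>0. \<forall>g\<in>A \<delta>. v g = d"
  have ex1: "\<exists>!d. ?P d" using nz unfolding eventual_value_def by (auto split: if_splits)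
  then have val: "eventual_value A v = (THE d. ?P d)" unfolding eventual_value_def by (rule if_P)
  have "?P (eventual_value A v)" unfolding val by (rule theI'[OF ex1])
  then obtain \<delta>0 where \<delta>0: "\<delta>0 > 0" "\<And>g. g \<in> A \<delta>0 \<Longrightarrow> v g = eventual_value A v" by blast
  let ?\<mu> = "min \<delta> \<delta>0"
  have "A ?\<mu> \<noteq> {}"
  proof
    assume "A ?\<mu> = {}"
    \<comment> \<open>This contradicts uniqueness, since 0 and the nonzero eventual value would both
      qualify.\<close>
    then have "\<forall>d. ?P d" using \<delta> \<delta>0(1) by (intro allI exI[of _ ?\<mu>]) auto
    with ex1 nz show False by metis
  qed
  then obtain g where "g \<in> A ?\<mu>" by blast
  then have "g \<in> A \<delta>" "g \<in> A \<delta>0" using mono[of ?\<mu> \<delta>] mono[of ?\<mu> \<delta>0] by auto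
  with \<delta>0(2) show ?thesis by blast
qed

text \<open>Some \<open>\<delta>\<close>-close regular approximation has a nonzero signed count of
  zeros, so it has a zero, and there \<open>h\<close> is smaller than
  \<open>\<delta>\<close>.\<close>

lemma brouwer_deg_near_zero:
  assumes "brouwer_deg W h U \<noteq> 0" and "\<delta> > 0"
  obtains x where "x \<in> U" "norm (h x) < \<delta>"
proof -
  let ?v = "\<lambda>g. \<Sum>x | x \<in> U \<and> g x = 0.
        if det_on W (frechet_derivative g (at x within U)) > 0 then 1 else - 1 :: int"
  have "\<exists>g\<in>regular_approx W h U \<delta>. ?v g = brouwer_deg W h U"
    unfolding brouwer_deg_def
  proof (rule eventual_value_attained)
    show "regular_approx W h U \<delta> \<subseteq> regular_approx W h U \<delta>'" if "\<delta> \<le> \<delta>'" for \<delta> \<delta>'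
      using that unfolding regular_approx_def by fastforce
  qed (use assms in \<open>simp_all add: brouwer_deg_def\<close>)
  then obtain g where g: "g \<in> regular_approx W h U \<delta>" "?v g = brouwer_deg W h U" by blast
  have "{x. x \<in> U \<and> g x = 0} \<noteq> {}"
  proof
    assume "{x. x \<in> U \<and> g x = 0} = {}"
    then have "?v g = 0" by (simp only: sum.empty)
    with g(2) assms(1) show False by simp
  qed
  then obtain x where x: "x \<in> U" "g x = 0" by blast
  moreover have "norm (g x - h x) < \<delta>"
    using g(1) x(1) closure_subset unfolding regular_approx_def by blast
  ultimately show thesis by (intro that) auto
qed

text \<open>The order properties are hypotheses because antisymmetry depends on the topology of the
  group. The class \<open>d\<close> precedes \<open>\<delta>\<close> in the conclusion: one symmetry
  has to serve all precisions, or the limit would not inherit it.\<close>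

lemma Gdeg_near_zeros:
  assumes c: "c \<in> Poly_Mapping.keys (Gdeg G T act E F U)"
    and trans: "transp_on (Phi0 G T) class_le" and antisym: "antisymp_on (Phi0 G T) class_le"
    and refl: "reflp_on (Phi0 G T) class_le"
  shows "c \<in> Phi0 G T"
    and "\<exists>d\<in>Phi0 G T. class_le c d \<and>
      (\<forall>\<delta>>0. \<exists>x\<in>fixed_points act (class_rep d) U. norm (F x) < \<delta>)"
proof -
  define n where "n = Gdeg G T act E F U"
  have n0: "n \<noteq> 0" using c by (auto simp: n_def)
  \<comment> \<open>Every precision is met by an approximation with the same \<open>n\<close>, so
    \<open>d\<close> can be chosen from \<open>n\<close> alone.\<close>
  have approx: "\<exists>(W, h)\<in>fin_dim_approx G act E F U \<delta>. is_Gdeg_fin G T act W h (U \<inter> W) n"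
    if \<delta>: "\<delta> > 0" for \<delta>
  proof -
    have "\<exists>g\<in>fin_dim_approx G act E F U \<delta>. (\<lambda>(W, h). Gdeg_fin G T act W h (U \<inter> W)) g = n"
      unfolding n_def Gdeg_def
    proof (rule eventual_value_attained[OF _ _ \<delta>])
      show "fin_dim_approx G act E F U \<delta> \<subseteq> fin_dim_approx G act E F U \<delta>'" if "\<delta> \<le> \<delta>'" for \<delta> \<delta>'
        using that unfolding fin_dim_approx_def by fastforce
    qed (use n0 in \<open>simp add: n_def Gdeg_def\<close>)
    then obtain W h where Wh: "(W, h) \<in> fin_dim_approx G act E F U \<delta>"
      "Gdeg_fin G T act W h (U \<inter> W) = n" by auto
    \<comment> \<open>As \<open>n\<close> is nonzero, it is not the default value 0 and therefore
      solves the recurrence.\<close>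
    have "\<exists>!n. is_Gdeg_fin G T act W h (U \<inter> W) n"
      using n0 Wh(2) unfolding Gdeg_fin_def by (auto split: if_splits)
    from theI'[OF this] have "is_Gdeg_fin G T act W h (U \<inter> W) n"
      using Wh(2) n0 unfolding Gdeg_fin_def by (auto split: if_splits)
    with Wh(1) show ?thesis by blast
  qed
  from approx[of 1] have keys: "Poly_Mapping.keys n \<subseteq> Phi0 G T"
    unfolding is_Gdeg_fin_def by auto
  with c show cP: "c \<in> Phi0 G T" by (auto simp: n_def)
  let ?A = "{d \<in> Poly_Mapping.keys n. class_le c d}"
  let ?R = "\<lambda>d e. class_le d e \<and> d \<noteq> e"
  have A: "?A \<subseteq> Phi0 G T" using keys by blast
  have "\<exists>d\<in>?A. \<forall>e\<in>?A. e \<noteq> d \<longrightarrow> \<not> ?R d e"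
  proof (rule Finite_Set.bex_max_element)
    show "asymp_on ?A ?R"
      using antisym A unfolding asymp_on_def antisymp_on_def by blast
    show "transp_on ?A ?R"
      using trans antisym A unfolding transp_on_def antisymp_on_def by blast
    show "?A \<noteq> {}" using c cP refl by (auto simp: n_def reflp_on_def)
  qed simp
  then obtain d where d: "d \<in> Poly_Mapping.keys n" "class_le c d"
    and max: "\<And>e. e \<in> Poly_Mapping.keys n \<Longrightarrow> class_le c e \<Longrightarrow> class_le d e \<Longrightarrow> e = d" by blast
  have dP: "d \<in> Phi0 G T" using d(1) keys by blast
  \<comment> \<open>By transitivity a key above \<open>d\<close> is also above \<open>c\<close>,
    hence competes with \<open>d\<close> in \<open>?A\<close>.\<close>
  have no_above: "{e. e \<in> Poly_Mapping.keys n \<and> class_le d e \<and> e \<noteq> d} = {}"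
    using max d(2) trans cP dP keys unfolding transp_on_def by blast
  have "\<exists>x\<in>fixed_points act (class_rep d) U. norm (F x) < \<delta>" if \<delta>: "\<delta> > 0" for \<delta>
  proof -
    obtain W h where Wh: "(W, h) \<in> fin_dim_approx G act E F U (\<delta> / 2)"
      "is_Gdeg_fin G T act W h (U \<inter> W) n" using approx[of "\<delta> / 2"] \<delta> by auto
    let ?K = "class_rep d"
    have "real_of_int (Poly_Mapping.lookup n d) =
        of_int (brouwer_deg (fixed_points act ?K W) h (fixed_points act ?K (U \<inter> W)))
          / real (Coset.order (weyl_group G ?K))"
      using Wh(2) dP unfolding is_Gdeg_fin_def Let_def no_above[simplified] by (simp add: no_above)
    moreover have "Poly_Mapping.lookup n d \<noteq> 0" using d(1) by (simp add: in_keys_iff)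
    ultimately have "brouwer_deg (fixed_points act ?K W) h (fixed_points act ?K (U \<inter> W)) \<noteq> 0" by auto
    then obtain x where x: "x \<in> fixed_points act ?K (U \<inter> W)" "norm (h x) < \<delta> / 2"
      using brouwer_deg_near_zero \<delta> by (metis half_gt_zero)
    then have "x \<in> closure U" using closure_subset by (auto simp: fixed_points_def)
    then have "norm (h x - F x) < \<delta> / 2" using Wh(1) by (auto simp: fin_dim_approx_def)
    moreover have "norm (F x) \<le> norm (h x) + norm (h x - F x)"
      using norm_triangle_ineq4[of "h x" "h x - F x"] by simp
    ultimately have "norm (F x) < \<delta>" using x(2) by linarith
    with x(1) show ?thesis by (auto simp: fixed_points_def)
  qed
  with dP d(2) show "\<exists>d\<in>Phi0 G T. class_le c d \<and>
      (\<forall>\<delta>>0. \<exists>x\<in>fixed_points act (class_rep d) U. norm (F x) < \<delta>)" by blast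
qed

section \<open>Subconjugacy as a partial order on conjugacy classes of subgroups\<close>

context group
begin

lemma conj_set_eq: "g <# L #> inv g = (\<lambda>l. g \<otimes> l \<otimes> inv g) ` L"
  by (auto simp: l_coset_def r_coset_def)

lemma conj_classI: "g \<in> carrier G \<Longrightarrow> g <# L #> inv g \<in> conj_class G L"
  by (auto simp: conj_class_def)

lemma conj_class_self: "L \<subseteq> carrier G \<Longrightarrow> L \<in> conj_class G L"
proof -
  assume "L \<subseteq> carrier G"
  then have "(\<lambda>l. \<one> \<otimes> l \<otimes> inv \<one>) ` L = (\<lambda>l. l) ` L" by (intro image_cong) auto
  then have "\<one> <# L #> inv \<one> = L" unfolding conj_set_eq image_ident .
  then show ?thesis using conj_classI[of \<one> L] by simp
qed

lemma conj_conj: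
  assumes "h \<in> carrier G" "g \<in> carrier G" "l \<in> carrier G"
  shows "h \<otimes> (g \<otimes> l \<otimes> inv g) \<otimes> inv h = (h \<otimes> g) \<otimes> l \<otimes> inv (h \<otimes> g)"
  using assms by (simp add: inv_mult_group m_assoc)

lemma conj_cancel:
  assumes "g \<in> carrier G" "x \<in> carrier G"
  shows "g \<otimes> (inv g \<otimes> x \<otimes> g) \<otimes> inv g = x" "inv g \<otimes> (g \<otimes> x \<otimes> inv g) \<otimes> g = x"
proof -
  have "g \<otimes> (inv g \<otimes> x \<otimes> inv (inv g)) \<otimes> inv g = x"
    using assms by (subst conj_conj) simp_all
  then show "g \<otimes> (inv g \<otimes> x \<otimes> g) \<otimes> inv g = x" using assms by simp
  have "inv g \<otimes> (g \<otimes> x \<otimes> inv g) \<otimes> inv (inv g) = x"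
    using assms by (subst conj_conj) simp_all
  then show "inv g \<otimes> (g \<otimes> x \<otimes> inv g) \<otimes> g = x" using assms by simp
qed

text \<open>An inclusion between arbitrary members of the classes can be conjugated back so that the
  larger subgroup is \<open>K\<close> itself; this turns the order into a condition on elements,
  with one conjugator.\<close>

lemma class_le_conj_class_iff:
  assumes L: "L \<subseteq> carrier G" and K: "K \<subseteq> carrier G"
  shows "class_le (conj_class G L) (conj_class G K) \<longleftrightarrow>
    (\<exists>g\<in>carrier G. \<forall>l\<in>L. g \<otimes> l \<otimes> inv g \<in> K)" (is "?A \<longleftrightarrow> ?B")
proof
  assume ?A
  then obtain a b where a: "a \<in> carrier G" and b: "b \<in> carrier G"
    and sub: "(\<lambda>l. a \<otimes> l \<otimes> inv a) ` L \<subseteq> (\<lambda>l. b \<otimes> l \<otimes> inv b) ` K"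
    by (auto simp: class_le_def conj_class_def conj_set_eq)
  have "(inv b \<otimes> a) \<otimes> l \<otimes> inv (inv b \<otimes> a) \<in> K" if l: "l \<in> L" for l
  proof -
    from sub l obtain k where k: "k \<in> K" "a \<otimes> l \<otimes> inv a = b \<otimes> k \<otimes> inv b" by blast
    have lk: "l \<in> carrier G" "k \<in> carrier G" using L K l k by auto
    have "(inv b \<otimes> a) \<otimes> l \<otimes> inv (inv b \<otimes> a) = inv b \<otimes> (a \<otimes> l \<otimes> inv a) \<otimes> b"
      using a b lk by (simp add: inv_mult_group m_assoc)
    also have "\<dots> = k" unfolding k(2) using b lk by (simp only: conj_cancel)
    finally show ?thesis using k(1) by simp
  qed
  with a b show ?B by (intro bexI[of _ "inv b \<otimes> a"]) auto
next
  assume ?B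
  then obtain g where g: "g \<in> carrier G" "\<And>l. l \<in> L \<Longrightarrow> g \<otimes> l \<otimes> inv g \<in> K" by blast
  have "K \<in> conj_class G K" by (rule conj_class_self[OF K])
  moreover have "g <# L #> inv g \<in> conj_class G L" using g by (intro conj_classI)
  moreover have "g <# L #> inv g \<subseteq> K" using g(2) by (auto simp: conj_set_eq)
  ultimately show ?A unfolding class_le_def by blast
qed

lemma conj_class_conj:
  assumes a: "a \<in> carrier G" and L: "L \<subseteq> carrier G"
  shows "conj_class G (a <# L #> inv a) = conj_class G L"
proof -
  have 1: "g <# (a <# L #> inv a) #> inv g = (g \<otimes> a) <# L #> inv (g \<otimes> a)" if "g \<in> carrier G" for g
    unfolding conj_set_eq image_image
    using L that a by (intro image_cong) (auto simp: inv_mult_group m_assoc)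
  have "g <# L #> inv g = (g \<otimes> inv a) <# (a <# L #> inv a) #> inv (g \<otimes> inv a)" if "g \<in> carrier G" for g
    using 1[of "g \<otimes> inv a"] that a by (simp add: m_assoc)
  note 2 = this
  show ?thesis
  proof (intro equalityI subsetI)
    fix X assume "X \<in> conj_class G (a <# L #> inv a)"
    then obtain g where "g \<in> carrier G" "X = g <# (a <# L #> inv a) #> inv g"
      by (auto simp: conj_class_def)
    then show "X \<in> conj_class G L" using conj_classI[of "g \<otimes> a" L] 1 a by simp
  next
    fix X assume "X \<in> conj_class G L"
    then obtain g where g: "g \<in> carrier G" "X = g <# L #> inv g" by (auto simp: conj_class_def)
    show "X \<in> conj_class G (a <# L #> inv a)"
      unfolding g(2) 2[OF g(1)] using g(1) a by (intro conj_classI) simp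
  qed
qed

lemma conj_class_eqI:
  assumes L: "L \<subseteq> carrier G" and K: "K \<subseteq> carrier G" and g: "g \<in> carrier G"
    and 1: "\<And>l. l \<in> L \<Longrightarrow> g \<otimes> l \<otimes> inv g \<in> K" and 2: "\<And>k. k \<in> K \<Longrightarrow> inv g \<otimes> k \<otimes> g \<in> L"
  shows "conj_class G L = conj_class G K"
proof -
  have "g <# L #> inv g = K"
  proof (unfold conj_set_eq, intro equalityI subsetI)
    fix k assume k: "k \<in> K"
    then have "k = g \<otimes> (inv g \<otimes> k \<otimes> g) \<otimes> inv g"
      using K g conj_cancel(1)[of g k] by auto
    with 2[OF k] show "k \<in> (\<lambda>l. g \<otimes> l \<otimes> inv g) ` L" by blast
  qed (use 1 in auto)
  with conj_class_conj[OF g L] show ?thesis by simp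
qed

lemma transp_on_class_le: "transp_on (Phi0 G T) class_le"
proof (rule transp_onI)
  fix c d e
  assume "c \<in> Phi0 G T" "d \<in> Phi0 G T" "e \<in> Phi0 G T" and le: "class_le c d" "class_le d e"
  then obtain L K J where LKJ: "subgroup L G" "subgroup K G" "subgroup J G"
    and c: "c = conj_class G L" "d = conj_class G K" "e = conj_class G J"
    by (auto simp: Phi0_def Phi0_subgroups_def)
  note sub = LKJ[THEN subgroup.subset]
  from le obtain g h where g: "g \<in> carrier G" "\<And>l. l \<in> L \<Longrightarrow> g \<otimes> l \<otimes> inv g \<in> K"
    and h: "h \<in> carrier G" "\<And>l. l \<in> K \<Longrightarrow> h \<otimes> l \<otimes> inv h \<in> J"
    unfolding c by (auto simp: class_le_conj_class_iff sub)
  have "(h \<otimes> g) \<otimes> l \<otimes> inv (h \<otimes> g) \<in> J" if "l \<in> L" for l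
    using h(2)[OF g(2)[OF that]] that sub(1) g(1) h(1) conj_conj[of h g l] by auto
  with g h show "class_le c e"
    unfolding c class_le_conj_class_iff[OF sub(1,3)] by (intro bexI[of _ "h \<otimes> g"]) auto
qed

lemma reflp_on_class_le: "reflp_on (Phi0 G T) class_le"
proof (rule reflp_onI)
  fix c assume "c \<in> Phi0 G T"
  then obtain L where L: "subgroup L G" "c = conj_class G L"
    by (auto simp: Phi0_def Phi0_subgroups_def)
  then have "L \<in> c" using conj_class_self[OF subgroup.subset] by blast
  then show "class_le c c" by (auto simp: class_le_def)
qed

text \<open>If g conjugates L into K and h conjugates K into L, then h g conjugates L into itself.
  If that is onto, g conjugates L onto K. The hypothesis is this passage from into to onto, supplied
  for the compact group by \<open>GG_closed_subgroup_conj\<close>.\<close>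

lemma antisymp_on_class_le:
  assumes conj_closed: "\<And>L g l. subgroup L G \<Longrightarrow> closedin T L \<Longrightarrow> g \<in> carrier G \<Longrightarrow>
    (\<And>l. l \<in> L \<Longrightarrow> g \<otimes> l \<otimes> inv g \<in> L) \<Longrightarrow> l \<in> L \<Longrightarrow> inv g \<otimes> l \<otimes> g \<in> L"
  shows "antisymp_on (Phi0 G T) class_le"
proof (rule antisymp_onI)
  fix c d
  assume "c \<in> Phi0 G T" "d \<in> Phi0 G T" and le: "class_le c d" "class_le d c"
  then obtain L K where LK: "subgroup L G" "subgroup K G" and cl: "closedin T L"
    and c: "c = conj_class G L" "d = conj_class G K"
    by (auto simp: Phi0_def Phi0_subgroups_def)
  note sub = LK[THEN subgroup.subset]
  from le obtain g h where g: "g \<in> carrier G" "\<And>l. l \<in> L \<Longrightarrow> g \<otimes> l \<otimes> inv g \<in> K"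
    and h: "h \<in> carrier G" "\<And>l. l \<in> K \<Longrightarrow> h \<otimes> l \<otimes> inv h \<in> L"
    unfolding c by (auto simp: class_le_conj_class_iff sub)
  have "(h \<otimes> g) \<otimes> l \<otimes> inv (h \<otimes> g) \<in> L" if "l \<in> L" for l
    using h(2)[OF g(2)[OF that]] that sub(1) g(1) h(1) conj_conj[of h g l] by auto
  note * = conj_closed[OF LK(1) cl _ this]
  have "inv g \<otimes> k \<otimes> g \<in> L" if k: "k \<in> K" for k
  proof -
    have kc: "k \<in> carrier G" using k sub by auto
    have "inv (h \<otimes> g) \<otimes> (h \<otimes> k \<otimes> inv h) \<otimes> (h \<otimes> g) \<in> L"
      using *[of "h \<otimes> k \<otimes> inv h"] h(2)[OF k] g h by simp
    also have "inv (h \<otimes> g) \<otimes> (h \<otimes> k \<otimes> inv h) \<otimes> (h \<otimes> g) =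
        inv g \<otimes> (inv h \<otimes> (h \<otimes> k \<otimes> inv h) \<otimes> h) \<otimes> g"
      using conj_conj[of "inv g" "inv h" "h \<otimes> k \<otimes> inv h"] g(1) h(1) kc
      by (simp add: inv_mult_group)
    also have "\<dots> = inv g \<otimes> k \<otimes> g" using h(1) kc by (simp only: conj_cancel)
    finally show ?thesis .
  qed
  with g show "c = d" unfolding c by (intro conj_class_eqI[OF sub]) auto
qed

lemma conj_class_class_rep:
  assumes "c \<in> Phi0 G T"
  shows "class_rep c \<subseteq> carrier G" "conj_class G (class_rep c) = c"
proof -
  obtain L where L: "subgroup L G" "c = conj_class G L"
    using assms by (auto simp: Phi0_def Phi0_subgroups_def)
  note sub = subgroup.subset[OF L(1)]
  have "class_rep c \<in> c"
    unfolding class_rep_def L(2) by (rule someI[where P = "\<lambda>K. K \<in> conj_class G L"])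
      (rule conj_class_self[OF sub])
  then obtain g where g: "g \<in> carrier G" "class_rep c = g <# L #> inv g"
    by (auto simp: L(2) conj_class_def)
  with conj_class_conj[OF g(1) sub] show "conj_class G (class_rep c) = c" by (simp add: L(2))
  show "class_rep c \<subseteq> carrier G" using g sub by (auto simp: conj_set_eq)
qed

end

section \<open>Closed subgroups of the compact group \<open>GG \<Gamma>\<close>\<close>

lemma group_Z2: "group Z2"
  by (rule groupI) (auto simp: Z2_def)

lemma group_O2: "group O2"
proof (rule groupI)
  fix A assume "A \<in> carrier O2"
  then have "transpose A \<in> carrier O2" "transpose A \<otimes>\<^bsub>O2\<^esub> A = \<one>\<^bsub>O2\<^esub>"
    by (auto simp: O2_def orthogonal_matrix_def)
  then show "\<exists>B\<in>carrier O2. B \<otimes>\<^bsub>O2\<^esub> A = \<one>\<^bsub>O2\<^esub>" by blast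
qed (auto simp: O2_def orthogonal_matrix_mul orthogonal_matrix_id matrix_mul_assoc)

lemma group_GG: "group \<Gamma> \<Longrightarrow> group (GG \<Gamma>)"
  unfolding GG_def by (intro DirProd_group group_Z2 group_O2)

lemma rot_0: "rot 0 = mat 1"
  by (simp add: rot_def vec2_eq_iff mat_def)

lemma rot_in_O2: "rot \<tau> \<in> carrier O2"
proof -
  have "transpose (rot \<tau>) = rot (- \<tau>)" by (simp add: rot_def vec2_eq_iff transpose_def)
  then show ?thesis by (simp add: O2_def orthogonal_matrix_def rot_mult rot_0)
qed

lemma continuous_on_matrix_mult:
  fixes A B :: "real \<Rightarrow> real^2^2"
  assumes "continuous_on S A" "continuous_on S B"
  shows "continuous_on S (\<lambda>t. A t ** B t)"
  unfolding matrix_matrix_mult_def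
  by (intro continuous_on_vec_lambda continuous_on_sum continuous_on_mult continuous_on_component assms)

lemma continuous_on_rot: "continuous_on S (\<lambda>t. rot (c * t))"
proof -
  have "(\<lambda>t. rot (c * t)) = (\<lambda>t. cos (c * t) *\<^sub>R mat 1 + sin (c * t) *\<^sub>R rot (pi / 2))"
    by (simp add: rot_def vec2_eq_iff mat_def fun_eq_iff)
  then show ?thesis by (rule ssubst) (intro continuous_intros)
qed

text \<open>A closed subgroup mapped into itself by the conjugation with \<open>g\<close> is mapped onto itself, since
  suitable positive powers of \<open>g\<close> converge to the identity.\<close>

lemma GG_closed_subgroup_conj:
  assumes \<Gamma>: "group \<Gamma>" "finite (carrier \<Gamma>)"
    and L: "subgroup L (GG \<Gamma>)" "closedin (GG_topology \<Gamma>) L" and g: "g \<in> carrier (GG \<Gamma>)"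
    and conj: "\<And>l. l \<in> L \<Longrightarrow> g \<otimes>\<^bsub>GG \<Gamma>\<^esub> l \<otimes>\<^bsub>GG \<Gamma>\<^esub> inv\<^bsub>GG \<Gamma>\<^esub> g \<in> L" and l: "l \<in> L"
  shows "inv\<^bsub>GG \<Gamma>\<^esub> g \<otimes>\<^bsub>GG \<Gamma>\<^esub> l \<otimes>\<^bsub>GG \<Gamma>\<^esub> g \<in> L"
proof -
  interpret \<Gamma>: group \<Gamma> by fact
  interpret G: group "GG \<Gamma>" by (rule group_GG[OF \<Gamma>(1)])
  define \<rho> where "\<rho> \<tau> = (\<one>\<^bsub>\<Gamma>\<^esub>, 1 :: int, rot \<tau>)" for \<tau>
  have \<rho>: "\<rho> \<tau> \<in> carrier (GG \<Gamma>)" for \<tau> by (simp add: \<rho>_def GG_def Z2_def rot_in_O2)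
  have \<rho>_mult: "\<rho> a \<otimes>\<^bsub>GG \<Gamma>\<^esub> \<rho> b = \<rho> (a + b)" for a b
    by (simp add: \<rho>_def GG_def Z2_def O2_def rot_mult)
  have \<rho>0: "\<rho> 0 = \<one>\<^bsub>GG \<Gamma>\<^esub>" by (simp add: \<rho>_def GG_def Z2_def O2_def rot_0)
  have \<rho>_inv: "inv\<^bsub>GG \<Gamma>\<^esub> \<rho> a = \<rho> (- a)" for a
    by (rule G.inv_equality) (simp_all add: \<rho> \<rho>_mult \<rho>0)
  have \<rho>_per: "\<rho> (\<tau> + of_int k * (2 * pi)) = \<rho> \<tau>" for \<tau> k
    unfolding \<rho>_def using rot_eq_iff by blast
  have lG: "l \<in> carrier (GG \<Gamma>)" using l subgroup.subset[OF L(1)] by blast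
  obtain \<gamma> s A where g': "g = (\<gamma>, s, A)" "\<gamma> \<in> carrier \<Gamma>" "s \<in> carrier Z2" "A \<in> carrier O2"
    using g by (cases g) (auto simp: GG_def)
  obtain \<beta> where \<beta>: "A ** A = rot \<beta>"
    using g'(4)
  proof (cases rule: O2_cases)
    case (1 \<tau>)
    then show thesis by (intro that[of "\<tau> + \<tau>"]) (simp add: rot_mult)
  next
    case (2 \<tau>)
    have "A ** A = kappa ** (rot \<tau> ** kappa) ** rot \<tau>" by (simp add: 2 matrix_mul_assoc)
    also have "\<dots> = (kappa ** kappa) ** (rot (- \<tau>) ** rot \<tau>)" by (simp add: rot_kappa matrix_mul_assoc)
    finally show thesis by (intro that[of 0]) (simp add: kappa_kappa rot_mult)
  qed
  define g2 where "g2 = g \<otimes>\<^bsub>GG \<Gamma>\<^esub> g"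
  have g2: "g2 = (\<gamma> \<otimes>\<^bsub>\<Gamma>\<^esub> \<gamma>, 1, rot \<beta>)"
    using g'(3) \<beta> by (auto simp: g2_def g'(1) GG_def Z2_def O2_def)
  have g2G: "g2 \<in> carrier (GG \<Gamma>)" using g by (simp add: g2_def)
  have g2_pow: "g2 [^]\<^bsub>GG \<Gamma>\<^esub> n = ((\<gamma> \<otimes>\<^bsub>\<Gamma>\<^esub> \<gamma>) [^]\<^bsub>\<Gamma>\<^esub> n, 1, rot (real n * \<beta>))" for n :: nat
  proof (induction n)
    case 0
    show ?case by (simp add: GG_def Z2_def O2_def rot_0)
  next
    case (Suc n)
    then show ?case by (simp add: g2 GG_def Z2_def O2_def rot_mult algebra_simps)
  qed
  \<comment> \<open>The power 2 q trivialises the components in \<Gamma> and in \<open>Z2\<close>,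
    so \<open>g\<close> raised to 2 q is the pure rotation \<open>\<rho> \<alpha>\<close>.\<close>
  define q where "q = Coset.order \<Gamma>"
  have q: "q > 0" using \<Gamma> by (simp add: q_def \<Gamma>.order_gt_0_iff_finite)
  define \<alpha> where "\<alpha> = real q * \<beta>"
  have "g2 [^]\<^bsub>GG \<Gamma>\<^esub> q = \<rho> \<alpha>"
    using g'(2) by (simp add: g2_pow q_def \<alpha>_def \<rho>_def \<Gamma>.pow_order_eq_1)
  moreover have "g2 [^]\<^bsub>GG \<Gamma>\<^esub> q = g [^]\<^bsub>GG \<Gamma>\<^esub> (2 * q)"
  proof -
    have "g2 = g [^]\<^bsub>GG \<Gamma>\<^esub> (2::nat)" using g by (simp add: g2_def numeral_2_eq_2)
    then show ?thesis using G.nat_pow_pow[OF g, of 2 q] by simp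
  qed
  ultimately have gq: "g [^]\<^bsub>GG \<Gamma>\<^esub> (2 * q) = \<rho> \<alpha>" by simp
  have \<rho>_pow: "\<rho> \<alpha> [^]\<^bsub>GG \<Gamma>\<^esub> j = \<rho> (real j * \<alpha>)" for j :: nat
    by (induction j) (simp_all add: \<rho>0 \<rho>_mult algebra_simps)
  have conj_pow: "g [^]\<^bsub>GG \<Gamma>\<^esub> k \<otimes>\<^bsub>GG \<Gamma>\<^esub> l \<otimes>\<^bsub>GG \<Gamma>\<^esub> inv\<^bsub>GG \<Gamma>\<^esub> (g [^]\<^bsub>GG \<Gamma>\<^esub> k) \<in> L" for k :: nat
  proof (induction k)
    case 0
    then show ?case using l lG by simp
  next
    case (Suc k)
    have "g [^]\<^bsub>GG \<Gamma>\<^esub> Suc k = g \<otimes>\<^bsub>GG \<Gamma>\<^esub> g [^]\<^bsub>GG \<Gamma>\<^esub> k" using g by (rule G.nat_pow_Suc2)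
    with conj[OF Suc] g lG show ?case by (simp add: G.inv_mult_group G.m_assoc)
  qed
  \<comment> \<open>\<open>\<Phi> 0\<close> is the element wanted in \<open>L\<close>. At \<tau> = j
    \<alpha> the rotation is the power 2 q j of \<open>g\<close>, so \<open>\<Phi> \<tau>\<close> is
    the conjugate of \<open>l\<close> by the power 2 q j - 1, known to lie in \<open>L\<close>; j >
    0 keeps this exponent a natural number.\<close>
  define \<Phi> where "\<Phi> \<tau> = inv\<^bsub>GG \<Gamma>\<^esub> g \<otimes>\<^bsub>GG \<Gamma>\<^esub> (\<rho> \<tau> \<otimes>\<^bsub>GG \<Gamma>\<^esub> l \<otimes>\<^bsub>GG \<Gamma>\<^esub> \<rho> (- \<tau>)) \<otimes>\<^bsub>GG \<Gamma>\<^esub> g" for \<tau>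
  have \<Phi>_in: "\<Phi> (real j * \<alpha> - of_int h * (2 * pi)) \<in> L" if j: "j > 0" for j :: nat and h
  proof -
    have "2 * q * j > 0" using q j by simp
    then obtain k where k: "2 * q * j = Suc k" using gr0_implies_Suc by blast
    have "\<rho> (real j * \<alpha>) = g [^]\<^bsub>GG \<Gamma>\<^esub> Suc k"
      using g by (simp only: k[symmetric] G.nat_pow_pow[symmetric] gq \<rho>_pow)
    also have "\<dots> = g \<otimes>\<^bsub>GG \<Gamma>\<^esub> g [^]\<^bsub>GG \<Gamma>\<^esub> k" using g by (rule G.nat_pow_Suc2)
    finally have e: "\<rho> (real j * \<alpha>) = g \<otimes>\<^bsub>GG \<Gamma>\<^esub> g [^]\<^bsub>GG \<Gamma>\<^esub> k" .
    let ?p = "g [^]\<^bsub>GG \<Gamma>\<^esub> k"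
    have p: "?p \<in> carrier (GG \<Gamma>)" using g by simp
    have "\<Phi> (real j * \<alpha>) = inv\<^bsub>GG \<Gamma>\<^esub> g \<otimes>\<^bsub>GG \<Gamma>\<^esub> (g \<otimes>\<^bsub>GG \<Gamma>\<^esub> ?p \<otimes>\<^bsub>GG \<Gamma>\<^esub> l \<otimes>\<^bsub>GG \<Gamma>\<^esub>
        (inv\<^bsub>GG \<Gamma>\<^esub> ?p \<otimes>\<^bsub>GG \<Gamma>\<^esub> inv\<^bsub>GG \<Gamma>\<^esub> g)) \<otimes>\<^bsub>GG \<Gamma>\<^esub> g"
      unfolding \<Phi>_def \<rho>_inv[symmetric] e using g p by (simp add: G.inv_mult_group)
    also have "\<dots> = (inv\<^bsub>GG \<Gamma>\<^esub> g \<otimes>\<^bsub>GG \<Gamma>\<^esub> g) \<otimes>\<^bsub>GG \<Gamma>\<^esub> (?p \<otimes>\<^bsub>GG \<Gamma>\<^esub> l \<otimes>\<^bsub>GG \<Gamma>\<^esub> inv\<^bsub>GG \<Gamma>\<^esub> ?p)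
        \<otimes>\<^bsub>GG \<Gamma>\<^esub> (inv\<^bsub>GG \<Gamma>\<^esub> g \<otimes>\<^bsub>GG \<Gamma>\<^esub> g)"
      using g p lG by (simp only: G.m_assoc G.m_closed G.inv_closed)
    also have "\<dots> = ?p \<otimes>\<^bsub>GG \<Gamma>\<^esub> l \<otimes>\<^bsub>GG \<Gamma>\<^esub> inv\<^bsub>GG \<Gamma>\<^esub> ?p" using g p lG by simp
    finally have "\<Phi> (real j * \<alpha>) \<in> L" using conj_pow by simp
    moreover have "\<Phi> (real j * \<alpha> - of_int h * (2 * pi)) = \<Phi> (real j * \<alpha>)"
      using \<rho>_per[of "real j * \<alpha>" "- h"] \<rho>_per[of "- (real j * \<alpha>)" h] by (simp add: \<Phi>_def algebra_simps)
    ultimately show ?thesis by simp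
  qed
  have cont: "continuous_map euclidean (GG_topology \<Gamma>) \<Phi>"
  proof -
    obtain \<gamma>' s' A' where gi: "inv\<^bsub>GG \<Gamma>\<^esub> g = (\<gamma>', s', A')" "\<gamma>' \<in> carrier \<Gamma>" "s' \<in> carrier Z2" "A' \<in> carrier O2"
      using G.inv_closed[OF g] by (cases "inv\<^bsub>GG \<Gamma>\<^esub> g") (auto simp: GG_def)
    obtain \<delta> r B where l': "l = (\<delta>, r, B)" "\<delta> \<in> carrier \<Gamma>" "r \<in> carrier Z2" "B \<in> carrier O2"
      using lG by (cases l) (auto simp: GG_def)
    interpret Z2: group Z2 by (rule group_Z2)
    interpret O2: group O2 by (rule group_O2)
    have "\<Phi> = (\<lambda>\<tau>. (\<gamma>' \<otimes>\<^bsub>\<Gamma>\<^esub> \<delta> \<otimes>\<^bsub>\<Gamma>\<^esub> \<gamma>, s' \<otimes>\<^bsub>Z2\<^esub> r \<otimes>\<^bsub>Z2\<^esub> s,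
        A' \<otimes>\<^bsub>O2\<^esub> (rot (1 * \<tau>) \<otimes>\<^bsub>O2\<^esub> B \<otimes>\<^bsub>O2\<^esub> rot ((- 1) * \<tau>)) \<otimes>\<^bsub>O2\<^esub> A))"
      unfolding \<Phi>_def gi(1) unfolding l' g'(1) \<rho>_def GG_def
      using l' by (simp add: fun_eq_iff Z2_def)
    moreover have "continuous_map euclidean (GG_topology \<Gamma>) \<dots>"
      unfolding GG_topology_def
    proof (intro continuous_map_pairedI)
      show "continuous_map euclidean (discrete_topology (carrier \<Gamma>)) (\<lambda>\<tau>::real. \<gamma>' \<otimes>\<^bsub>\<Gamma>\<^esub> \<delta> \<otimes>\<^bsub>\<Gamma>\<^esub> \<gamma>)"
        using gi l' g' by simp
      show "continuous_map euclidean (discrete_topology (carrier Z2)) (\<lambda>\<tau>::real. s' \<otimes>\<^bsub>Z2\<^esub> r \<otimes>\<^bsub>Z2\<^esub> s)"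
        using gi l' g' by simp
      have "continuous_on UNIV (\<lambda>\<tau>. A' ** (rot (1 * \<tau>) ** B ** rot ((- 1) * \<tau>)) ** A)"
        by (intro continuous_on_matrix_mult continuous_on_rot continuous_on_const)
      then show "continuous_map euclidean (top_of_set (carrier O2))
         (\<lambda>\<tau>. A' \<otimes>\<^bsub>O2\<^esub> (rot (1 * \<tau>) \<otimes>\<^bsub>O2\<^esub> B \<otimes>\<^bsub>O2\<^esub> rot ((- 1) * \<tau>)) \<otimes>\<^bsub>O2\<^esub> A)"
        using gi l' g' rot_in_O2 by (auto simp: continuous_map_in_subtopology) (simp add: O2_def)
    qed
    ultimately show ?thesis by simp
  qed
  have "closed {\<tau>. \<Phi> \<tau> \<in> L}"
    using closedin_continuous_map_preimage[OF cont L(2)] by simp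
  \<comment> \<open>Positive multiples of \<alpha> come arbitrarily close to multiples of 2 pi, at
    distance below 2 pi / N by Dirichlet; thus 0 is a limit of parameters with \<open>\<Phi>\<close>
    in the closed set \<open>L\<close>.\<close>
  moreover have "\<exists>\<tau>\<in>{\<tau>. \<Phi> \<tau> \<in> L}. dist \<tau> 0 < e" if e: "e > 0" for e
  proof -
    obtain N :: nat where N: "2 * pi / e < real N" using reals_Archimedean2 by blast
    moreover have "0 < 2 * pi / e" using e by simp
    ultimately have N0: "N > 0" by (metis less_trans of_nat_0_less_iff)
    obtain h k where k: "0 < k" "\<bar>of_int k * (\<alpha> / (2 * pi)) - of_int h\<bar> < 1 / N"
      using Dirichlet_approx[OF N0] by metis
    have "of_int k * \<alpha> - of_int h * (2 * pi) = (of_int k * (\<alpha> / (2 * pi)) - of_int h) * (2 * pi)"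
      by (simp add: field_simps)
    then have "\<bar>of_int k * \<alpha> - of_int h * (2 * pi)\<bar> = \<bar>of_int k * (\<alpha> / (2 * pi)) - of_int h\<bar> * (2 * pi)"
      by (simp add: abs_mult)
    also have "\<dots> < 1 / N * (2 * pi)" using k(2) by (intro mult_strict_right_mono) auto
    also have "\<dots> < e" using N e N0 by (simp add: field_simps)
    finally have "dist (real (nat k) * \<alpha> - of_int h * (2 * pi)) 0 < e" using k(1) by (simp add: dist_real_def)
    moreover have "\<Phi> (real (nat k) * \<alpha> - of_int h * (2 * pi)) \<in> L" using k(1) by (intro \<Phi>_in) simp
    ultimately show ?thesis by blast
  qed
  then have "0 \<in> closure {\<tau>. \<Phi> \<tau> \<in> L}" by (auto simp: closure_approachable)
  ultimately have "\<Phi> 0 \<in> L" by (simp add: closure_closed)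
  then show ?thesis using lG g by (simp add: \<Phi>_def \<rho>0)
qed

section \<open>Symmetric solutions\<close>

lemma perm_act_one:
  assumes "group_action \<Gamma> UNIV \<phi>"
  shows "perm_act \<Gamma> \<phi> \<one>\<^bsub>\<Gamma>\<^esub> u = u"
proof -
  interpret group_action \<Gamma> UNIV \<phi> by fact
  interpret \<Gamma>: group \<Gamma> using group_hom group_hom.axioms(1) by blast
  show ?thesis by (simp add: perm_act_def vec_eq_iff flip: id_eq_one)
qed

lemma h2_act_one:
  assumes "group_action \<Gamma> UNIV \<phi>"
  shows "h2_act \<Gamma> \<phi> \<one>\<^bsub>GG \<Gamma>\<^esub> x = x"
proof -
  have "\<one>\<^bsub>GG \<Gamma>\<^esub> = (\<one>\<^bsub>\<Gamma>\<^esub>, 1, rot 0)" by (simp add: GG_def Z2_def O2_def rot_0)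
  then show ?thesis
    using assms by (simp add: h2_fun_inject[symmetric] fun_eq_iff h2_act_rot perm_act_one)
qed

lemma h2_act_inv:
  assumes \<phi>: "group_action \<Gamma> UNIV \<phi>" and g: "g \<in> carrier (GG \<Gamma>)"
  shows "h2_act \<Gamma> \<phi> (inv\<^bsub>GG \<Gamma>\<^esub> g) (h2_act \<Gamma> \<phi> g x) = x"
proof -
  interpret group_action \<Gamma> UNIV \<phi> by fact
  interpret G: group "GG \<Gamma>" using group_hom group_hom.axioms(1) group_GG by blast
  show ?thesis
    using h2_act_mult[OF \<phi> G.inv_closed[OF g] g, of x] g by (simp add: h2_act_one[OF \<phi>])
qed

lemma h2_fun_act_constant_on:
  assumes "h2_fun x constant_on UNIV"
  shows "h2_fun (h2_act \<Gamma> \<phi> g x) constant_on UNIV"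
  using assms by (cases g) (auto simp: h2_fun_act constant_on_def)

lemma closed_fixed_points_h2_act:
  fixes z :: "(real^'n::finite) h2"
  assumes x: "x \<longlonglongrightarrow> z" and fixd: "\<And>k::nat. h2_act \<Gamma> \<phi> g (x k) = x k"
  shows "h2_act \<Gamma> \<phi> g z = z"
proof -
  obtain \<gamma> s A where g: "g = (\<gamma>, s, A)" by (cases g)
  have "h2_fun (h2_act \<Gamma> \<phi> g z) t = h2_fun z t" for t
  proof (rule LIMSEQ_unique)
    have bl: "bounded_linear (\<lambda>u. of_int s *\<^sub>R perm_act \<Gamma> \<phi> \<gamma> u :: real^'n)"
      using bounded_linear_compose[OF bounded_linear_scaleR_right bounded_linear_perm_act] .
    have "(\<lambda>k. h2_fun (h2_act \<Gamma> \<phi> g (x k)) t) \<longlonglongrightarrow> h2_fun (h2_act \<Gamma> \<phi> g z) t"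
      unfolding g h2_fun_act by (rule bounded_linear.tendsto[OF bl tendsto_h2_fun[OF x]])
    then show "(\<lambda>k. h2_fun (x k) t) \<longlonglongrightarrow> h2_fun (h2_act \<Gamma> \<phi> g z) t" by (simp add: fixd)
    show "(\<lambda>k. h2_fun (x k) t) \<longlonglongrightarrow> h2_fun z t" by (rule tendsto_h2_fun[OF x])
  qed
  then show ?thesis by (simp add: h2_fun_inject[symmetric] fun_eq_iff)
qed

lemma h2_fix_antiperiodic:
  assumes \<phi>: "group_action \<Gamma> UNIV \<phi>" and x: "x \<in> h2_fix \<Gamma> \<phi> m"
  shows "h2_fun x (t + pi / real m) = - h2_fun x t"
proof -
  have "(\<one>\<^bsub>\<Gamma>\<^esub>, - 1, rot (pi / real m)) \<in> Z2md \<Gamma> m"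
    unfolding Z2md_def by (rule generate.incl) simp
  with x have "h2_act \<Gamma> \<phi> (\<one>\<^bsub>\<Gamma>\<^esub>, - 1, rot (pi / real m)) x = x"
    by (auto simp: h2_fix_def fixed_points_def)
  then have "h2_fun x t = - h2_fun x (t + pi / real m)"
    by (metis h2_act_rot(1) perm_act_one[OF \<phi>] of_int_minus of_int_1 scaleR_minus1_left)
  then show ?thesis by simp
qed

lemma perm_act_scaleR: "perm_act \<Gamma> \<phi> \<gamma> (c *\<^sub>R u) = c *\<^sub>R perm_act \<Gamma> \<phi> \<gamma> u"
  by (simp add: perm_act_def vec_eq_iff)

lemma periodic_solution_h2_iff:
  "periodic_solution lam f (h2_fun x) \<longleftrightarrow>
    (\<forall>t. (h2_d1 x has_vector_derivative lam\<^sup>2 *\<^sub>R f (h2_fun x t)) (at t))"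
proof -
  have d: "(h2_fun x has_vector_derivative h2_d1 x t) (at t)" for t
    using h2_derivs_h2[of x] by (simp add: h2_derivs_def)
  have "v = h2_d1 x" if "\<And>t. (h2_fun x has_vector_derivative v t) (at t)" for v
    using that d vector_derivative_unique_at by blast
  with d show ?thesis
    unfolding periodic_solution_def
    by (intro iffI exI[of _ "h2_d1 x"]) (auto simp: h2_periodic h2_d1_periodic)
qed

text \<open>The equation is autonomous and of second order, so a time reflection enters only through
  c^2 = 1; (A1) and (A2) move the permutation and the sign through \<open>f\<close>.\<close>

lemma periodic_solution_h2_act:
  fixes f :: "real^'n::finite \<Rightarrow> real^'n"
  assumes A1: "\<And>\<gamma> u. \<gamma> \<in> carrier \<Gamma> \<Longrightarrow> f (perm_act \<Gamma> \<phi> \<gamma> u) = perm_act \<Gamma> \<phi> \<gamma> (f u)"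
    and A2: "\<And>u. f (- u) = - f u"
    and x: "periodic_solution lam f (h2_fun x)" and g: "g \<in> carrier (GG \<Gamma>)"
  shows "periodic_solution lam f (h2_fun (h2_act \<Gamma> \<phi> g x))"
proof -
  obtain \<gamma> s A where g': "g = (\<gamma>, s, A)" "\<gamma> \<in> carrier \<Gamma>" "s = 1 \<or> s = - 1"
    using g by (cases g) (auto simp: GG_def Z2_def)
  obtain c d where c: "c = 1 \<or> c = -1" and A: "O2_time A = (\<lambda>t. d + c * t)"
    using O2_time_affine by blast
  let ?B = "\<lambda>u. of_int s *\<^sub>R perm_act \<Gamma> \<phi> \<gamma> u :: real^'n"
  have bl: "bounded_linear ?B"
    using bounded_linear_compose[OF bounded_linear_scaleR_right bounded_linear_perm_act] .
  have eq: "h2_fun (h2_act \<Gamma> \<phi> g x) = (\<lambda>t. ?B (h2_fun x (d + c * t)))"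
    by (simp add: g' h2_fun_act A)
  have "h2_d1 (h2_act \<Gamma> \<phi> g x) = (\<lambda>t. ?B (c *\<^sub>R h2_d1 x (d + c * t)))"
    using h2_d1_d2_eqI(1) h2_derivs_linear[OF bl h2_derivs_affine[OF c h2_derivs_h2[of x], of d]]
    unfolding eq[symmetric] by blast
  moreover have "((\<lambda>t. ?B (c *\<^sub>R h2_d1 x (d + c * t))) has_vector_derivative
      lam\<^sup>2 *\<^sub>R f (?B (h2_fun x (d + c * t)))) (at t)" for t
  proof -
    have l: "((\<lambda>t. d + c * t) has_vector_derivative c) (at t)"
      by (auto intro!: derivative_eq_intros)
    have "((h2_d1 x \<circ> (\<lambda>t. d + c * t)) has_vector_derivative
        c *\<^sub>R lam\<^sup>2 *\<^sub>R f (h2_fun x (d + c * t))) (at t)"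
      using x unfolding periodic_solution_h2_iff by (intro vector_diff_chain_at[OF l]) auto
    from bounded_linear.has_vector_derivative[OF bounded_linear_scaleR_right[of c] this]
    have "((\<lambda>t. c *\<^sub>R h2_d1 x (d + c * t)) has_vector_derivative
        lam\<^sup>2 *\<^sub>R f (h2_fun x (d + c * t))) (at t)"
      using c by (auto simp: o_def)
    from bounded_linear.has_vector_derivative[OF bl this]
    have "((\<lambda>t. ?B (c *\<^sub>R h2_d1 x (d + c * t))) has_vector_derivative
        ?B (lam\<^sup>2 *\<^sub>R f (h2_fun x (d + c * t)))) (at t)" .
    moreover have "?B (lam\<^sup>2 *\<^sub>R f u) = lam\<^sup>2 *\<^sub>R f (?B u)" for u
      using g'(3) A1[OF g'(2)] by (auto simp: A2 perm_act_scaleR)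
    ultimately show ?thesis by simp
  qed
  ultimately show ?thesis unfolding periodic_solution_h2_iff by (simp add: eq)
qed

text \<open>The uniform bound confines all values to a compact ball, on which \<open>f\<close> is
  uniformly continuous.\<close>

lemma uniform_limit_compose_continuous:
  fixes f :: "'v::euclidean_space \<Rightarrow> 'w::metric_space"
  assumes f: "continuous_on UNIV f" and x: "uniform_limit S x u sequentially"
    and b: "\<And>k t. t \<in> S \<Longrightarrow> norm (x k t) \<le> B"
  shows "uniform_limit S (\<lambda>k t. f (x k t)) (\<lambda>t. f (u t)) sequentially"
proof (rule uniform_limit_compose_uniformly_continuous_on[OF x])
  show "uniformly_continuous_on (cball 0 B) f"
    by (intro compact_uniformly_continuous continuous_on_subset[OF f]) auto
qed (use b in auto)

text \<open>A Palais-Smale property: bounded approximate zeros of the field accumulate at an exact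
  one. The limit z satisfies z'' = z + (\<lambda>^2 f(z) - z), so it solves the original
  equation.\<close>

lemma field_F_palais_smale:
  fixes f :: "'v::euclidean_space \<Rightarrow> 'v"
  assumes f: "continuous_on UNIV f" and b: "\<And>k. norm (x k) \<le> B"
    and lim: "(\<lambda>k. field_F lam f 1 (x k)) \<longlonglongrightarrow> 0"
  obtains r z where "strict_mono (r :: nat \<Rightarrow> nat)" "(\<lambda>k. x (r k)) \<longlonglongrightarrow> z"
    "periodic_solution lam f (h2_fun z)"
proof -
  let ?Y = "\<lambda>u t. lam\<^sup>2 *\<^sub>R f (u t) - u t"
  have Y: "continuous_on UNIV (?Y u)" if "continuous_on UNIV u" for u :: "real \<Rightarrow> 'v"
    by (intro continuous_intros continuous_on_compose2[OF f] that) auto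
  obtain r z where r: "strict_mono (r :: nat \<Rightarrow> nat)" "(\<lambda>k. x (r k)) \<longlonglongrightarrow> z"
    and z: "z = L_inv (?Y (h2_fun z))"
  proof (rule h2_compactness[of x B "\<lambda>k. ?Y (h2_fun (x k))" ?Y])
    show "continuous_on UNIV (?Y (h2_fun (x k)))" for k by (rule Y[OF h2_continuous(1)])
    show "(\<lambda>k. x k - L_inv (?Y (h2_fun (x k)))) \<longlonglongrightarrow> 0"
      using lim by (simp add: field_F_def)
    show "continuous_on UNIV (?Y u) \<and> (\<forall>t. ?Y u (t + 2 * pi) = ?Y u t)"
      if "continuous_on UNIV u" "\<And>t. u (t + 2 * pi) = u t" for u
      using that Y by simp
    fix u and r :: "nat \<Rightarrow> nat"
    assume ul: "uniform_limit UNIV (\<lambda>k. h2_fun (x (r k))) u sequentially"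
    have bd: "norm (h2_fun (x (r k)) t) \<le> (2 + 2 * pi) * B" for k t
      using h2_sup_bound(1)[of "x (r k)" t] mult_left_mono[OF b[of "r k"], of "2 + 2 * pi"]
        pi_ge_zero by linarith
    show "uniform_limit UNIV (\<lambda>k. ?Y (h2_fun (x (r k)))) (?Y u) sequentially"
      by (intro uniform_limit_minus ul
          bounded_linear.uniform_limit[OF bounded_linear_scaleR_right]
          uniform_limit_compose_continuous[OF f ul bd])
  qed (auto simp: b h2_periodic)
  have "(h2_d1 z has_vector_derivative lam\<^sup>2 *\<^sub>R f (h2_fun z t)) (at t)" for t
  proof -
    have "(h2_d1 (L_inv (?Y (h2_fun z))) has_vector_derivative
        h2_fun (L_inv (?Y (h2_fun z))) t + ?Y (h2_fun z) t) (at t)"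
      by (rule L_inv_ode) (simp_all add: Y h2_continuous h2_periodic)
    then show ?thesis by (simp flip: z)
  qed
  with r show thesis by (intro that) (auto simp: periodic_solution_h2_iff)
qed

lemma radius_R_pos:
  fixes f :: "'v::euclidean_space \<Rightarrow> 'v"
  assumes "lam > 0" "continuous_on UNIV f" "\<exists>M>0. \<forall>u. norm u > M \<longrightarrow> u \<bullet> f u > 0"
  shows "radius_R lam f > 0"
  unfolding radius_R_def using someI_ex[OF field_F_zeros_bounded[OF assms]] by blast

lemma radius_eps_pos:
  fixes f :: "real^'n::finite \<Rightarrow> real^'n"
  assumes \<phi>: "group_action \<Gamma> UNIV \<phi>" and m: "m \<ge> 1" and R: "radius_R lam f > 0"
    and f: "continuous_on UNIV f" and f0: "f 0 = 0" and D: "(f has_derivative D) (at 0)"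
    and nonres: "\<And>(j::nat) \<mu>. odd j \<Longrightarrow> \<mu> \<in> complex_spectrum (matrix D) \<Longrightarrow>
       complex_of_real ((real (j * m))\<^sup>2) + complex_of_real (lam\<^sup>2) * \<mu> \<noteq> 0"
  shows "radius_eps \<Gamma> \<phi> lam f m > 0"
proof -
  obtain e where e: "e > 0" "\<And>x. norm x \<le> e \<Longrightarrow>
      (\<forall>t. h2_fun x (t + pi / real m) = - h2_fun x t) \<Longrightarrow> field_F lam f 1 x = 0 \<Longrightarrow> x = 0"
    using field_F_zero_isolated[OF m f f0 D nonres] by blast
  let ?P = "\<lambda>\<epsilon>. 0 < \<epsilon> \<and> \<epsilon> < radius_R lam f \<and>
     (\<forall>x\<in>cball 0 \<epsilon> \<inter> h2_fix \<Gamma> \<phi> m. field_F lam f 1 x = 0 \<longrightarrow> x = 0)"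
  \<comment> \<open>Half of \<open>radius_R\<close> meets the strict inequality demanded in the
    choice of the small radius.\<close>
  have "?P (min e (radius_R lam f / 2))"
    using e R h2_fix_antiperiodic[OF \<phi>] by auto
  then have "?P (radius_eps \<Gamma> \<phi> lam f m)" unfolding radius_eps_def by (rule someI)
  then show ?thesis by blast
qed

lemma omega_H_key_solution:
  fixes \<Gamma> :: "'g monoid" and \<phi> :: "'g \<Rightarrow> 'n::finite \<Rightarrow> 'n" and f :: "real^'n \<Rightarrow> real^'n"
  assumes \<Gamma>: "group \<Gamma>" "finite (carrier \<Gamma>)" and \<phi>: "group_action \<Gamma> UNIV \<phi>"
    and eps: "radius_eps \<Gamma> \<phi> lam f m > 0" and f: "continuous_on UNIV f"
    and A1: "\<And>\<gamma> u. \<gamma> \<in> carrier \<Gamma> \<Longrightarrow> f (perm_act \<Gamma> \<phi> \<gamma> u) = perm_act \<Gamma> \<phi> \<gamma> (f u)"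
    and A2: "\<And>u. f (- u) = - f u"
    and H: "H \<subseteq> carrier (GG \<Gamma>)"
    and key: "conj_class (GG \<Gamma>) H \<in> Poly_Mapping.keys (omega_H \<Gamma> \<phi> lam f m)"
  shows "\<exists>x. periodic_solution lam f (h2_fun x) \<and> \<not> h2_fun x constant_on UNIV \<and>
    H \<subseteq> stabilizer (GG \<Gamma>) (h2_act \<Gamma> \<phi>) x"
proof -
  interpret G: group "GG \<Gamma>" by (rule group_GG[OF \<Gamma>(1)])
  let ?act = "h2_act \<Gamma> \<phi>"
  let ?E = "h2_fix \<Gamma> \<phi> m" and ?R = "radius_R lam f" and ?\<epsilon> = "radius_eps \<Gamma> \<phi> lam f m"
  let ?U = "(ball 0 ?R - cball 0 ?\<epsilon>) \<inter> ?E"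
  have "antisymp_on (Phi0 (GG \<Gamma>) (GG_topology \<Gamma>)) class_le"
    using G.antisymp_on_class_le[OF GG_closed_subgroup_conj[OF \<Gamma>]] by blast
  from Gdeg_near_zeros(2)[OF key[unfolded omega_H_def] G.transp_on_class_le this G.reflp_on_class_le]
  obtain d where d: "d \<in> Phi0 (GG \<Gamma>) (GG_topology \<Gamma>)" "class_le (conj_class (GG \<Gamma>) H) d"
    and near: "\<And>\<delta>. \<delta> > 0 \<Longrightarrow>
      \<exists>x\<in>fixed_points ?act (class_rep d) ?U. norm (field_F lam f 1 x) < \<delta>" by blast
  note K = G.conj_class_class_rep[OF d(1)]
  \<comment> \<open>The approximate zeros are fixed by the chosen representative of
    \<open>d\<close>, which contains \<open>H\<close> only after conjugation by this
    \<open>g\<close>.\<close>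
  obtain g where g: "g \<in> carrier (GG \<Gamma>)"
    "\<And>h. h \<in> H \<Longrightarrow> g \<otimes>\<^bsub>GG \<Gamma>\<^esub> h \<otimes>\<^bsub>GG \<Gamma>\<^esub> inv\<^bsub>GG \<Gamma>\<^esub> g \<in> class_rep d"
    using d(2) G.class_le_conj_class_iff[OF H K(1)] K(2) by auto
  have "\<exists>x. x \<in> fixed_points ?act (class_rep d) ?U \<and> norm (field_F lam f 1 x) < inverse (real (Suc k))" for k
    using near[of "inverse (real (Suc k))"] by auto
  then obtain x where x: "\<And>k. x k \<in> fixed_points ?act (class_rep d) ?U"
    "\<And>k. norm (field_F lam f 1 (x k)) < inverse (real (Suc k))" by metis
  have "(\<lambda>k. field_F lam f 1 (x k)) \<longlonglongrightarrow> 0"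
  proof (rule tendsto_norm_zero_cancel,
      rule tendsto_sandwich[OF _ _ tendsto_const LIMSEQ_inverse_real_of_nat])
    show "\<forall>\<^sub>F k in sequentially. norm (field_F lam f 1 (x k)) \<le> inverse (real (Suc k))"
      using x(2) by (simp add: less_imp_le)
  qed simp
  moreover have "norm (x k) \<le> ?R" for k
    using x(1)[of k] by (auto simp: fixed_points_def)
  ultimately obtain r z where r: "strict_mono (r :: nat \<Rightarrow> nat)" "(\<lambda>k. x (r k)) \<longlonglongrightarrow> z"
    and z: "periodic_solution lam f (h2_fun z)"
    using field_F_palais_smale[OF f] by metis
  \<comment> \<open>The strict bound on the annulus weakens in the limit, but it still excludes z =
    0.\<close>
  have "norm z \<ge> ?\<epsilon>"
  proof (rule LIMSEQ_le_const[OF tendsto_norm[OF r(2)]])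
    show "\<exists>N. \<forall>n\<ge>N. ?\<epsilon> \<le> norm (x (r n))"
      using x(1) by (auto simp: fixed_points_def not_le less_imp_le)
  qed
  then have z0: "z \<noteq> 0" using eps by auto
  have "?act k (x (r n)) = x (r n)" if "k \<in> Z2md \<Gamma> m \<union> class_rep d" for k n
    using x(1)[of "r n"] that by (auto simp: fixed_points_def h2_fix_def)
  then have fixd: "?act k z = z" if "k \<in> Z2md \<Gamma> m \<union> class_rep d" for k
    using that closed_fixed_points_h2_act[OF r(2)] by blast
  then have "z \<in> ?E" by (simp add: h2_fix_def fixed_points_def)
  note anti = h2_fix_antiperiodic[OF \<phi> this]
  have nc: "\<not> h2_fun z constant_on UNIV"
  proof
    assume "h2_fun z constant_on UNIV"
    then obtain c where c: "\<And>t. h2_fun z t = c" by (auto simp: constant_on_def)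
    with anti[of 0] have "c = - c" by simp
    then have "c = 0" by (simp add: vec_eq_iff)
    with c z0 show False by (simp add: h2_fun_inject[symmetric] h2_fun_zero fun_eq_iff)
  qed
  \<comment> \<open>The isotropy group of this translate is that of z conjugated by the inverse of
    g, so it contains \<open>H\<close>. Acting by g leads back to z, so the translate is not
    constant either.\<close>
  let ?x = "?act (inv\<^bsub>GG \<Gamma>\<^esub> g) z"
  have gi: "inv\<^bsub>GG \<Gamma>\<^esub> g \<in> carrier (GG \<Gamma>)" using g(1) by simp
  have "periodic_solution lam f (h2_fun ?x)"
    by (rule periodic_solution_h2_act[OF A1 A2 z gi])
  moreover have "\<not> h2_fun ?x constant_on UNIV"
    using nc h2_fun_act_constant_on[of ?x \<Gamma> \<phi> g] h2_act_inv[OF \<phi> gi, of z] g(1) by auto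
  moreover have "H \<subseteq> stabilizer (GG \<Gamma>) ?act ?x"
  proof
    fix h assume h: "h \<in> H"
    then have hG: "h \<in> carrier (GG \<Gamma>)" using H by blast
    let ?k = "g \<otimes>\<^bsub>GG \<Gamma>\<^esub> h \<otimes>\<^bsub>GG \<Gamma>\<^esub> inv\<^bsub>GG \<Gamma>\<^esub> g"
    have kG: "?k \<in> carrier (GG \<Gamma>)" using hG g(1) by simp
    have "inv\<^bsub>GG \<Gamma>\<^esub> g \<otimes>\<^bsub>GG \<Gamma>\<^esub> ?k = (inv\<^bsub>GG \<Gamma>\<^esub> g \<otimes>\<^bsub>GG \<Gamma>\<^esub> g) \<otimes>\<^bsub>GG \<Gamma>\<^esub> (h \<otimes>\<^bsub>GG \<Gamma>\<^esub> inv\<^bsub>GG \<Gamma>\<^esub> g)"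
      using hG g(1) by (simp only: G.m_assoc G.m_closed G.inv_closed)
    then have e: "inv\<^bsub>GG \<Gamma>\<^esub> g \<otimes>\<^bsub>GG \<Gamma>\<^esub> ?k = h \<otimes>\<^bsub>GG \<Gamma>\<^esub> inv\<^bsub>GG \<Gamma>\<^esub> g" using hG g(1) by simp
    have "?act h ?x = ?act (inv\<^bsub>GG \<Gamma>\<^esub> g) (?act ?k z)"
      unfolding h2_act_mult[OF \<phi> hG gi, symmetric] h2_act_mult[OF \<phi> gi kG, symmetric] e ..
    also have "\<dots> = ?x" using fixd g(2)[OF h] by simp
    finally show "h \<in> stabilizer (GG \<Gamma>) ?act ?x" using hG by (simp add: stabilizer_def)
  qed
  ultimately show ?thesis by blast
qed

text \<open>The positive odd multiples of m are the \<open>j * m\<close> with j an odd natural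
  number. Distinctness of the classes is expressed by \<open>inj_on\<close>, so that no two summands
  of the expansion can merge or cancel.\<close>

theorem theorem3p1:
  fixes \<Gamma> :: "'g monoid" and \<phi> :: "'g \<Rightarrow> 'n::finite \<Rightarrow> 'n"
    and f :: "real^'n \<Rightarrow> real^'n" and Df :: "real^'n \<Rightarrow> ((real^'n) \<Rightarrow>\<^sub>L (real^'n))"
    and lam :: real and m :: nat
  assumes "group \<Gamma>" and "finite (carrier \<Gamma>)" and "group_action \<Gamma> UNIV \<phi>"
    and "lam > 0" and "m \<ge> 1"
    and C1: "\<And>u. (f has_derivative blinfun_apply (Df u)) (at u)" "continuous_on UNIV Df"
    and A1: "\<And>\<gamma> u. \<gamma> \<in> carrier \<Gamma> \<Longrightarrow> f (perm_act \<Gamma> \<phi> \<gamma> u) = perm_act \<Gamma> \<phi> \<gamma> (f u)"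
    and A2: "\<And>u. f (- u) = - f u"
    and A3: "\<exists>M>0. \<forall>u. norm u > M \<longrightarrow> u \<bullet> f u > 0"
    and nonres: "\<And>j \<mu>. odd (j::nat) \<Longrightarrow> \<mu> \<in> complex_spectrum (matrix (blinfun_apply (Df 0))) \<Longrightarrow>
       complex_of_real ((real (j * m))\<^sup>2) + complex_of_real (lam\<^sup>2) * \<mu> \<noteq> 0"
  shows "(omega_H \<Gamma> \<phi> lam f m \<noteq> 0 \<longrightarrow>
            (\<exists>x. periodic_solution lam f x \<and> \<not> x constant_on UNIV))
       \<and> (\<forall>(r::nat) (n :: nat \<Rightarrow> int) (Hs :: nat \<Rightarrow> ('g \<times> int \<times> (real^2^2)) set).
            (\<forall>j\<in>{1..r}. n j \<noteq> 0 \<and> Hs j \<in> Phi0_subgroups (GG \<Gamma>) (GG_topology \<Gamma>)) \<and>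
            inj_on (\<lambda>j. conj_class (GG \<Gamma>) (Hs j)) {1..r} \<and>
            omega_H \<Gamma> \<phi> lam f m =
              (\<Sum>j\<in>{1..r}. frag_cmul (n j) (frag_of (conj_class (GG \<Gamma>) (Hs j)))) \<longrightarrow>
            (\<forall>j\<in>{1..r}. \<exists>x :: (real^'n) h2.
               periodic_solution lam f (h2_fun x) \<and> \<not> h2_fun x constant_on UNIV \<and>
               Hs j \<subseteq> stabilizer (GG \<Gamma>) (h2_act \<Gamma> \<phi>) x))"
proof -
  have f: "continuous_on UNIV f"
    using C1(1) by (meson continuous_at_imp_continuous_on has_derivative_continuous)
  have f0: "f 0 = 0" using A2[of 0] by (simp add: vec_eq_iff)
  have R: "radius_R lam f > 0" by (rule radius_R_pos[OF \<open>lam > 0\<close> f A3])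
  have eps: "radius_eps \<Gamma> \<phi> lam f m > 0"
    by (rule radius_eps_pos[OF \<open>group_action \<Gamma> UNIV \<phi>\<close> \<open>m \<ge> 1\<close> R f f0 C1(1) nonres])
  note sol = omega_H_key_solution[OF \<open>group \<Gamma>\<close> \<open>finite (carrier \<Gamma>)\<close> \<open>group_action \<Gamma> UNIV \<phi>\<close> eps f A1 A2]
  interpret G: group "GG \<Gamma>" by (rule group_GG[OF \<open>group \<Gamma>\<close>])
  have antisym: "antisymp_on (Phi0 (GG \<Gamma>) (GG_topology \<Gamma>)) class_le"
    using G.antisymp_on_class_le[OF GG_closed_subgroup_conj[OF \<open>group \<Gamma>\<close> \<open>finite (carrier \<Gamma>)\<close>]] by blast
  show ?thesis
  proof (intro conjI impI allI ballI)
    assume "omega_H \<Gamma> \<phi> lam f m \<noteq> 0"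
    \<comment> \<open>A nonzero invariant has a class in its support; that class belongs to
      \<open>Phi0\<close> and so comes from an actual subgroup, to which \<open>sol\<close>
      applies.\<close>
    then obtain c where c: "c \<in> Poly_Mapping.keys (omega_H \<Gamma> \<phi> lam f m)"
      by (metis keys_eq_empty ex_in_conv)
    from Gdeg_near_zeros(1)[OF c[unfolded omega_H_def] G.transp_on_class_le antisym G.reflp_on_class_le]
    obtain H where "subgroup H (GG \<Gamma>)" "c = conj_class (GG \<Gamma>) H"
      by (auto simp: Phi0_def Phi0_subgroups_def)
    with sol[of H] c subgroup.subset show "\<exists>x. periodic_solution lam f x \<and> \<not> x constant_on UNIV"
      by blast
  next
    fix r :: nat and n :: "nat \<Rightarrow> int" and Hs :: "nat \<Rightarrow> ('g \<times> int \<times> (real^2^2)) set" and j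
    assume *: "(\<forall>j\<in>{1..r}. n j \<noteq> 0 \<and> Hs j \<in> Phi0_subgroups (GG \<Gamma>) (GG_topology \<Gamma>)) \<and>
        inj_on (\<lambda>j. conj_class (GG \<Gamma>) (Hs j)) {1..r} \<and>
        omega_H \<Gamma> \<phi> lam f m =
          (\<Sum>j\<in>{1..r}. frag_cmul (n j) (frag_of (conj_class (GG \<Gamma>) (Hs j))))"
      and j: "j \<in> {1..r}"
    let ?c = "\<lambda>j. conj_class (GG \<Gamma>) (Hs j)"
    have "Poly_Mapping.lookup (omega_H \<Gamma> \<phi> lam f m) (?c j) =
        (\<Sum>i\<in>{1..r}. n i * Poly_Mapping.lookup (frag_of (?c i)) (?c j))"
      using * by (simp add: lookup_sum)
    \<comment> \<open>Injectivity of the classes isolates the j-th coefficient.\<close>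
    also have "\<dots> = (\<Sum>i\<in>{1..r}. if i = j then n i else 0)"
      using * j by (intro sum.cong) (auto simp: lookup_frag_of dest: inj_onD)
    also have "\<dots> = n j" using j by simp
    finally have "?c j \<in> Poly_Mapping.keys (omega_H \<Gamma> \<phi> lam f m)"
      using * j by (simp add: in_keys_iff)
    moreover have "Hs j \<subseteq> carrier (GG \<Gamma>)"
      using * j by (intro subgroup.subset) (auto simp: Phi0_subgroups_def)
    ultimately show "\<exists>x :: (real^'n) h2.
        periodic_solution lam f (h2_fun x) \<and> \<not> h2_fun x constant_on UNIV \<and>
        Hs j \<subseteq> stabilizer (GG \<Gamma>) (h2_act \<Gamma> \<phi>) x"
      by (intro sol)
  qed
qed

end
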